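(* Let $\mathcal{N}$ be a finite-dimensional stopping model that is closed under pgf composition, connected, and has a non-empty interior. Assume the probabilities $p_i(N)=\Pr(N=i)$ are continuously differentiable with respect to the parameters for all $i\ge 1$. Then $\mathcal{N}$ consists of a family of random variables that commute. More precisely, there is a positive integer-valued random variable $N_0$ with $0<p_1(N_0)<1$ such that $\mathcal{N}\subset\mathcal{N}_{N_0}$ and the interior of $\mathcal{N}$ is $$\mathring{\mathcal{N}}=\{N_\theta\in\mathcal{N}_{N_0}\mid \theta\in(0,\theta_{\mathcal{N}})\}$$ for some $\theta_{\mathcal{N}}\in(0,\theta_{K_{N_0}}]$.
   Context: All random variables $N$ here are positive integer-valued ($\Pr(N=0)=0$) with probability generating function (pgf) $h_N(t)=\sum_{i\ge1}p_i(N)t^i$, $p_i(N)=\Pr(N=i)$; random variables are identified with their distributions. A stopping model $\mathcal{N}$ is a family of such random variables. It is finite-dimensional if, for some positive integer $m$, it is either globally parametrized by a vector $\delta$ in a parameter space in $\mathbb{R}^m$ that is an open set (possibly with boundary), or it is an $m$-dimensional differentiable manifold (possibly with boundary) embedded in the space of probability sequences, so that each $N\in\mathcal{N}$ admits a local parametrization by $m$ coordinates. Interior is relative to this $m$-dimensional structure. $N_1\circ N_2$ is the random variable with pgf $h_{N_1}\circ h_{N_2}$; $\mathcal{N}$ is closed under pgf composition if $N_1,N_2\in\mathcal{N}$ implies $N_1\circ N_2\in\mathcal{N}$. $N_1,N_2$ commute if $h_{N_1}\circ h_{N_2}=h_{N_2}\circ h_{N_1}$. For $N_0$ different from the degenerate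 variable $N_I$ ($h_{N_I}(t)=t$), $\mathcal{N}_{N_0}$ is the set of all positive integer-valued random variables $N$ that commute with $N_0$. When $0<p_1(N_0)<1$, each element $N$ of $\mathcal{N}_{N_0}$ is uniquely determined by $\theta=h_N'(0)=p_1(N)$ and is denoted $N_\theta$; $\mathcal{D}_{N_0}\subset(0,1]$ denotes the set of all these values $\theta$, and, when $\mathcal{D}_{N_0}$ has non-empty interior, $\theta_{K_{N_0}}=\sup\{\theta\mid(0,\theta]\subset\mathcal{D}_{N_0}\}\in(0,1]$. *)

theory Defs
  imports "HOL-Probability.Probability"
begin

section \<open>Probability generating functions\<close>

text \<open>
  A random variable is identified with its distribution, a \<^typ>\<open>nat pmf\<close>; it is positive
  integer-valued if \<^prop>\<open>pmf N 0 = 0\<close>.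
\<close>

definition pgf :: "nat pmf \<Rightarrow> real \<Rightarrow> real" where
  "pgf N t = (\<Sum>i. pmf N i * t ^ i)"

definition pgf_comp :: "nat pmf \<Rightarrow> nat pmf \<Rightarrow> nat pmf"  (infixl "\<circ>\<^sub>g" 55) where
  "N1 \<circ>\<^sub>g N2 = (THE N. \<forall>t\<in>{0..1}. pgf N t = pgf N1 (pgf N2 t))"

definition pgf_commute :: "nat pmf \<Rightarrow> nat pmf \<Rightarrow> bool" where
  "pgf_commute N1 N2 \<longleftrightarrow> (\<forall>t\<in>{0..1}. pgf N1 (pgf N2 t) = pgf N2 (pgf N1 t))"

definition closed_under_pgf_comp :: "nat pmf set \<Rightarrow> bool" where
  "closed_under_pgf_comp \<N> \<longleftrightarrow> (\<forall>N1\<in>\<N>. \<forall>N2\<in>\<N>. N1 \<circ>\<^sub>g N2 \<in> \<N>)"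

definition commutant :: "nat pmf \<Rightarrow> nat pmf set" where
  "commutant N0 = {N. pmf N 0 = 0 \<and> pgf_commute N N0}"

definition theta_set :: "nat pmf \<Rightarrow> real set" where
  "theta_set N0 = (\<lambda>N. pmf N 1) ` commutant N0"

text \<open>
  Nonpositive \<open>\<theta>\<close> satisfy the condition below trivially, so the supremum is taken over a
  nonempty set, and \<open>theta_K N0 > 0\<close> says that \<open>theta_set N0\<close> contains some \<open>(0, \<theta>]\<close>, \<open>\<theta> > 0\<close>.
\<close>

definition theta_K :: "nat pmf \<Rightarrow> real" where
  "theta_K N0 = Sup {\<theta>. {0<..\<theta>} \<subseteq> theta_set N0}"


section \<open>Well-definedness of the composition\<close>

lemma summable_pgf:
  assumes "t \<in> {0..1}"
  shows "summable (\<lambda>i. pmf N i * t ^ i)"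
proof (rule summable_comparison_test'[of "pmf N"])
  show "summable (pmf N)"
  proof (rule summableI_nonneg_bounded[where x=1])
    show "(\<Sum>i<n. pmf N i) \<le> 1" for n
      by (metis finite_lessThan measure_measure_pmf_finite measure_pmf.prob_le_1)
  qed simp
  show "norm (pmf N i * t ^ i) \<le> pmf N i" for i
    using assms by (auto simp: abs_mult mult_left_le power_le_one)
qed

lemma nn_integral_pgf:
  assumes "t \<in> {0..1}"
  shows "(\<integral>\<^sup>+n. ennreal (t ^ n) \<partial>measure_pmf N) = ennreal (pgf N t)"
proof -
  have "(\<integral>\<^sup>+n. ennreal (t ^ n) \<partial>measure_pmf N) = (\<Sum>i. ennreal (pmf N i * t ^ i))"
    using assms by (simp add: nn_integral_measure_pmf nn_integral_count_space_nat ennreal_mult)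
  also have "\<dots> = ennreal (pgf N t)"
    unfolding pgf_def using assms by (intro suminf_ennreal2 summable_pgf) auto
  finally show ?thesis .
qed

lemma pgf_nonneg: "t \<in> {0..1} \<Longrightarrow> 0 \<le> pgf N t"
  unfolding pgf_def by (intro suminf_nonneg summable_pgf) auto

lemma pgf_le_1:
  assumes "t \<in> {0..1}"
  shows "pgf N t \<le> 1"
proof -
  have "(\<integral>\<^sup>+n. ennreal (t ^ n) \<partial>measure_pmf N) \<le> (\<integral>\<^sup>+n. 1 \<partial>measure_pmf N)"
    using assms by (intro nn_integral_mono) (auto simp: power_le_one)
  then show ?thesis
    using assms by (simp add: nn_integral_pgf measure_pmf.emeasure_space_1)
qed

lemma pgf_in_01: "t \<in> {0..1} \<Longrightarrow> pgf N t \<in> {0..1}"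
  by (simp add: pgf_nonneg pgf_le_1)

lemma pgf_inject:
  assumes eq: "\<And>t. t \<in> {0..1} \<Longrightarrow> pgf M t = pgf N t"
  shows "M = N"
proof (rule pmf_eqI)
  define d where "d i = pmf M i - pmf N i" for i
  have dsum: "(\<lambda>i. d i * t ^ i) sums 0" if "t \<in> {0..1}" for t
  proof -
    have "(\<lambda>i. pmf M i * t ^ i - pmf N i * t ^ i) sums (pgf M t - pgf N t)"
      unfolding pgf_def by (intro sums_diff summable_sums summable_pgf that)
    then show ?thesis
      using eq[OF that] by (simp add: d_def algebra_simps)
  qed
  have "d m = 0" for m
  proof (induction m rule: less_induct)
    case (less m)
    have tail: "(\<lambda>i. d (i + m) * t ^ i) sums 0" if "t \<in> {0<..1}" for t
    proof -
      have "(\<lambda>i. d (i + m) * t ^ (i + m)) sums 0"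
        using sums_split_initial_segment[OF dsum[of t], of m] that less by simp
      then have "(\<lambda>i. (d (i + m) * t ^ (i + m)) / t ^ m) sums (0 / t ^ m)"
        by (rule sums_divide)
      then show ?thesis
        using that by (simp add: power_add)
    qed
    define g where "g t = (\<Sum>i. d (i + m) * t ^ i)" for t
    have "(g \<longlongrightarrow> d m) (at 0)"
    proof -
      have "(\<lambda>i. d (i + m) * t ^ i) sums g t" if "norm t < 1" for t :: real
      proof -
        have "summable (\<lambda>i. d (i + m) * t ^ i)"
          by (rule powser_inside[where x=1])
            (use that tail[of 1] in \<open>auto simp: sums_iff\<close>)
        then show ?thesis
          unfolding g_def by (rule summable_sums)
      qed
      from powser_limit_0[OF zero_less_one this] show ?thesis by simp
    qed
    then have "(g \<longlongrightarrow> d m) (at_right 0)"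
      by (rule tendsto_mono[OF at_le, rotated]) simp
    moreover have "\<forall>\<^sub>F t in at_right 0. g t = 0"
      unfolding eventually_at_right_field
      by (rule exI[of _ 1]) (use tail in \<open>auto simp: g_def sums_iff\<close>)
    then have "(g \<longlongrightarrow> 0) (at_right 0)"
      by (rule tendsto_eventually)
    ultimately show "d m = 0"
      by (intro tendsto_unique[OF trivial_limit_at_right_real])
  qed
  then show "pmf M i = pmf N i" for i
    by (simp add: d_def)
qed

lemma nn_integral_replicate_pmf:
  assumes "t \<in> {0..1}"
  shows "(\<integral>\<^sup>+xs. ennreal (t ^ sum_list xs) \<partial>measure_pmf (replicate_pmf n N)) = ennreal (pgf N t ^ n)"
proof (induction n)
  case (Suc n)
  have "(\<integral>\<^sup>+xs. ennreal (t ^ sum_list xs) \<partial>measure_pmf (replicate_pmf (Suc n) N))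
      = (\<integral>\<^sup>+x. ennreal (t ^ x) * ennreal (pgf N t ^ n) \<partial>measure_pmf N)"
    using assms by (simp add: power_add ennreal_mult nn_integral_cmult Suc)
  also have "\<dots> = ennreal (pgf N t ^ Suc n)"
    using assms by (simp add: nn_integral_multc nn_integral_pgf ennreal_mult' pgf_nonneg)
  finally show ?case .
qed simp

lemma pgf_comp_exists_unique:
  "\<exists>!N. \<forall>t\<in>{0..1}. pgf N t = pgf N1 (pgf N2 t)"
proof (rule ex_ex1I)
  define N where "N = N1 \<bind> (\<lambda>n. map_pmf sum_list (replicate_pmf n N2))"
  have "pgf N t = pgf N1 (pgf N2 t)" if t: "t \<in> {0..1}" for t
  proof -
    have "ennreal (pgf N t) = (\<integral>\<^sup>+n. ennreal (t ^ n) \<partial>measure_pmf N)"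
      by (rule nn_integral_pgf[OF t, symmetric])
    also have "\<dots> = (\<integral>\<^sup>+n. ennreal (pgf N2 t ^ n) \<partial>measure_pmf N1)"
      unfolding N_def using nn_integral_replicate_pmf[OF t] by simp
    also have "\<dots> = ennreal (pgf N1 (pgf N2 t))"
      by (intro nn_integral_pgf pgf_in_01 t)
    finally show ?thesis
      using t by (simp add: pgf_nonneg pgf_in_01 del: atLeastAtMost_iff)
  qed
  then show "\<exists>N. \<forall>t\<in>{0..1}. pgf N t = pgf N1 (pgf N2 t)"
    by blast
qed (rule pgf_inject, auto)

lemma pgf_pgf_comp: "t \<in> {0..1} \<Longrightarrow> pgf (N1 \<circ>\<^sub>g N2) t = pgf N1 (pgf N2 t)"
  using theI'[OF pgf_comp_exists_unique, of N1 N2] unfolding pgf_comp_def by blast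


section \<open>Finite-dimensional stopping models\<close>

text \<open>
  \<open>S\<close> need not be open: at points of \<open>S\<close> outside its interior the derivative is taken within \<open>S\<close>,
  and the derivatives have to fit together continuously on all of \<open>S\<close>.
\<close>

definition C1_on :: "'a::real_normed_vector set \<Rightarrow> ('a \<Rightarrow> 'b::real_normed_vector) \<Rightarrow> bool" where
  "C1_on S f \<longleftrightarrow> (\<exists>f' :: 'a \<Rightarrow> 'a \<Rightarrow>\<^sub>L 'b. continuous_on S f' \<and>
     (\<forall>x\<in>S. (f has_derivative blinfun_apply (f' x)) (at x within S)))"

text \<open>
  The \<open>m\<close>-dimensional structure of a model, where \<open>m = CARD('m) \<ge> 1\<close>: either a single global
  parametrization \<open>\<gamma>\<close> on a parameter space \<open>D\<close>, or an atlas given by local parametrizations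
  (inverses of charts) \<open>(V, \<phi>)\<close>.
\<close>

datatype 'm::finite model_structure =
    Global "(real ^ 'm) set" "real ^ 'm \<Rightarrow> nat pmf"
  | Atlas "((real ^ 'm) set \<times> (real ^ 'm \<Rightarrow> nat pmf)) set"

text \<open>
  An open set possibly with boundary is an open set together with an arbitrary part of its
  topological boundary. The parameters identify the members of the model.
\<close>

definition global_parametrization ::
    "(real ^ 'm) set \<Rightarrow> (real ^ 'm \<Rightarrow> nat pmf) \<Rightarrow> nat pmf set \<Rightarrow> bool" where
  "global_parametrization D \<gamma> \<N> \<longleftrightarrow>
     D \<subseteq> closure (interior D) \<and> inj_on \<gamma> D \<and> \<gamma> ` D = \<N>"

text \<open>
  A manifold with boundary embedded in the space of probability sequences. Probability sequences
  are topologized as elements of \<^typ>\<open>nat \<Rightarrow> real\<close>, i.e. by pointwise convergence; on probability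
  sequences this topology coincides with the one of \<open>\<ell>\<^sup>1\<close> (Scheffe).
\<close>

definition embedded_manifold ::
    "((real ^ 'm) set \<times> (real ^ 'm \<Rightarrow> nat pmf)) set \<Rightarrow> nat pmf set \<Rightarrow> bool" where
  "embedded_manifold A \<N> \<longleftrightarrow>
     \<N> = (\<Union>(V, \<phi>)\<in>A. \<phi> ` V) \<and>
     (\<forall>(V, \<phi>)\<in>A.
        (\<exists>k. openin (top_of_set {x. 0 \<le> x $ k}) V) \<and>
        openin (top_of_set (pmf ` \<N>)) (pmf ` \<phi> ` V) \<and>
        (\<exists>\<psi>. homeomorphism V (pmf ` \<phi> ` V) (\<lambda>x. pmf (\<phi> x)) \<psi>)) \<and>
     (\<forall>(V, \<phi>)\<in>A. \<forall>(W, \<eta>)\<in>A.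
        C1_on {x \<in> V. \<phi> x \<in> \<eta> ` W} (\<lambda>x. inv_into W \<eta> (\<phi> x)))"

primrec finite_dimensional :: "'m::finite model_structure \<Rightarrow> nat pmf set \<Rightarrow> bool" where
  "finite_dimensional (Global D \<gamma>) \<N> \<longleftrightarrow> global_parametrization D \<gamma> \<N>"
| "finite_dimensional (Atlas A) \<N> \<longleftrightarrow> embedded_manifold A \<N>"

primrec model_connected :: "'m::finite model_structure \<Rightarrow> nat pmf set \<Rightarrow> bool" where
  "model_connected (Global D \<gamma>) \<N> \<longleftrightarrow> connected D"
| "model_connected (Atlas A) \<N> \<longleftrightarrow> connected (pmf ` \<N>)"

text \<open>
  For an atlas this is the manifold interior, the points \<open>x \<in> V\<close> that lie in the interior of the
  half-space being exactly those in \<open>interior V\<close>.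
\<close>

primrec model_interior :: "'m::finite model_structure \<Rightarrow> nat pmf set" where
  "model_interior (Global D \<gamma>) = \<gamma> ` interior D"
| "model_interior (Atlas A) = (\<Union>(V, \<phi>)\<in>A. \<phi> ` interior V)"

primrec C1_in_parameters :: "'m::finite model_structure \<Rightarrow> (nat pmf \<Rightarrow> real) \<Rightarrow> bool" where
  "C1_in_parameters (Global D \<gamma>) F \<longleftrightarrow> C1_on D (\<lambda>x. F (\<gamma> x))"
| "C1_in_parameters (Atlas A) F \<longleftrightarrow> (\<forall>(V, \<phi>)\<in>A. C1_on V (\<lambda>x. F (\<phi> x)))"

end

theory Submission
  imports Defs "HOL-Complex_Analysis.Complex_Analysis"
begin

text \<open>
  Let \<open>H\<close> be a curve in the model through \<open>f\<close> with velocity \<open>D \<noteq> 0\<close>, and regard \<open>Y = D / f'\<close> as a formal vector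
  field at 0. Composing copies of the curve with members of the model gives families of pgfs in many parameters;
  as the model is finite-dimensional, the pull-backs \<open>Y(w) / w'\<close> of \<open>Y\<close> along the pgfs \<open>w\<close> of the model span a
  finite-dimensional space. An element \<open>Z\<close> of this space that vanishes to the highest order at 0 is a common
  eigenvector: \<open>Z(w) = k(w) w' Z\<close> for all \<open>w\<close>. This equation forces \<open>Z\<close> to converge and extends it to the unit
  interval, where a primitive of \<open>1 / \<bar>Z\<bar>\<close> conjugates every \<open>w\<close> to an affine map. Since \<open>w\<close> maps the open unit
  interval onto itself and, unless \<open>w(t) = t\<close>, without fixed points, these affine maps are all translations or have a common
  fixed point; in either case they commute.

  If all members but \<open>w(t) = t\<close> had \<open>p\<^sub>1 = 0\<close>, they would be determined by their order at 0 and the model would be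
  countable. So some member \<open>N0\<close> has \<open>0 < p\<^sub>1 < 1\<close>, the members are determined by \<open>p\<^sub>1\<close> and depend continuously
  on it, and the model is one-dimensional.
\<close>

section \<open>Evaluation of power series\<close>

text \<open>The smoothness hypothesis concerns each coefficient separately and gives no bound on the
  growth of the coefficients of \<open>D\<close>. The linear algebra therefore takes place among
  formal series, and convergence is regained only for \<open>Z\<close>, from its functional
  equation. Finite dimension enters through measure: without a finite span, composition would yield
  a family in \<open>m + 1\<close> parameters with injective derivative inside a model of dimension
  \<open>m\<close>. The equation for \<open>Z\<close> says that \<open>w\<close> preserves the line
  spanned by a vector field, not the field itself. Such maps are affine in the time parameter of the
  flow, and affine maps need not commute. What excludes, say, a translation next to a dilation is
  that all members other than the identity move every point of the open unit interval towards 0 and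
  map this interval onto itself. The absolute value in the primitive makes it increasing whatever
  the sign of \<open>Z\<close>.\<close>

definition abs_conv_at :: "real fps \<Rightarrow> real \<Rightarrow> bool" where
  "abs_conv_at A t \<longleftrightarrow> summable (\<lambda>n. norm (fps_nth A n * t ^ n))"

lemma abs_conv_sums: "abs_conv_at A t \<Longrightarrow> (\<lambda>n. fps_nth A n * t ^ n) sums eval_fps A t"
  unfolding abs_conv_at_def eval_fps_def by (rule summable_sums[OF summable_norm_cancel])

lemma abs_conv_at_mono:
  assumes "abs_conv_at A t" "\<bar>s\<bar> \<le> \<bar>t\<bar>"
  shows "abs_conv_at A s"
proof -
  have "norm (norm (fps_nth A n * s ^ n)) \<le> norm (fps_nth A n * t ^ n)" for n
    using power_mono[OF assms(2), of n] by (auto simp: abs_mult power_abs intro!: mult_left_mono)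
  then show ?thesis
    using assms(1) unfolding abs_conv_at_def by (intro summable_comparison_test[OF _ assms(1)[unfolded abs_conv_at_def]]) auto
qed

lemma abs_conv_radius:
  assumes "abs_conv_at A t"
  shows "ereal \<bar>t\<bar> \<le> fps_conv_radius A"
proof -
  have "summable (\<lambda>n. fps_nth A n * t ^ n)"
    using assms unfolding abs_conv_at_def by (rule summable_norm_cancel)
  then have "ereal (norm t) \<le> conv_radius (fps_nth A)"
    by (rule conv_radius_geI)
  then show ?thesis by (simp add: fps_conv_radius_def)
qed

lemma radius_abs_conv:
  assumes "ereal \<bar>t\<bar> < fps_conv_radius A"
  shows "abs_conv_at A t"
  using abs_summable_in_conv_radius[of t "fps_nth A"] assms
  by (simp add: abs_conv_at_def fps_conv_radius_def)

lemma abs_conv_const_mult: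
  assumes "abs_conv_at A t"
  shows "abs_conv_at (fps_const c * A) t" "eval_fps (fps_const c * A) t = c * eval_fps A t"
proof -
  show "abs_conv_at (fps_const c * A) t"
    using summable_mult[OF assms[unfolded abs_conv_at_def], of "\<bar>c\<bar>"]
    by (simp add: abs_conv_at_def abs_mult mult.assoc)
  show "eval_fps (fps_const c * A) t = c * eval_fps A t"
    using sums_mult[OF abs_conv_sums[OF assms], of c]
    by (simp add: eval_fps_def sums_iff mult.assoc)
qed

lemma abs_conv_mult:
  assumes A: "abs_conv_at A t" and B: "abs_conv_at B t"
  shows "abs_conv_at (A * B) t" "eval_fps (A * B) t = eval_fps A t * eval_fps B t"
proof -
  have eq: "fps_nth (A * B) k * t ^ k
      = (\<Sum>i\<le>k. (fps_nth A i * t ^ i) * (fps_nth B (k - i) * t ^ (k - i)))" for k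
  proof -
    have "fps_nth (A * B) k * t ^ k = (\<Sum>i\<le>k. (fps_nth A i * fps_nth B (k - i)) * t ^ k)"
      by (simp add: fps_mult_nth atLeast0AtMost sum_distrib_right)
    also have "\<dots> = (\<Sum>i\<le>k. (fps_nth A i * t ^ i) * (fps_nth B (k - i) * t ^ (k - i)))"
      by (rule sum.cong) (auto simp: power_add[symmetric] algebra_simps)
    finally show ?thesis .
  qed
  show "eval_fps (A * B) t = eval_fps A t * eval_fps B t"
    using Cauchy_product_sums[OF A[unfolded abs_conv_at_def] B[unfolded abs_conv_at_def]]
    by (simp add: eval_fps_def eq sums_iff)
  have "summable (\<lambda>k. \<Sum>i\<le>k. norm (fps_nth A i * t ^ i) * norm (fps_nth B (k - i) * t ^ (k - i)))"
    by (rule summable_Cauchy_product) (use A B in \<open>simp_all add: abs_conv_at_def\<close>)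
  then show "abs_conv_at (A * B) t"
    unfolding abs_conv_at_def eq
    by (rule summable_comparison_test[rotated])
       (auto intro!: exI[of _ 0] order.trans[OF sum_abs] sum_mono simp: abs_mult)
qed

lemma abs_conv_power:
  assumes "abs_conv_at A t"
  shows "abs_conv_at (A ^ k) t \<and> eval_fps (A ^ k) t = eval_fps A t ^ k"
proof (induction k)
  case 0
  have "(\<lambda>n. norm (fps_nth 1 n * t ^ n)) = (\<lambda>n. if n = 0 then 1 else 0)"
    by auto
  then have "abs_conv_at 1 t"
    unfolding abs_conv_at_def using summable_single[of 0 "\<lambda>_. 1::real"]
    by simp
  then show ?case by simp
next
  case (Suc k)
  then show ?case using abs_conv_mult[OF assms, of "A ^ k"] by simp
qed

lemma fps_power_nonneg:
  fixes F :: "real fps"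
  assumes "\<And>n. fps_nth F n \<ge> 0"
  shows "fps_nth (F ^ k) n \<ge> 0"
proof (induction k arbitrary: n)
  case (Suc k)
  then show ?case using assms by (auto simp: fps_mult_nth intro!: sum_nonneg)
qed simp

lemma fps_power_nth_eq_0:
  fixes F :: "'a::idom fps"
  assumes "fps_nth F 0 = 0" "n < k"
  shows "fps_nth (F ^ k) n = 0"
  using assms by (simp add: startsby_zero_power_prefix)

text \<open>The double family \<open>g (i, n)\<close> has column sums giving the coefficients of
  \<open>A oo F\<close> and row sums giving \<open>A\<close> at \<open>F(t)\<close>. Since
  \<open>F\<close> has nonnegative coefficients, the absolute row sums are exactly the absolute
  terms of \<open>A\<close> at \<open>F(t)\<close>, so Fubini applies up to the end point of
  convergence; for pgfs this includes 1.\<close>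

lemma abs_conv_compose:
  assumes nn: "\<And>n. fps_nth F n \<ge> 0" and F0: "fps_nth F 0 = 0" and t: "0 \<le> t"
    and F: "abs_conv_at F t" and A: "abs_conv_at A (eval_fps F t)"
  shows "abs_conv_at (A oo F) t" "eval_fps (A oo F) t = eval_fps A (eval_fps F t)"
proof -
  define x where "x = eval_fps F t"
  define g where "g = (\<lambda>(i,n). fps_nth A i * (fps_nth (F ^ i) n * t ^ n))"
  have x0: "x \<ge> 0"
    unfolding x_def eval_fps_def by (intro suminf_nonneg) (use nn t abs_conv_sums[OF F] in \<open>auto simp: sums_iff\<close>)
  have Fi: "((\<lambda>n. fps_nth (F ^ i) n * t ^ n) has_sum x ^ i) UNIV" for i
  proof -
    have "(\<lambda>n. fps_nth (F ^ i) n * t ^ n) sums x ^ i"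
      using abs_conv_power[OF F, of i] abs_conv_sums by (metis x_def)
    then show ?thesis
      by (rule sums_nonneg_imp_has_sum) (use fps_power_nonneg[OF nn] t in auto)
  qed
  have Ax: "(\<lambda>i. norm (fps_nth A i * x ^ i)) summable_on UNIV"
    using A unfolding abs_conv_at_def x_def by (subst summable_on_UNIV_nonneg_real_iff) auto
  have hs: "((\<lambda>n. norm (g (i, n))) has_sum norm (fps_nth A i * x ^ i)) UNIV" for i
    using has_sum_cmult_right[OF Fi[of i], of "\<bar>fps_nth A i\<bar>"] fps_power_nonneg[OF nn] t x0
    by (simp add: g_def abs_mult)
  have gabs: "(\<lambda>p. norm (g p)) summable_on UNIV \<times> UNIV"
  proof (rule Infinite_Sum.abs_summable_on_Sigma_iff[where f = g and A = UNIV and B = "\<lambda>_. UNIV", THEN iffD2], intro conjI ballI)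
    show "(\<lambda>n. norm (g (i, n))) summable_on UNIV" for i
      using hs[of i] by (rule has_sum_imp_summable)
    show "(\<lambda>i. norm (\<Sum>\<^sub>\<infinity>n. norm (g (i, n)))) summable_on UNIV"
      using Ax unfolding infsumI[OF hs] by simp
  qed
  then have gs: "g summable_on UNIV \<times> UNIV"
    by (rule abs_summable_summable)
  have col: "(\<Sum>\<^sub>\<infinity>i. g (i, n)) = fps_nth (A oo F) n * t ^ n" for n
  proof -
    have "((\<lambda>i. g (i, n)) has_sum (\<Sum>i\<in>{0..n}. g (i, n))) UNIV"
      by (rule has_sum_finite_neutralI) (auto simp: g_def fps_power_nth_eq_0[OF F0])
    then show ?thesis
      by (simp add: infsumI g_def fps_compose_nth sum_distrib_right mult.assoc)
  qed
  have row: "(\<Sum>\<^sub>\<infinity>n. g (i, n)) = fps_nth A i * x ^ i" for i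
    using has_sum_cmult_right[OF Fi[of i], of "fps_nth A i"] by (simp add: g_def infsumI)
  have gabs': "(\<lambda>(n,i). norm (g (i, n))) summable_on UNIV \<times> UNIV"
    using summable_on_swap[of "\<lambda>p. norm (g p)" UNIV UNIV] gabs by (simp add: case_prod_unfold prod.swap_def)
  have gs': "(\<lambda>(n,i). g (i, n)) summable_on UNIV \<times> UNIV"
    using summable_on_swap[of g UNIV UNIV] gs by (simp add: case_prod_unfold prod.swap_def)
  have "(\<lambda>n. norm (fps_nth (A oo F) n * t ^ n)) summable_on UNIV"
  proof (rule summable_on_comparison_test)
    show "(\<lambda>n. \<Sum>\<^sub>\<infinity>i. norm (g (i, n))) summable_on UNIV"
      by (rule summable_on_Sigma_banach) (use gabs' in simp)
    show "norm (fps_nth (A oo F) n * t ^ n) \<le> (\<Sum>\<^sub>\<infinity>i. norm (g (i, n)))" for n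
    proof -
      have "(\<lambda>i. norm (g (i, n))) summable_on UNIV"
        using summable_on_SigmaD1[OF gabs', of n] by simp
      then show ?thesis unfolding col[symmetric] by (rule norm_infsum_bound)
    qed
  qed auto
  then show AF: "abs_conv_at (A oo F) t"
    unfolding abs_conv_at_def by (subst (asm) summable_on_UNIV_nonneg_real_iff) auto
  have "(\<Sum>\<^sub>\<infinity>n. fps_nth (A oo F) n * t ^ n) = (\<Sum>\<^sub>\<infinity>n. \<Sum>\<^sub>\<infinity>i. g (i, n))"
    by (simp add: col)
  also have "\<dots> = (\<Sum>\<^sub>\<infinity>i. \<Sum>\<^sub>\<infinity>n. g (i, n))"
    by (rule infsum_swap_banach) (use gs' in simp)
  also have "\<dots> = (\<Sum>\<^sub>\<infinity>i. fps_nth A i * x ^ i)"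
    by (simp add: row)
  finally have "(\<Sum>\<^sub>\<infinity>n. fps_nth (A oo F) n * t ^ n) = (\<Sum>\<^sub>\<infinity>i. fps_nth A i * x ^ i)" .
  moreover have "(\<Sum>\<^sub>\<infinity>n. fps_nth B n * s ^ n) = eval_fps B s" if "abs_conv_at B s" for B s
    using norm_summable_imp_has_sum[OF that[unfolded abs_conv_at_def] abs_conv_sums[OF that]]
    by (simp add: infsumI)
  ultimately show "eval_fps (A oo F) t = eval_fps A (eval_fps F t)"
    using AF A by (simp add: x_def)
qed

lemma abs_conv_deriv:
  assumes A: "abs_conv_at A s" and t: "\<bar>t\<bar> < s"
  shows "abs_conv_at (fps_deriv A) t"
    and "(eval_fps A has_real_derivative eval_fps (fps_deriv A) t) (at t)"
proof -
  have r: "ereal \<bar>t\<bar> < fps_conv_radius A"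
    using abs_conv_radius[OF A] t by (metis abs_ge_self ereal_less_eq(3) le_less_trans less_ereal.simps(1) less_le_trans)
  have "fps_conv_radius A \<le> fps_conv_radius (fps_deriv A)"
    by (rule fps_conv_radius_deriv)
  with r show "abs_conv_at (fps_deriv A) t"
    by (intro radius_abs_conv) simp
  show "(eval_fps A has_real_derivative eval_fps (fps_deriv A) t) (at t)"
    by (rule has_field_derivative_eval_fps) (use r in simp)
qed

lemma eval_fps_nonzero_near_0:
  assumes A: "abs_conv_at A s" and s: "s > 0" and nz: "A \<noteq> 0"
  obtains r where "0 < r" "\<And>t. 0 < t \<Longrightarrow> t \<le> r \<Longrightarrow> eval_fps A t \<noteq> 0"
proof -
  have rad: "ereal s \<le> fps_conv_radius A"
    using abs_conv_radius[OF A] s by simp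
  \<comment> \<open>\<open>powser_0_nonzero\<close> asks for a function vanishing at the centre and
    a nonzero coefficient of positive index. The factor \<open>fps_X\<close> provides both and
    leaves the other zeros unchanged.\<close>
  define a where "a n = fps_nth (fps_X * A) n" for n
  obtain m where m: "fps_nth A m \<noteq> 0" using nz by (metis fps_ext fps_zero_nth)
  have "(\<lambda>n. a n * (x - 0) ^ n) sums (x * eval_fps A x)" if "norm (x - 0) < s" for x
  proof -
    have c: "ereal (norm x) < fps_conv_radius A"
      using that rad by (metis diff_zero less_ereal.simps(1) less_le_trans)
    have "(\<lambda>n. x * (fps_nth A n * x ^ n)) sums (x * eval_fps A x)"
      by (intro sums_mult sums_eval_fps c)
    then have "(\<lambda>n. a (Suc n) * x ^ Suc n) sums (x * eval_fps A x)"
      by (simp add: a_def mult_ac)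
    then show ?thesis by (subst (asm) sums_Suc_iff) (simp add: a_def)
  qed
  moreover have "a (Suc m) \<noteq> 0" using m by (simp add: a_def)
  ultimately obtain r where r: "0 < r" "\<And>z. z \<in> cball 0 r - {0} \<Longrightarrow> z * eval_fps A z \<noteq> 0"
    using powser_0_nonzero[of s 0 a "\<lambda>x. x * eval_fps A x" "Suc m"] s by auto
  show ?thesis
    by (rule that[of r]) (use r in \<open>force simp: dist_norm\<close>)+
qed

lemma eval_fps_inject:
  assumes A: "abs_conv_at A s" and B: "abs_conv_at B s" and s: "s > 0"
    and eq: "\<And>t. 0 < t \<Longrightarrow> t < s \<Longrightarrow> eval_fps A t = eval_fps B t"
  shows "A = B"
proof (rule ccontr)
  assume "A \<noteq> B"
  then have nz: "A - B \<noteq> 0" by simp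
  have "abs_conv_at (A - B) s"
    unfolding abs_conv_at_def
    by (rule summable_comparison_test[OF _ summable_add[OF A[unfolded abs_conv_at_def] B[unfolded abs_conv_at_def]]])
       (auto simp: left_diff_distrib intro!: exI[of _ 0])
  then obtain r where r: "0 < r" "\<And>t. 0 < t \<Longrightarrow> t \<le> r \<Longrightarrow> eval_fps (A - B) t \<noteq> 0"
    by (rule eval_fps_nonzero_near_0[OF _ s nz]) blast
  define t where "t = min r (s / 2)"
  have t: "0 < t" "t \<le> r" "t < s" using r s by (auto simp: t_def)
  have "eval_fps (A - B) t = eval_fps A t - eval_fps B t"
    using abs_conv_sums[OF abs_conv_at_mono[OF A, of t]] abs_conv_sums[OF abs_conv_at_mono[OF B, of t]] t
    by (auto simp: eval_fps_def sums_iff left_diff_distrib suminf_diff)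
  then show False using r(2)[OF t(1,2)] eq[OF t(1,3)] by simp
qed

section \<open>Generating functions of distributions as formal series\<close>

definition gf :: "nat pmf \<Rightarrow> real fps" where
  "gf N = Abs_fps (pmf N)"

lemma gf_nth [simp]: "fps_nth (gf N) n = pmf N n"
  by (simp add: gf_def)

lemma eval_gf: "eval_fps (gf N) t = pgf N t"
  by (simp add: eval_fps_def pgf_def)

lemma abs_conv_gf: "0 \<le> t \<Longrightarrow> t \<le> 1 \<Longrightarrow> abs_conv_at (gf N) t"
  using summable_pgf[of t N] by (simp add: abs_conv_at_def abs_mult)

lemma gf_inject: "gf M = gf N \<longleftrightarrow> M = N"
  by (metis gf_nth pmf_eqI)

text \<open>The bridge from the composition of distributions, which is defined through values on the
  unit interval, to formal substitution, for which the inner series must vanish at 0.\<close>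

lemma gf_pgf_comp:
  assumes "pmf N2 0 = 0"
  shows "gf (N1 \<circ>\<^sub>g N2) = gf N1 oo gf N2"
proof (rule eval_fps_inject[of _ 1])
  have *: "abs_conv_at (gf N1 oo gf N2) t \<and> eval_fps (gf N1 oo gf N2) t = pgf N1 (pgf N2 t)"
    if "0 \<le> t" "t \<le> 1" for t
    using abs_conv_compose[of "gf N2" t "gf N1"] assms that pgf_in_01[of t N2]
    by (simp add: abs_conv_gf eval_gf)
  then show "abs_conv_at (gf N1 oo gf N2) 1" by simp
  show "eval_fps (gf (N1 \<circ>\<^sub>g N2)) t = eval_fps (gf N1 oo gf N2) t" if "0 < t" "t < 1" for t
    using * that by (simp add: eval_gf pgf_pgf_comp)
qed (auto intro: abs_conv_gf)

unbundle fps_syntax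

section \<open>Pull-backs of formal vector fields\<close>

lemma subdegree_fps_deriv:
  fixes w :: "'a::{idom, ring_char_0} fps"
  assumes "fps_nth w 0 = 0" "w \<noteq> 0"
  shows "subdegree (fps_deriv w) = subdegree w - 1"
proof (rule subdegreeI)
  have pos: "subdegree w > 0" using assms by (simp add: subdegree_eq_0_iff zero_less_iff_neq_zero)
  show "fps_nth (fps_deriv w) (subdegree w - 1) \<noteq> 0"
    using pos assms by (simp del: of_nat_Suc add: of_nat_eq_0_iff)
  show "fps_nth (fps_deriv w) i = 0" if "i < subdegree w - 1" for i
    using that by (simp add: nth_less_subdegree_zero)
qed

lemma fps_deriv_nonzero:
  fixes w :: "'a::{idom, ring_char_0} fps"
  assumes "fps_nth w 0 = 0" "w \<noteq> 0"
  shows "fps_deriv w \<noteq> 0"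
  using assms by (metis fps_const_0_eq_0 fps_deriv_eq_0_iff)

text \<open>
  The pull-back along the substitution \<open>w\<close> of the formal vector field with coefficient \<open>X\<close>; Laurent
  series are needed because \<open>fps_deriv w\<close> is not a unit if \<open>w\<close> starts with a term of degree at least 2.
\<close>

definition pull :: "real fps \<Rightarrow> real fls \<Rightarrow> real fls" where
  "pull w X = fls_compose_fps X w / fps_to_fls (fps_deriv w)"

text \<open>The chain rule makes the pull-back contravariant. Hence the span of the pull-backs along
  a family closed under composition is itself invariant under pull-back.\<close>

lemma pull_pull:
  assumes "fps_nth v 0 = 0" "v \<noteq> 0" "fps_nth w 0 = 0" "w \<noteq> 0"
  shows "pull w (pull v X) = pull (v oo w) X"
  using assms
  by (simp add: pull_def fls_compose_fps_divide fls_compose_fps_assoc fls_times_fps_to_fls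
      fps_compose_deriv field_simps)

lemma pull_add:
  "fps_nth w 0 = 0 \<Longrightarrow> w \<noteq> 0 \<Longrightarrow> pull w (X + Y) = pull w X + pull w Y"
  by (simp add: pull_def fls_compose_fps_add add_divide_distrib)

lemma pull_scale:
  "fps_nth w 0 = 0 \<Longrightarrow> w \<noteq> 0 \<Longrightarrow> pull w (fls_const c * X) = fls_const c * pull w X"
  by (simp add: pull_def fls_compose_fps_mult)

lemma pull_eq_0_iff:
  "fps_nth w 0 = 0 \<Longrightarrow> w \<noteq> 0 \<Longrightarrow> pull w X = 0 \<longleftrightarrow> X = 0"
  by (simp add: pull_def fls_compose_fps_eq_0_iff fps_deriv_nonzero)

text \<open>If \<open>w\<close> has order \<open>d\<close> and \<open>X\<close> has order
  \<open>s\<close>, then \<open>X(w)\<close> has order \<open>d * s\<close> and \<open>w'\<close>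
  has order \<open>d - 1\<close>. So \<open>s - 1\<close> is multiplied by \<open>d\<close>: for
  \<open>d \<ge> 2\<close> the value 1 is a repelling fixed point for the subdegree.\<close>

lemma subdegree_pull:
  assumes "fps_nth w 0 = 0" "w \<noteq> 0" "X \<noteq> 0"
  shows "fls_subdegree (pull w X) = int (subdegree w) * (fls_subdegree X - 1) + 1"
proof -
  have "subdegree w > 0" using assms by (simp add: subdegree_eq_0_iff zero_less_iff_neq_zero)
  then show ?thesis
    using assms by (simp add: pull_def fls_divide_subdegree fls_compose_fps_eq_0_iff fps_deriv_nonzero
        fls_subdegree_fls_to_fps subdegree_fps_deriv of_nat_diff algebra_simps)
qed

text \<open>In a finitely generated space the order of a nonzero element is bounded, and
  \<open>n\<close> is uniform in the coefficients. When the generator \<open>X b\<close> is added,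
  either the old bound survives, or some \<open>X b + L d\<close> is nonzero and vanishes up to
  \<open>n\<close>. In the latter case its order \<open>m\<close> is the new bound: after a multiple
  of it is split off, the rest \<open>L e\<close> vanishes up to \<open>n\<close>, hence is 0, and
  the coefficient at \<open>m\<close> forces \<open>c b = 0\<close>.\<close>

lemma fls_combination_bound_above:
  fixes X :: "'b \<Rightarrow> real fls"
  assumes "finite J"
  shows "\<exists>n. \<forall>c. (\<forall>i\<le>n. (\<Sum>b\<in>J. fls_const (c b) * X b) $$ i = 0) \<longrightarrow> (\<Sum>b\<in>J. fls_const (c b) * X b) = 0"
  using assms
proof (induction J rule: finite_induct)
  case (insert b J)
  define L where "L c = (\<Sum>b\<in>J. fls_const (c b) * X b)" for c
  have L_diff: "L c - fls_const k * L d = L (\<lambda>b. c b - k * d b)" for c k d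
    unfolding L_def sum_distrib_left sum_subtractf[symmetric]
    by (intro sum.cong refl) (simp add: algebra_simps flip: fls_const_mult_const fls_minus_const)
  obtain n where n: "\<And>c. \<forall>i\<le>n. L c $$ i = 0 \<Longrightarrow> L c = 0"
    using insert.IH unfolding L_def by blast
  have split: "(\<Sum>b\<in>insert b J. fls_const (c b) * X b) = fls_const (c b) * X b + L c" for c
    using insert.hyps by (simp add: L_def)
  show ?case
  proof (cases "\<exists>d. (\<forall>i\<le>n. (X b + L d) $$ i = 0) \<and> X b + L d \<noteq> 0")
    case False
    show ?thesis unfolding split
    proof (intro exI[of _ n] allI impI)
      fix c assume c: "\<forall>i\<le>n. (fls_const (c b) * X b + L c) $$ i = 0"
      show "fls_const (c b) * X b + L c = 0"
      proof (cases "c b = 0")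
        case True then show ?thesis using c n[of c] by simp
      next
        case nz: False
        have L0: "L (\<lambda>_. 0) = 0" by (simp add: L_def)
        define d where "d = (\<lambda>b'. c b' / c b)"
        have Ld: "fls_const (c b) * L d = L c"
          using nz by (simp add: L_def d_def sum_distrib_left flip: mult.assoc)
        then have eq: "fls_const (c b) * X b + L c = fls_const (c b) * (X b + L d)"
          by (simp add: algebra_simps)
        with c nz have "\<forall>i\<le>n. (X b + L d) $$ i = 0" by (simp del: fls_plus_nth)
        with False have "X b + L d = 0" by blast
        with eq show ?thesis by simp
      qed
    qed
  next
    case True
    then obtain d where d: "\<forall>i\<le>n. (X b + L d) $$ i = 0" "X b + L d \<noteq> 0" by blast
    define m where "m = fls_subdegree (X b + L d)"
    have m: "(X b + L d) $$ m \<noteq> 0" using d by (simp add: m_def del: fls_plus_nth)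
    have nm: "n < m" unfolding m_def by (rule fls_subdegree_greaterI) (use d in blast)+
    show ?thesis unfolding split
    proof (intro exI[of _ m] allI impI)
      fix c assume c: "\<forall>i\<le>m. (fls_const (c b) * X b + L c) $$ i = 0"
      define e where "e = (\<lambda>b'. c b' - c b * d b')"
      have eq: "fls_const (c b) * X b + L c = fls_const (c b) * (X b + L d) + L e"
        unfolding e_def L_diff[symmetric] by (simp add: algebra_simps)
      have "L e $$ i = 0" if "i \<le> n" for i
      proof -
        have "(fls_const (c b) * X b + L c) $$ i = 0" using c that nm by simp
        moreover have "(fls_const (c b) * (X b + L d)) $$ i = 0"
          using d that by (simp del: fls_plus_nth)
        ultimately show ?thesis unfolding eq by (simp only: fls_plus_nth)
      qed
      then have Le: "L e = 0" using n by blast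
      have "(fls_const (c b) * X b + L c) $$ m = 0" using c by blast
      then have "c b * (X b + L d) $$ m = 0" unfolding eq Le by (simp del: fls_plus_nth)
      with m have "c b = 0" by (metis mult_eq_0_iff)
      then show "fls_const (c b) * X b + L c = 0" unfolding eq Le by simp
    qed
  qed
qed simp

lemma fls_combination_bound_below:
  fixes X :: "'b \<Rightarrow> real fls"
  assumes "finite J"
  shows "\<exists>l. \<forall>c. \<forall>i<l. (\<Sum>b\<in>J. fls_const (c b) * X b) $$ i = 0"
  using assms
proof (induction J rule: finite_induct)
  case (insert b J)
  then obtain l where l: "\<forall>c. \<forall>i<l. (\<Sum>b\<in>J. fls_const (c b) * X b) $$ i = 0" by blast
  show ?case
    by (rule exI[of _ "min l (fls_subdegree (X b))"]) (use insert.hyps l in auto)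
qed simp

text \<open>The real linear hull of all pull-backs of \<open>Y\<close>, with scalars embedded by
  \<open>fls_const\<close>; the inductive form lets properties of pull-backs extend to the hull by
  induction.\<close>

inductive_set pull_span :: "real fps set \<Rightarrow> real fls \<Rightarrow> real fls set" for S Y where
  gen: "w \<in> S \<Longrightarrow> pull w Y \<in> pull_span S Y"
| add: "A \<in> pull_span S Y \<Longrightarrow> B \<in> pull_span S Y \<Longrightarrow> A + B \<in> pull_span S Y"
| scale: "A \<in> pull_span S Y \<Longrightarrow> fls_const c * A \<in> pull_span S Y"

text \<open>
  An element of maximal subdegree of the span is an eigenvector: a suitable multiple of it cancels the
  leading term of its pull-back. If some \<open>w\<close> has order at least 2, the subdegree must be 1, for otherwise the
  subdegrees of the pull-backs along the iterates of \<open>w\<close> are unbounded.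
\<close>

lemma pull_eigenvector:
  fixes X :: "'b \<Rightarrow> real fls" and D :: "real fps"
  assumes S0: "\<And>w. w \<in> S \<Longrightarrow> fps_nth w 0 = 0" and Snz: "\<And>w. w \<in> S \<Longrightarrow> w \<noteq> 0"
    and Scomp: "\<And>v w. v \<in> S \<Longrightarrow> w \<in> S \<Longrightarrow> v oo w \<in> S"
    and f: "f \<in> S" and D: "D \<noteq> 0" "fps_nth D 0 = 0"
    and u: "u \<in> S" and J: "finite J"
    and span: "\<And>w. w \<in> S \<Longrightarrow> \<exists>c. pull (w oo u) (fps_to_fls D / fps_to_fls (fps_deriv f))
                       = (\<Sum>b\<in>J. fls_const (c b) * X b)"
  shows "\<exists>Z. Z \<noteq> 0 \<and> fps_nth Z 0 = 0 \<and> (\<forall>w\<in>S. \<exists>\<kappa>. \<kappa> \<noteq> 0 \<and> Z oo w = fps_const \<kappa> * fps_deriv w * Z)"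
proof -
  define Y where "Y = fps_to_fls D / fps_to_fls (fps_deriv f)"
  define M where "M = pull_span S Y"
  have Ynz: "Y \<noteq> 0" using D fps_deriv_nonzero[OF S0[OF f] Snz[OF f]] by (simp add: Y_def)
  have MS: "pull v A \<in> M" if "A \<in> M" "v \<in> S" for A v
    using that(1) unfolding M_def
  proof induction
    case (gen w)
    then show ?case using that(2) Scomp S0 Snz by (auto simp: pull_pull intro: pull_span.gen)
  qed (use that(2) S0 Snz in \<open>auto simp: pull_add pull_scale intro: pull_span.intros\<close>)
  \<comment> \<open>The hypothesis speaks only of pull-backs along \<open>w oo u\<close>, so it
    confines \<open>pull u A\<close> and not \<open>A\<close> itself. Since \<open>pull u\<close> is
    linear and injective and its effect on orders is known, this still controls the orders in
    \<open>M\<close>.\<close>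
  have Mspan: "\<exists>c. pull u A = (\<Sum>b\<in>J. fls_const (c b) * X b)" if "A \<in> M" for A
    using that unfolding M_def
  proof induction
    case (gen w)
    then show ?case using span[of w] S0 Snz u by (simp add: pull_pull Y_def)
  next
    case (add A B)
    then obtain c d where "pull u A = (\<Sum>b\<in>J. fls_const (c b) * X b)" "pull u B = (\<Sum>b\<in>J. fls_const (d b) * X b)"
      by blast
    then have "pull u (A + B) = (\<Sum>b\<in>J. fls_const (c b + d b) * X b)"
      using S0[OF u] Snz[OF u] by (simp add: pull_add sum.distrib[symmetric] distrib_right flip: fls_plus_const)
    then show ?case by (intro exI[of _ "\<lambda>b. c b + d b"])
  next
    case (scale A k)
    then obtain c where "pull u A = (\<Sum>b\<in>J. fls_const (c b) * X b)" by blast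
    then have "pull u (fls_const k * A) = (\<Sum>b\<in>J. fls_const (k * c b) * X b)"
      using S0[OF u] Snz[OF u] by (simp add: pull_scale sum_distrib_left mult.assoc[symmetric])
    then show ?case by (intro exI[of _ "\<lambda>b. k * c b"])
  qed
  define ord where "ord w = int (subdegree w)" for w :: "real fps"
  have ord1: "ord w \<ge> 1" if "w \<in> S" for w
  proof -
    have "subdegree w \<noteq> 0" using S0 Snz that by (simp add: subdegree_eq_0_iff)
    then show ?thesis by (simp add: ord_def)
  qed
  have sd: "fls_subdegree (pull w A) = ord w * (fls_subdegree A - 1) + 1" if "w \<in> S" "A \<noteq> 0" for w A
    using that S0 Snz by (simp add: subdegree_pull ord_def)
  have pnz: "pull w A \<noteq> 0" if "w \<in> S" "A \<noteq> 0" for w A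
    using that S0 Snz by (simp add: pull_eq_0_iff)
  obtain n where n: "\<And>c. \<forall>i\<le>n. (\<Sum>b\<in>J. fls_const (c b) * X b) $$ i = 0 \<Longrightarrow> (\<Sum>b\<in>J. fls_const (c b) * X b) = 0"
    using fls_combination_bound_above[OF J, of X] by blast
  obtain l where l: "\<And>c i. i < l \<Longrightarrow> (\<Sum>b\<in>J. fls_const (c b) * X b) $$ i = 0"
    using fls_combination_bound_below[OF J, of X] by blast
  \<comment> \<open>Pulling back along \<open>u\<close> does not lower subdegrees at or above 1 and
    does not raise those at or below 0. Hence the upper bound \<open>n\<close> transfers to
    \<open>A\<close> only beyond 1, and the lower bound \<open>l\<close> only for nonpositive
    subdegrees.\<close>
  have bounds: "fls_subdegree A \<le> max n 1" "fls_subdegree A \<le> 0 \<Longrightarrow> l \<le> fls_subdegree A" if A: "A \<in> M" "A \<noteq> 0" for A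
  proof -
    obtain c where c: "pull u A = (\<Sum>b\<in>J. fls_const (c b) * X b)" using Mspan A by blast
    have nz: "pull u A \<noteq> 0" using A u pnz by blast
    then obtain i where "i \<le> n" "pull u A $$ i \<noteq> 0" using n c by metis
    then have 1: "fls_subdegree (pull u A) \<le> n" by (meson fls_subdegree_leI')
    have 2: "l \<le> fls_subdegree (pull u A)" by (rule fls_subdegree_geI[OF nz]) (use l c in metis)
    show "fls_subdegree A \<le> max n 1"
    proof (rule ccontr)
      assume "\<not> ?thesis"
      then have s: "fls_subdegree A > 1" "fls_subdegree A > n" by auto
      then have "1 * (fls_subdegree A - 1) \<le> ord u * (fls_subdegree A - 1)"
        using ord1[OF u] by (intro mult_right_mono) auto
      then show False using 1 s sd[OF u A(2)] unfolding mult_1_left by linarith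
    qed
    show "l \<le> fls_subdegree A" if "fls_subdegree A \<le> 0"
    proof -
      have "ord u * (fls_subdegree A - 1) \<le> 1 * (fls_subdegree A - 1)"
        using ord1[OF u] that by (intro mult_right_mono_neg) auto
      then show ?thesis using 2 sd[OF u A(2)] unfolding mult_1_left by linarith
    qed
  qed
  have YM: "pull u Y \<in> M" "pull u Y \<noteq> 0"
    unfolding M_def using u Ynz pnz by (auto intro: pull_span.gen)
  \<comment> \<open>The maximal subdegree is found as the least distance to the upper bound, a
    natural number.\<close>
  define P where "P k \<longleftrightarrow> (\<exists>A\<in>M. A \<noteq> 0 \<and> max n 1 - fls_subdegree A = int k)" for k
  have "\<exists>k. P k"
    unfolding P_def using YM bounds(1)[OF YM]
    by (intro exI[of _ "nat (max n 1 - fls_subdegree (pull u Y))"]) auto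
  then obtain k where k: "P k" "\<And>j. P j \<Longrightarrow> k \<le> j"
    using LeastI_ex[of P] Least_le[of P] by blast
  obtain Z where Z: "Z \<in> M" "Z \<noteq> 0" "max n 1 - fls_subdegree Z = int k" using k by (auto simp: P_def)
  have Zmax: "fls_subdegree A \<le> fls_subdegree Z" if "A \<in> M" "A \<noteq> 0" for A
  proof -
    have "P (nat (max n 1 - fls_subdegree A))"
      unfolding P_def using bounds(1)[OF that] that by (intro bexI[of _ A]) auto
    from k(2)[OF this] show ?thesis using Z(3) bounds(1)[OF that] by linarith
  qed
  have Zsub: "fls_subdegree (pull w Z) = fls_subdegree Z \<and> (ord w \<ge> 2 \<longrightarrow> fls_subdegree Z = 1)" if w: "w \<in> S" for w
  proof (cases "ord w \<ge> 2")
    case False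
    then have "ord w = 1" using ord1[OF w] by simp
    then show ?thesis using sd[OF w Z(2)] by simp
  next
    case True
    have "fls_subdegree Z = 1"
    proof (rule ccontr)
      assume ne: "fls_subdegree Z \<noteq> 1"
      have "fls_subdegree (pull w Z) \<le> fls_subdegree Z"
        using Zmax MS Z w pnz by blast
      then have le: "ord w * (fls_subdegree Z - 1) \<le> 1 * (fls_subdegree Z - 1)"
        using sd[OF w Z(2)] unfolding mult_1_left by linarith
      \<comment> \<open>A subdegree above 1 would be increased by the pull-back along
        \<open>w\<close>, against maximality.\<close>
      have neg: "fls_subdegree Z \<le> 0"
      proof (rule ccontr)
        assume "\<not> ?thesis"
        then have gt: "fls_subdegree Z > 1" using ne by simp
        then have "2 * (fls_subdegree Z - 1) \<le> ord w * (fls_subdegree Z - 1)"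
          by (intro mult_right_mono True) simp
        from order_trans[OF this le] show False using gt by simp
      qed
      have "\<exists>A\<in>M. A \<noteq> 0 \<and> fls_subdegree A \<le> - int j" for j
      proof (induction j)
        case 0 show ?case using Z neg by auto
      next
        case (Suc j)
        then obtain A where A: "A \<in> M" "A \<noteq> 0" "fls_subdegree A \<le> - int j" by blast
        have "ord w * (fls_subdegree A - 1) \<le> 2 * (fls_subdegree A - 1)"
          using True A by (intro mult_right_mono_neg) auto
        then have "fls_subdegree (pull w A) \<le> 2 * (fls_subdegree A - 1) + 1"
          unfolding sd[OF w A(2)] by (rule add_right_mono)
        then have "fls_subdegree (pull w A) \<le> - int (Suc j)"
          using A(3) by simp
        then show ?case using A MS w pnz by blast
      qed
      from this[of "nat (1 - l)"] obtain A where A: "A \<in> M" "A \<noteq> 0" "fls_subdegree A \<le> - int (nat (1 - l))" by blast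
      have "fls_subdegree A \<le> 0" using A(3) by linarith
      then have "l \<le> fls_subdegree A" using bounds(2) A by blast
      with A(3) show False by linarith
    qed
    then show ?thesis using sd[OF w Z(2)] by simp
  qed
  have eig: "\<exists>\<kappa>. \<kappa> \<noteq> 0 \<and> pull w Z = fls_const \<kappa> * Z" if w: "w \<in> S" for w
  proof -
    define s where "s = fls_subdegree Z"
    define \<kappa> where "\<kappa> = pull w Z $$ s / Z $$ s"
    have Zs: "Z $$ s \<noteq> 0" using Z(2) by (simp add: s_def)
    have ps: "pull w Z $$ s \<noteq> 0" using Zsub[OF w] pnz[OF w Z(2)] nth_fls_subdegree_nonzero unfolding s_def by metis
    define A where "A = pull w Z + fls_const (- \<kappa>) * Z"
    have AM: "A \<in> M" using MS[OF Z(1) w] Z(1) unfolding A_def M_def by (intro pull_span.add pull_span.scale)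
    have "A = 0"
    proof (rule ccontr)
      assume "A \<noteq> 0"
      then have "fls_subdegree A \<le> s" using Zmax AM by (simp add: s_def)
      moreover have "s < fls_subdegree A"
      proof (rule fls_subdegree_greaterI[OF \<open>A \<noteq> 0\<close>])
        fix i assume "i \<le> s"
        then consider "i = s" | "i < s" by linarith
        then show "A $$ i = 0"
        proof cases
          case 1 then show ?thesis using Zs by (simp add: A_def \<kappa>_def)
        next
          case 2 then show ?thesis using Zsub[OF w] by (simp add: A_def s_def)
        qed
      qed
      ultimately show False by simp
    qed
    then have "pull w Z = fls_const \<kappa> * Z"
      by (intro fls_eqI) (simp add: A_def fls_eq_iff)
    moreover have "\<kappa> \<noteq> 0" using Zs ps by (simp add: \<kappa>_def)
    ultimately show ?thesis by blast
  qed
  \<comment> \<open>\<open>Z\<close> is a power series vanishing at 0. With a member of order at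
    least 2 its subdegree is 1 by \<open>Zsub\<close>; otherwise \<open>f'\<close> and all
    \<open>w'\<close> are units, and vanishing at 0 passes from \<open>D\<close> to the whole
    span.\<close>
  have s1: "fls_subdegree Z \<ge> 1"
  proof (cases "\<exists>w\<in>S. ord w \<ge> 2")
    case True
    then show ?thesis using Zsub by auto
  next
    case False
    then have ord: "ord w = 1" if "w \<in> S" for w using ord1[OF that] that by force
    have "subdegree D \<ge> 1" using D by (simp add: subdegree_eq_0_iff Suc_le_eq zero_less_iff_neq_zero)
    moreover have "subdegree (fps_deriv f) = 0"
      using ord[OF f] S0[OF f] Snz[OF f] by (simp add: subdegree_fps_deriv ord_def)
    ultimately have Y1: "fls_subdegree Y \<ge> 1"
      using D fps_deriv_nonzero[OF S0[OF f] Snz[OF f]]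
      by (simp add: Y_def fls_divide_subdegree fls_subdegree_fls_to_fps)
    have "\<forall>i<1. A $$ i = 0" if "A \<in> M" for A
      using that unfolding M_def
    proof induction
      case (gen w)
      then have "fls_subdegree (pull w Y) \<ge> 1" using Y1 sd[OF gen Ynz] ord[OF gen] by simp
      then show ?case by simp
    qed auto
    then show ?thesis using Z by (intro fls_subdegree_geI) auto
  qed
  define z where "z = fls_regpart Z"
  have zZ: "Z = fps_to_fls z" using s1 by (simp add: z_def)
  have "\<exists>\<kappa>. \<kappa> \<noteq> 0 \<and> z oo w = fps_const \<kappa> * fps_deriv w * z" if w: "w \<in> S" for w
  proof -
    obtain \<kappa> where \<kappa>: "\<kappa> \<noteq> 0" "pull w Z = fls_const \<kappa> * Z" using eig w by blast
    then have "fps_to_fls (z oo w) = fps_to_fls (fps_const \<kappa> * fps_deriv w * z)"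
      using fps_deriv_nonzero[OF S0[OF w] Snz[OF w]] S0[OF w]
      by (simp add: zZ pull_def fls_times_fps_to_fls field_simps)
    then show ?thesis using \<kappa> by (auto simp: fps_to_fls_eq_iff)
  qed
  moreover have "z \<noteq> 0" using Z zZ by auto
  moreover have "fps_nth z 0 = 0" using s1 by (simp add: z_def)
  ultimately show ?thesis by blast
qed

unbundle no vec_syntax

section \<open>Dimension count\<close>

text \<open>Differentiability is meant coefficientwise, without any uniformity in \<open>n\<close>.
  This notion survives products and substitutions because each coefficient of the result is a
  polynomial in finitely many coefficients.\<close>

definition has_fps_derivative ::
    "('e::real_normed_vector \<Rightarrow> real fps) \<Rightarrow> ('e \<Rightarrow> real fps) \<Rightarrow> 'e \<Rightarrow> bool" where
  "has_fps_derivative G G' x \<longleftrightarrow> (\<forall>n. ((\<lambda>t. G t $ n) has_derivative (\<lambda>h. G' h $ n)) (at x))"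

lemma has_fps_derivative_const: "has_fps_derivative (\<lambda>t. A) (\<lambda>h. 0) x"
  by (simp add: has_fps_derivative_def)

lemma has_fps_derivative_mult:
  assumes "has_fps_derivative G G' x" "has_fps_derivative K K' x"
  shows "has_fps_derivative (\<lambda>t. G t * K t) (\<lambda>h. G x * K' h + G' h * K x) x"
  unfolding has_fps_derivative_def fps_mult_nth fps_add_nth sum.distrib[symmetric]
  by (intro allI has_derivative_sum has_derivative_mult)
     (use assms in \<open>auto simp: has_fps_derivative_def\<close>)

lemma has_fps_derivative_power:
  assumes K: "has_fps_derivative K K' x"
  shows "has_fps_derivative (\<lambda>t. K t ^ i) (\<lambda>h. of_nat i * K x ^ (i - 1) * K' h) x"
proof (induction i)
  case 0
  then show ?case by (simp add: has_fps_derivative_const)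
next
  case (Suc i)
  have "(\<lambda>h. K x * (of_nat i * K x ^ (i - 1) * K' h) + K' h * K x ^ i)
      = (\<lambda>h. of_nat (Suc i) * K x ^ (Suc i - 1) * K' h)"
    by (rule ext, cases i) (auto simp: algebra_simps)
  then show ?case
    using has_fps_derivative_mult[OF K Suc.IH] by (simp only: power_Suc)
qed

text \<open>The right-hand side is what termwise differentiation of
  \<open>\<Sum>i. G $ i * K ^ i\<close> in the direction \<open>L\<close> produces, cut off at
  \<open>n\<close>.\<close>

lemma fps_compose_deriv_mult_nth:
  fixes G K L :: "real fps"
  assumes K0: "K $ 0 = 0" and L0: "L $ 0 = 0"
  shows "((fps_deriv G oo K) * L) $ n = (\<Sum>i=0..n. G $ i * (of_nat i * K ^ (i - 1) * L) $ n)"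
proof -
  \<comment> \<open>This is the boundary term of the index shift from \<open>j\<close> to
    \<open>i = j + 1\<close>, which would correspond to \<open>i = n + 1\<close>.\<close>
  have KL: "(K ^ n * L) $ n = 0"
  proof -
    have "(K ^ n * L) $ n = (\<Sum>i=0..n. (K ^ n) $ i * L $ (n - i))"
      by (rule fps_mult_nth)
    also have "\<dots> = 0"
    proof (rule sum.neutral, intro ballI)
      fix i assume "i \<in> {0..n}"
      then consider "i < n" | "i = n" by force
      then show "(K ^ n) $ i * L $ (n - i) = 0"
        by cases (use fps_power_nth_eq_0[OF K0] L0 in auto)
    qed
    finally show ?thesis .
  qed
  have *: "(of_nat k * A * L) $ n = of_nat k * (A * L) $ n" for k A
    by (simp add: mult.assoc fps_of_nat[symmetric] del: fps_of_nat)
  have "((fps_deriv G oo K) * L) $ n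
      = (\<Sum>a=0..n. (\<Sum>j=0..a. fps_deriv G $ j * (K ^ j) $ a) * L $ (n - a))"
    by (simp add: fps_mult_nth fps_compose_nth)
  also have "\<dots> = (\<Sum>a=0..n. (\<Sum>j=0..n. fps_deriv G $ j * (K ^ j) $ a) * L $ (n - a))"
    by (intro sum.cong refl arg_cong2[where f = "(*)"] sum.mono_neutral_left)
       (auto simp: fps_power_nth_eq_0[OF K0])
  also have "\<dots> = (\<Sum>j=0..n. fps_deriv G $ j * (K ^ j * L) $ n)"
    unfolding fps_mult_nth sum_distrib_left sum_distrib_right by (subst sum.swap) (simp only: mult.assoc)
  also have "\<dots> = (\<Sum>j<n. G $ Suc j * (of_nat (Suc j) * (K ^ j * L) $ n))"
    by (cases n) (use KL in \<open>auto simp: lessThan_Suc_atMost atLeast0AtMost algebra_simps\<close>)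
  also have "\<dots> = (\<Sum>i\<in>{..<Suc n}. G $ i * (of_nat i * K ^ (i - 1) * L) $ n)"
    unfolding sum.lessThan_Suc_shift by (simp add: * del: of_nat_Suc)
  finally show ?thesis by (simp add: lessThan_Suc_atMost atLeast0AtMost)
qed

lemma has_fps_derivative_compose:
  assumes G: "has_fps_derivative G G' x" and K: "has_fps_derivative K K' x"
    and K0: "K x $ 0 = 0" "\<And>h. K' h $ 0 = 0"
  shows "has_fps_derivative (\<lambda>t. G t oo K t) (\<lambda>h. (G' h oo K x) + (fps_deriv (G x) oo K x) * K' h) x"
  unfolding has_fps_derivative_def
proof
  fix n
  have "((\<lambda>t. \<Sum>i=0..n. G t $ i * (K t ^ i) $ n) has_derivative
      (\<lambda>h. \<Sum>i=0..n. G x $ i * (of_nat i * K x ^ (i - 1) * K' h) $ n + G' h $ i * (K x ^ i) $ n)) (at x)"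
    by (intro has_derivative_sum has_derivative_mult)
       (use G has_fps_derivative_power[OF K] in \<open>auto simp: has_fps_derivative_def\<close>)
  then show "((\<lambda>t. (G t oo K t) $ n) has_derivative
      (\<lambda>h. ((G' h oo K x) + (fps_deriv (G x) oo K x) * K' h) $ n)) (at x)"
    by (simp only: fps_add_nth fps_compose_deriv_mult_nth[OF K0] fps_compose_nth sum.distrib add.commute)
qed

lemma continuous_on_fps_power:
  fixes K :: "'e::topological_space \<Rightarrow> real fps"
  assumes "\<And>n. continuous_on B (\<lambda>t. K t $ n)"
  shows "continuous_on B (\<lambda>t. (K t ^ i) $ n)"
proof (induction i arbitrary: n)
  case (Suc i)
  then show ?case using assms by (simp add: fps_mult_nth continuous_on_sum continuous_on_mult)
qed (simp)

lemma continuous_on_fps_compose: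
  fixes G K :: "'e::topological_space \<Rightarrow> real fps"
  assumes "\<And>n. continuous_on B (\<lambda>t. G t $ n)" "\<And>n. continuous_on B (\<lambda>t. K t $ n)"
  shows "continuous_on B (\<lambda>t. (G t oo K t) $ n)"
  unfolding fps_compose_nth
  by (intro continuous_on_sum continuous_on_mult assms continuous_on_fps_power)

text \<open>
  Projecting along the gradients \<open>a n\<close> of finitely many coefficients makes the derivative of \<open>G\<close> bijective;
  so the projected image of \<open>G\<close> has interior points, but it lies in a negligible set.
\<close>

lemma no_immersion_into_lower_dimension:
  fixes G G' :: "'e::euclidean_space \<Rightarrow> real fps" and \<phi> :: "'m::euclidean_space \<Rightarrow> real fps"
  assumes dim: "DIM('m) < DIM('e)" and e: "e > 0"
    and cont: "\<And>n. continuous_on (ball 0 e) (\<lambda>t. G t $ n)"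
    and der: "has_fps_derivative G G' 0"
    and inj: "\<And>h. G' h = 0 \<Longrightarrow> h = 0"
    and U: "open U" "fps_nth (G 0) \<in> U"
    and sub: "\<And>t. t \<in> ball 0 e \<Longrightarrow> fps_nth (G t) \<in> U \<Longrightarrow> G t \<in> \<phi> ` V"
    and \<phi>: "\<And>n. (\<lambda>x. \<phi> x $ n) differentiable_on V"
  shows False
proof -
  define L where "L n h = G' h $ n" for n h
  have derL: "((\<lambda>t. G t $ n) has_derivative L n) (at 0)" for n
    using der by (simp add: has_fps_derivative_def L_def[abs_def])
  have linL: "linear (L n)" for n
    using has_derivative_linear[OF derL] .
  define a where "a n = adjoint (L n) 1" for n
  have La: "L n h = h \<bullet> a n" for n h
    using adjoint_works[OF linL[of n], of h 1] by (simp add: a_def)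
  \<comment> \<open>By compactness, finitely many coefficients already detect every
    direction.\<close>
  have "compact (sphere (0::'e) 1)" by simp
  moreover have "sphere 0 1 \<subseteq> (\<Union>n\<in>UNIV. {h. L n h \<noteq> 0})"
  proof
    fix h :: 'e assume "h \<in> sphere 0 1"
    then have "h \<noteq> 0" by auto
    then obtain n where "L n h \<noteq> 0" using inj[of h] by (auto simp: L_def fps_eq_iff)
    then show "h \<in> (\<Union>n\<in>UNIV. {h. L n h \<noteq> 0})" by blast
  qed
  moreover have "open {h. L n h \<noteq> 0}" for n
    unfolding La by (intro open_Collect_neq continuous_intros)
  ultimately obtain I where I: "finite I" "sphere 0 1 \<subseteq> (\<Union>n\<in>I. {h. L n h \<noteq> 0})"
    by (metis (no_types, lifting) compactE_image)
  \<comment> \<open>The Gram operator of the gradients: \<open>h \<bullet> Q h\<close> is the sum of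
    the squares of the \<open>L n h\<close>. It is the derivative at 0 of the projected map
    \<open>g\<close>, whose target has the same dimension as its source.\<close>
  define Q where "Q h = (\<Sum>n\<in>I. L n h *\<^sub>R a n)" for h
  have linQ: "linear Q"
    unfolding Q_def La
    by (intro linear_compose_sum ballI linearI) (auto simp: inner_add_left scaleR_add_left)
  have "inj Q"
  proof (rule linear_injective_0[OF linQ, THEN iffD2], intro allI impI)
    fix h assume "Q h = 0"
    then have "0 = h \<bullet> Q h" by simp
    also have "\<dots> = (\<Sum>n\<in>I. (L n h)\<^sup>2)"
      by (simp add: Q_def inner_sum_right La power2_eq_square)
    finally have z: "L n h = 0" if "n \<in> I" for n
      using that I(1) by (metis (no_types, lifting) sum_nonneg_eq_0_iff power2_eq_iff_nonneg zero_le_power2 order_refl power_zero_numeral zero_eq_power2)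
    show "h = 0"
    proof (rule ccontr)
      assume h: "h \<noteq> 0"
      then have "(1 / norm h) *\<^sub>R h \<in> sphere 0 1" by simp
      then obtain n where "n \<in> I" "L n ((1 / norm h) *\<^sub>R h) \<noteq> 0" using I(2) by blast
      then show False using z by (simp add: La)
    qed
  qed
  then obtain Q' where Q': "linear Q'" "Q \<circ> Q' = id"
    using linear_injective_imp_surjective[OF linQ] linear_surjective_right_inverse[OF linQ] by blast
  define g where "g t = (\<Sum>n\<in>I. (G t $ n) *\<^sub>R a n)" for t
  have contG: "continuous_on (ball 0 e) (\<lambda>t. fps_nth (G t))"
    by (rule continuous_on_coordinatewise_then_product) (rule cont)
  then have "openin (top_of_set (ball 0 e)) (ball 0 e \<inter> (\<lambda>t. fps_nth (G t)) -` U)"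
    using U(1) by (rule continuous_openin_preimage_gen)
  then have oT: "open (ball 0 e \<inter> (\<lambda>t. fps_nth (G t)) -` U)"
    by (rule openin_open_trans) simp
  define T where "T = ball 0 e \<inter> (\<lambda>t. fps_nth (G t)) -` U"
  \<comment> \<open>Sussmann's theorem asks for continuity near 0 and a right inverse of the
    derivative at the single point 0, matching the coefficientwise differentiability at 0
    alone.\<close>
  have "g 0 \<in> interior (g ` T)"
  proof (rule sussmann_open_mapping[where S = "ball 0 e" and f' = Q and g' = Q'])
    show "continuous_on (ball 0 e) g"
      unfolding g_def by (intro continuous_on_sum continuous_on_scaleR cont continuous_on_const)
    show "(g has_derivative Q) (at 0)"
      unfolding g_def Q_def by (intro has_derivative_sum has_derivative_scaleR_left derL)
    show "bounded_linear Q'" using Q' linear_conv_bounded_linear by blast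
    have "interior T = T" unfolding T_def by (rule interior_open[OF oT])
    then show "0 \<in> interior T" using e U(2) by (simp add: T_def)
  qed (use e Q' in \<open>auto simp: T_def\<close>)
  moreover have "negligible (g ` T)"
  proof (rule negligible_subset)
    show "g ` T \<subseteq> (\<lambda>x. \<Sum>n\<in>I. (\<phi> x $ n) *\<^sub>R a n) ` V"
    proof
      fix y assume "y \<in> g ` T"
      then obtain t where t: "t \<in> T" "y = g t" by blast
      then obtain x where "x \<in> V" "G t = \<phi> x" using sub[of t] by (auto simp: T_def)
      then show "y \<in> (\<lambda>x. \<Sum>n\<in>I. (\<phi> x $ n) *\<^sub>R a n) ` V" using t by (auto simp: g_def)
    qed
    show "negligible ((\<lambda>x. \<Sum>n\<in>I. (\<phi> x $ n) *\<^sub>R a n) ` V)"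
      by (intro negligible_differentiable_image_lowdim dim)
         (use \<phi> I(1) in \<open>auto simp: differentiable_on_def intro!: differentiable_sum differentiable_scaleR\<close>)
  qed
  ultimately show False
    using negligible_subset[OF _ interior_subset] open_not_negligible open_interior by blast
qed

text \<open>
  The velocity of \<open>H t oo w oo G\<close> in the new parameter \<open>t\<close>, divided by the derivative of the whole composite,
  is the pull-back of \<open>Y\<close> along \<open>w oo G 0\<close>, and the quotients for the old parameters do not change. So
  unless the pull-backs span a finite-dimensional space, compositions yield immersions of any dimension into \<open>S\<close>.
\<close>

lemma finite_dimensional_pull:
  fixes S :: "real fps set" and H :: "real \<Rightarrow> real fps"
  assumes S0: "\<And>w. w \<in> S \<Longrightarrow> w $ 0 = 0" and Snz: "\<And>w. w \<in> S \<Longrightarrow> w \<noteq> 0"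
    and Scomp: "\<And>v w. v \<in> S \<Longrightarrow> w \<in> S \<Longrightarrow> v oo w \<in> S"
    and chart: "\<And>P. P \<in> S \<Longrightarrow> \<exists>V (\<phi> :: 'm::euclidean_space \<Rightarrow> real fps) U. open U \<and> fps_nth P \<in> U \<and>
          {Q \<in> S. fps_nth Q \<in> U} \<subseteq> \<phi> ` V \<and> (\<forall>n. (\<lambda>x. \<phi> x $ n) differentiable_on V)"
    and e: "e > 0" and HS: "\<And>t. \<bar>t\<bar> < e \<Longrightarrow> H t \<in> S"
    and Hcont: "\<And>n. continuous_on {-e<..<e} (\<lambda>t. H t $ n)"
    and Hder: "\<And>n. ((\<lambda>t. H t $ n) has_real_derivative D $ n) (at 0)"
  defines "Y \<equiv> fps_to_fls D / fps_to_fls (fps_deriv (H 0))"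
  shows "\<exists>u\<in>S. \<exists>(J :: ('m \<times> real) set) X. finite J \<and>
      (\<forall>w\<in>S. \<exists>c. pull (w oo u) Y = (\<Sum>b\<in>J. fls_const (c b) * X b))" (is ?finite_span)
proof (rule ccontr)
  assume neg: "\<not> ?thesis"
  have HS0: "H 0 \<in> S" using HS[of 0] e by simp
  \<comment> \<open>A family in \<open>S\<close> over a space of dimension \<open>m + 1\<close>
    whose first-order variation at 0 depends only on the coordinates in \<open>J\<close>. The
    velocities relative to \<open>(G 0)'\<close> are the \<open>X b\<close>, and these are linearly
    independent. For \<open>J = Basis\<close> the derivative is injective.\<close>
  define good where "good J G G' X \<longleftrightarrow> (\<forall>t\<in>ball 0 e. G t \<in> S) \<and> (\<forall>n. continuous_on (ball 0 e) (\<lambda>t. G t $ n)) \<and>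
      has_fps_derivative G G' 0 \<and>
      (\<forall>h. fps_to_fls (G' h) = fps_to_fls (fps_deriv (G 0)) * (\<Sum>b\<in>J. fls_const (h \<bullet> b) * X b)) \<and>
      (\<forall>c. (\<Sum>b\<in>J. fls_const (c b) * X b) = 0 \<longrightarrow> (\<forall>b\<in>J. c b = 0))"
    for J and G G' :: "'m \<times> real \<Rightarrow> real fps" and X
  have goodD: "\<And>t. t \<in> ball 0 e \<Longrightarrow> G t \<in> S"
      "\<And>n. continuous_on (ball 0 e) (\<lambda>t. G t $ n)"
      "has_fps_derivative G G' 0"
      "\<And>h. fps_to_fls (G' h) = fps_to_fls (fps_deriv (G 0)) * (\<Sum>b\<in>J. fls_const (h \<bullet> b) * X b)"
      "\<And>c b. (\<Sum>b\<in>J. fls_const (c b) * X b) = 0 \<Longrightarrow> b \<in> J \<Longrightarrow> c b = 0"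
    if "good J G G' X" for J G G' X
    using that unfolding good_def by blast+
  have "\<exists>G G' X. good J G G' X"
    if "finite J" "J \<subseteq> Basis" for J :: "('m \<times> real) set"
    using that
  proof (induction J rule: finite_induct)
    case empty
    show ?case
      unfolding good_def by (rule exI[of _ "\<lambda>_. H 0"], rule exI[of _ "\<lambda>_. 0"])
         (use HS0 in \<open>auto intro: has_fps_derivative_const\<close>)
  next
    case (insert b J)
    have "J \<subseteq> Basis" using insert.prems by simp
    from insert.IH[OF this] obtain G G' X where good: "good J G G' X" by blast
    note GS = goodD(1)[OF good] and Gc = goodD(2)[OF good] and Gd = goodD(3)[OF good]
      and GX = goodD(4)[OF good] and ind = goodD(5)[OF good]
    define u where "u = G 0"
    have u: "u \<in> S" using GS e by (simp add: u_def)
    have "\<not> (\<forall>w\<in>S. \<exists>c. pull (w oo u) Y = (\<Sum>b\<in>J. fls_const (c b) * X b))"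
    proof
      assume "\<forall>w\<in>S. \<exists>c. pull (w oo u) Y = (\<Sum>b\<in>J. fls_const (c b) * X b)"
      then have ?finite_span
        by (intro bexI[OF _ u] exI[of _ J] exI[of _ X] conjI insert.hyps(1))
      with neg show False by (rule notE)
    qed
    then have "\<exists>w\<in>S. \<not> (\<exists>c. pull (w oo u) Y = (\<Sum>b\<in>J. fls_const (c b) * X b))"
      by (simp only: Set.ball_simps not_not)
    then obtain w where "w \<in> S" "\<not> (\<exists>c. pull (w oo u) Y = (\<Sum>b\<in>J. fls_const (c b) * X b))"
      by (elim bexE)
    then have w: "w \<in> S" "\<And>c. pull (w oo u) Y \<noteq> (\<Sum>b\<in>J. fls_const (c b) * X b)"
      by simp_all
    have wu: "w oo u \<in> S" using Scomp w u by blast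
    \<comment> \<open>\<open>w\<close> was chosen so that this pull-back lies outside the span of
      the old \<open>X b\<close>. The new coordinate moves the outermost factor \<open>H\<close>,
      and the old family stays innermost.\<close>
    define X2 where "X2 = X(b := pull (w oo u) Y)"
    define K where "K t = w oo G t" for t
    define K' where "K' h = (fps_deriv w oo u) * G' h" for h
    define G2 where "G2 t = H (t \<bullet> b) oo K t" for t
    define G2' where "G2' h = ((fps_const (h \<bullet> b) * D) oo (w oo u)) + (fps_deriv (H 0) oo (w oo u)) * K' h" for h
    have b1: "norm b = 1" using insert.prems by simp
    have tb: "\<bar>t \<bullet> b\<bar> < e" if "t \<in> ball 0 e" for t
      using Cauchy_Schwarz_ineq2[of t b] b1 that by simp
    have G'0: "G' h $ 0 = 0" for h
    proof -
      have "((\<lambda>t. G t $ 0) has_derivative (\<lambda>h. 0)) (at 0)"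
        by (rule has_derivative_transform_within_open[of "\<lambda>_. 0" _ _ _ "ball 0 e"]) (use GS S0 e in auto)
      moreover have "((\<lambda>t. G t $ 0) has_derivative (\<lambda>h. G' h $ 0)) (at 0)"
        using Gd by (simp add: has_fps_derivative_def)
      ultimately have "(\<lambda>h. 0) = (\<lambda>h. G' h $ 0)" by (rule has_derivative_unique)
      then show ?thesis by metis
    qed
    have Kd: "has_fps_derivative K K' 0"
      using has_fps_derivative_compose[OF has_fps_derivative_const Gd, of w] S0[OF u] G'0
      unfolding K_def K'_def u_def[symmetric] by (simp add: u_def[symmetric])
    have K'0: "K' h $ 0 = 0" for h using G'0 by (simp add: K'_def)
    have Hb: "has_fps_derivative (\<lambda>t. H (t \<bullet> b)) (\<lambda>h. fps_const (h \<bullet> b) * D) 0"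
      unfolding has_fps_derivative_def
    proof
      fix n
      have "((\<lambda>t. t \<bullet> b) has_derivative (\<lambda>h. h \<bullet> b)) (at 0)"
        by (intro derivative_eq_intros) auto
      moreover have "((\<lambda>s. H s $ n) has_derivative (\<lambda>s. D $ n * s)) (at ((0::'m \<times> real) \<bullet> b))"
        using Hder[of n] by (simp add: has_field_derivative_def)
      ultimately have "((\<lambda>t. H (t \<bullet> b) $ n) has_derivative (\<lambda>h. D $ n * (h \<bullet> b))) (at 0)"
        by (rule has_derivative_compose)
      then show "((\<lambda>t. H (t \<bullet> b) $ n) has_derivative (\<lambda>h. (fps_const (h \<bullet> b) * D) $ n)) (at 0)"
        by (simp add: mult.commute)
    qed
    have K0: "K 0 = w oo u" by (simp add: K_def u_def)
    have "has_fps_derivative G2 G2' 0"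
      using has_fps_derivative_compose[OF Hb Kd] S0[OF wu] K'0
      by (simp add: G2_def[abs_def] G2'_def[abs_def] K0)
    moreover have "\<forall>t\<in>ball 0 e. G2 t \<in> S"
      using GS HS tb Scomp w by (auto simp: G2_def K_def)
    moreover have "\<forall>n. continuous_on (ball 0 e) (\<lambda>t. G2 t $ n)"
      unfolding G2_def K_def
    proof (intro allI continuous_on_fps_compose continuous_on_const Gc)
      show "continuous_on (ball 0 e) (\<lambda>t. H (t \<bullet> b) $ n)" for n
      proof (rule continuous_on_compose2[OF Hcont])
        show "(\<lambda>t. t \<bullet> b) ` ball 0 e \<subseteq> {-e<..<e}"
        proof (rule image_subsetI)
          fix t :: "'m \<times> real" assume "t \<in> ball 0 e"
          from tb[OF this] show "t \<bullet> b \<in> {-e<..<e}" unfolding greaterThanLessThan_iff by linarith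
        qed
      qed (intro continuous_intros)
    qed
    moreover have "\<forall>h. fps_to_fls (G2' h) = fps_to_fls (fps_deriv (G2 0)) *
        (\<Sum>b\<in>insert b J. fls_const (h \<bullet> b) * X2 b)"
    proof
      fix h
      have nz: "fps_deriv (w oo u) \<noteq> 0" "fps_deriv (H 0) oo (w oo u) \<noteq> 0"
        using fps_deriv_nonzero[OF S0[OF wu] Snz[OF wu]] fps_deriv_nonzero[OF S0[OF HS0] Snz[OF HS0]]
          S0[OF wu] Snz[OF wu] by (simp_all only: fps_compose_eq_0_iff simp_thms)
      have d: "fps_deriv (G2 0) = (fps_deriv (H 0) oo (w oo u)) * ((fps_deriv w oo u) * fps_deriv u)"
        by (simp add: G2_def K0 fps_compose_deriv[OF S0[OF wu]] fps_compose_deriv[OF S0[OF u]])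
      have dwu: "fps_deriv (w oo u) = (fps_deriv w oo u) * fps_deriv u"
        by (simp add: fps_compose_deriv[OF S0[OF u]])
      \<comment> \<open>The derivative of the whole composite is \<open>(H 0)'\<close> at
        \<open>w oo u\<close>, times \<open>(w oo u)'\<close>; these two factors cancel the
        denominators of \<open>Y\<close> and of \<open>pull\<close>.\<close>
      have p: "fps_to_fls (fps_deriv (G2 0)) * pull (w oo u) Y = fps_to_fls (D oo (w oo u))"
        using nz S0[OF wu] Snz[OF wu] unfolding d dwu[symmetric] Y_def pull_def
        by (simp add: fls_compose_fps_divide fls_times_fps_to_fls)
      have s: "(\<Sum>b\<in>insert b J. fls_const (h \<bullet> b) * X2 b)
          = fls_const (h \<bullet> b) * pull (w oo u) Y + (\<Sum>b\<in>J. fls_const (h \<bullet> b) * X b)"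
        using insert.hyps by (auto simp: X2_def intro!: sum.cong)
      have "fps_to_fls (fps_deriv (G2 0)) * (\<Sum>b\<in>insert b J. fls_const (h \<bullet> b) * X2 b)
          = fls_const (h \<bullet> b) * fps_to_fls (D oo (w oo u)) +
            fps_to_fls (fps_deriv (G2 0)) * (\<Sum>b\<in>J. fls_const (h \<bullet> b) * X b)"
        unfolding s p[symmetric] by (simp add: algebra_simps)
      also have "\<dots> = fls_const (h \<bullet> b) * fps_to_fls (D oo (w oo u)) +
            fps_to_fls ((fps_deriv (H 0) oo (w oo u)) * (fps_deriv w oo u)) * fps_to_fls (G' h)"
        unfolding d GX u_def[symmetric] by (simp add: fls_times_fps_to_fls mult.assoc)
      also have "\<dots> = fps_to_fls (G2' h)"
        using S0[OF wu] by (simp add: G2'_def K'_def fls_times_fps_to_fls fps_compose_mult_distrib mult.assoc)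
      finally show "fps_to_fls (G2' h) = fps_to_fls (fps_deriv (G2 0)) *
        (\<Sum>b\<in>insert b J. fls_const (h \<bullet> b) * X2 b)" by simp
    qed
    moreover have "\<forall>c. (\<Sum>b\<in>insert b J. fls_const (c b) * X2 b) = 0 \<longrightarrow> (\<forall>b\<in>insert b J. c b = 0)"
    proof (intro allI impI)
      fix c assume c: "(\<Sum>b\<in>insert b J. fls_const (c b) * X2 b) = 0"
      have s: "(\<Sum>b\<in>insert b J. fls_const (c b) * X2 b)
          = fls_const (c b) * pull (w oo u) Y + (\<Sum>b\<in>J. fls_const (c b) * X b)"
        using insert.hyps by (auto simp: X2_def intro!: sum.cong)
      have "c b = 0"
      proof (rule ccontr)
        assume cb: "c b \<noteq> 0"
        have "pull (w oo u) Y = fls_const (- 1 / c b) * (\<Sum>b\<in>J. fls_const (c b) * X b)"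
        proof -
          have "fls_const (c b) * pull (w oo u) Y = - (\<Sum>b\<in>J. fls_const (c b) * X b)"
            using c s by (simp add: eq_neg_iff_add_eq_0)
          then have "fls_const (1 / c b) * (fls_const (c b) * pull (w oo u) Y) = fls_const (- 1 / c b) * (\<Sum>b\<in>J. fls_const (c b) * X b)"
            by simp
          then show ?thesis using cb by (simp add: mult.assoc[symmetric])
        qed
        also have "\<dots> = (\<Sum>b'\<in>J. fls_const (- 1 / c b * c b') * X b')"
          by (simp only: sum_distrib_left mult.assoc[symmetric] fls_const_mult_const)
        finally show False by (rule notE[OF w(2)[of "\<lambda>b'. - 1 / c b * c b'"]])
      qed
      moreover from this c s have "(\<Sum>b\<in>J. fls_const (c b) * X b) = 0" by simp
      ultimately show "\<forall>b\<in>insert b J. c b = 0" using ind by blast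
    qed
    ultimately have "good (insert b J) G2 G2' X2" unfolding good_def by (intro conjI)
    then show ?case by blast
  qed
  from this[OF finite_Basis order_refl] obtain G G' X
    where good: "good Basis G G' X" by blast
  note GS = goodD(1)[OF good] and Gc = goodD(2)[OF good] and Gd = goodD(3)[OF good]
    and GX = goodD(4)[OF good] and ind = goodD(5)[OF good]
  have G0: "G 0 \<in> S" using GS e by simp
  obtain V and \<phi> :: "'m \<Rightarrow> real fps" and U where U: "open U" "fps_nth (G 0) \<in> U"
      "{Q \<in> S. fps_nth Q \<in> U} \<subseteq> \<phi> ` V" "\<And>n. (\<lambda>x. \<phi> x $ n) differentiable_on V"
    using chart[OF G0] by blast
  show False
  proof (rule no_immersion_into_lower_dimension[OF _ e Gc Gd _ U(1,2) _ U(4)])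
    show "DIM('m) < DIM('m \<times> real)" by simp
    show "h = 0" if "G' h = 0" for h
    proof -
      have "(\<Sum>b\<in>Basis. fls_const (h \<bullet> b) * X b) = 0"
        using GX[of h] that fps_deriv_nonzero[OF S0[OF G0] Snz[OF G0]] by simp
      then have "h \<bullet> b = 0" if "b \<in> Basis" for b using ind[of "\<lambda>b. h \<bullet> b"] that by blast
      then show ?thesis using euclidean_all_zero_iff by blast
    qed
    show "G t \<in> \<phi> ` V" if "t \<in> ball 0 e" "fps_nth (G t) \<in> U" for t
      using U(3) GS that by blast
  qed
qed

section \<open>Convergence of the eigenvector\<close>

lemma fps_deriv_gf_nonzero:
  assumes "pmf N 0 = 0"
  shows "gf N \<noteq> 0" "fps_deriv (gf N) \<noteq> 0"
proof -
  show nz: "gf N \<noteq> 0"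
  proof
    assume "gf N = 0"
    then have "\<forall>n. pmf N n = 0" by (metis fps_zero_nth gf_nth)
    then show False using set_pmf_not_empty[of N] by (auto simp: set_pmf_iff)
  qed
  show "fps_deriv (gf N) \<noteq> 0" by (rule fps_deriv_nonzero[OF _ nz]) (simp add: assms)
qed

text \<open>On the unit interval, moving all mass above 1 to the point 2 can only increase the pgf.
  The bound yields both \<open>pgf N t < t\<close> and linear contraction near 0.\<close>

lemma pgf_upper_bound:
  assumes "pmf N 0 = 0" "0 \<le> t" "t \<le> 1"
  shows "pgf N t \<le> pmf N 1 * t + (1 - pmf N 1) * t\<^sup>2"
proof -
  have s1: "summable (pmf N)" and le1: "(\<Sum>n. pmf N n) \<le> 1"
    using summable_pgf[of 1 N] pgf_le_1[of 1 N] by (simp_all add: pgf_def)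
  let ?g = "\<lambda>n. (if n = 1 then pmf N 1 * t - pmf N 1 * t\<^sup>2 else 0) + pmf N n * t\<^sup>2"
  have 1: "(\<lambda>n. if n = 1 then pmf N 1 * t - pmf N 1 * t\<^sup>2 else 0) sums (pmf N 1 * t - pmf N 1 * t\<^sup>2)"
    by (rule sums_single)
  have gs: "?g sums (pmf N 1 * t - pmf N 1 * t\<^sup>2 + (\<Sum>n. pmf N n) * t\<^sup>2)"
    by (intro sums_add 1 sums_mult2 summable_sums s1)
  have fs: "(\<lambda>n. pmf N n * t ^ n) sums pgf N t"
    unfolding pgf_def using summable_pgf assms by (intro summable_sums) auto
  have le: "pmf N n * t ^ n \<le> ?g n" for n
  proof -
    consider "n = 0" | "n = 1" | "n \<ge> 2" by linarith
    then show ?thesis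
    proof cases
      case 3
      then have "t ^ n \<le> t\<^sup>2" using assms by (intro power_decreasing) auto
      then show ?thesis using 3 by (simp add: mult_left_mono)
    qed (use assms in auto)
  qed
  have "pgf N t \<le> pmf N 1 * t - pmf N 1 * t\<^sup>2 + (\<Sum>n. pmf N n) * t\<^sup>2"
    by (rule sums_le[OF le fs gs])
  also have "\<dots> \<le> pmf N 1 * t - pmf N 1 * t\<^sup>2 + 1 * t\<^sup>2"
    by (intro add_left_mono mult_right_mono le1) auto
  finally show ?thesis by (simp add: algebra_simps)
qed

lemma pgf_less:
  assumes "pmf N 0 = 0" "pmf N 1 < 1" "0 < t" "t < 1"
  shows "pgf N t < t"
proof -
  have "pgf N t \<le> pmf N 1 * t + (1 - pmf N 1) * t\<^sup>2"
    using assms by (intro pgf_upper_bound) auto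
  also have "\<dots> = t - (1 - pmf N 1) * (t * (1 - t))" by (simp add: power2_eq_square algebra_simps)
  also have "\<dots> < t" using assms by simp
  finally show ?thesis .
qed

text \<open>A Cauchy estimate; by nonnegativity a single term of the series is at most its
  sum.\<close>

lemma power_coeff_le:
  fixes F :: "real fps"
  assumes nn: "\<And>n. F $ n \<ge> 0" and t: "t > 0" and F: "abs_conv_at F t"
  shows "(F ^ j) $ m \<le> eval_fps F t ^ j / t ^ m"
proof -
  have s: "(\<lambda>n. (F ^ j) $ n * t ^ n) sums (eval_fps F t ^ j)"
    using abs_conv_power[OF F, of j] abs_conv_sums by metis
  have "(F ^ j) $ m * t ^ m \<le> (\<Sum>n. (F ^ j) $ n * t ^ n)"
    using sum_le_suminf[of "\<lambda>n. (F ^ j) $ n * t ^ n" "{m}"] s t fps_power_nonneg[OF nn]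
    by (auto simp: sums_iff)
  then show ?thesis using s t by (simp add: sums_iff field_simps)
qed

text \<open>
  The coefficient of degree \<open>n + d - 1\<close> of the functional equation, where \<open>d\<close> is the order of \<open>gf N\<close>,
  bounds the \<open>n\<close>-th coefficient of \<open>Z\<close> by the earlier ones.
\<close>

lemma eigenvector_converges:
  assumes N: "pmf N 0 = 0" "pmf N 1 < 1" and k: "k \<noteq> 0"
    and Z: "Z oo gf N = fps_const k * fps_deriv (gf N) * Z"
  shows "\<exists>r>0. abs_conv_at Z r"
proof -
  define f where "f = gf N"
  have f0: "f $ 0 = 0" and fnn: "\<And>n. f $ n \<ge> 0" and fle: "\<And>n. f $ n \<le> 1"
    using N by (simp_all add: f_def pmf_le_1)
  have fnz: "f \<noteq> 0" unfolding f_def by (rule fps_deriv_gf_nonzero[OF N(1)])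
  define d where "d = subdegree f"
  have d1: "d \<ge> 1" using f0 fnz by (simp add: d_def subdegree_eq_0_iff Suc_le_eq zero_less_iff_neq_zero)
  define a where "a = f $ d"
  have a: "a > 0" using fnz fnn[of d] by (simp add: a_def d_def order_less_le)
  \<comment> \<open>The absolute value of the factor \<open>k * d * a\<close> with which
    \<open>Z $ n\<close> enters the right-hand side in degree \<open>n + d - 1\<close>.\<close>
  define M where "M = \<bar>k\<bar> * d * a"
  have M: "M > 0" using k d1 a by (simp add: M_def)
  define f1 where "f1 = pmf N 1"
  have f1: "0 \<le> f1" "f1 < 1" using N by (simp_all add: f1_def)
  \<comment> \<open>A ratio above 1 with \<open>\<rho> * f1 < 1\<close>. For small \<open>x\<close>,
    \<open>f\<close> then maps the radius \<open>r = \<rho> * x\<close> to \<open>F < x\<close>, and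
    a Cauchy estimate at \<open>r\<close> measured with the weight \<open>x ^ n\<close> gains the
    decaying factor \<open>(1/\<rho>) ^ n\<close>.\<close>
  define \<rho> where "\<rho> = 2 / (1 + f1)"
  have \<rho>: "\<rho> > 1" "\<rho> * f1 < 1" using f1 by (simp_all add: \<rho>_def field_simps)
  define B where "B = (\<Sum>i. real (i + 1 + d) * (1/2) ^ i)"
  have Bs: "summable (\<lambda>i. real (i + 1 + d) * (1/2::real) ^ i)"
  proof -
    have "summable (\<lambda>i. of_nat (Suc i) * (1/2::real) ^ i + real d * (1/2) ^ i)"
      using geometric_deriv_sums[of "1/2::real"]
      by (intro summable_add summable_mult summable_geometric) (auto simp: sums_iff)
    then show ?thesis by (simp add: algebra_simps)
  qed
  have B: "B > 0" unfolding B_def by (rule suminf_pos[OF Bs]) auto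
  \<comment> \<open>The four bounds serve, in this order, to compare with the series
    \<open>B\<close>, to have \<open>r \<le> 1\<close>, to have \<open>F < x\<close>, and to keep
    the contribution of the higher coefficients of \<open>f'\<close> below
    \<open>M / 4\<close>.\<close>
  define x where "x = Min {1/2, 1/\<rho>, (1 - \<rho> * f1) / (2 * \<rho>\<^sup>2), M / (4 * \<bar>k\<bar> * B)}"
  have x: "x > 0" "x \<le> 1/2" "x \<le> 1/\<rho>" "x \<le> (1 - \<rho> * f1) / (2 * \<rho>\<^sup>2)" "x \<le> M / (4 * \<bar>k\<bar> * B)"
  proof -
    show "x > 0"
      unfolding x_def using \<rho> M B k by (subst Min_gr_iff) auto
  qed (unfold x_def, (rule Min_le; simp)+)
  define r where "r = \<rho> * x"
  have r: "0 < r" "r \<le> 1"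
    using mult_left_mono[OF x(3), of \<rho>] x(1) \<rho>(1) by (simp_all add: r_def)
  define F where "F = eval_fps f r"
  have F0: "F \<ge> 0" using r by (simp add: F_def f_def eval_gf pgf_nonneg)
  have Fx: "F < x"
  proof -
    have "F \<le> f1 * r + (1 - f1) * r\<^sup>2"
      using pgf_upper_bound[of N r] r N by (simp add: F_def f_def eval_gf f1_def)
    also have "\<dots> \<le> f1 * r + 1 * r\<^sup>2" using f1 by (intro add_left_mono mult_right_mono) auto
    also have "\<dots> = x * (\<rho> * f1 + \<rho>\<^sup>2 * x)" by (simp add: r_def power2_eq_square algebra_simps)
    also have "\<dots> < x * 1"
    proof (rule mult_strict_left_mono)
      have "\<rho>\<^sup>2 * x \<le> (1 - \<rho> * f1) / 2"
        using mult_left_mono[OF x(4), of "\<rho>\<^sup>2"] \<rho> by simp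
      also have "\<dots> < 1 - \<rho> * f1" using \<rho>(2) by simp
      finally show "\<rho> * f1 + \<rho>\<^sup>2 * x < 1" by simp
    qed (use x(1) in simp)
    finally show ?thesis by simp
  qed
  define q where "q = F / x"
  have q: "0 \<le> q" "q < 1" using F0 Fx x(1) by (simp_all add: q_def)
  have fc: "abs_conv_at f r" using r by (simp add: f_def abs_conv_gf)
  have pc: "(f ^ j) $ m \<le> F ^ j / r ^ m" for j m
    using power_coeff_le[OF fnn r(1) fc] by (simp add: F_def)
  \<comment> \<open>In this degree \<open>Z $ n\<close> meets the leading coefficient of
    \<open>f'\<close>. Indices above \<open>n\<close> drop out on both sides, because
    \<open>f ^ j\<close> has order \<open>d * j\<close> and \<open>f'\<close> has order
    \<open>d - 1\<close>.\<close>
  have main_eq: "k * (\<Sum>j\<le>n. Z $ j * (real (n - j + d) * f $ (n - j + d))) = (\<Sum>j\<le>n. Z $ j * (f ^ j) $ (n + d - 1))" for n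
  proof -
    have "(Z oo f) $ (n + d - 1) = (\<Sum>j\<le>n. Z $ j * (f ^ j) $ (n + d - 1))"
      unfolding fps_compose_nth
    proof (rule sum.mono_neutral_right)
      show "\<forall>j\<in>{0..n + d - 1} - {..n}. Z $ j * (f ^ j) $ (n + d - 1) = 0"
      proof
        fix j assume "j \<in> {0..n + d - 1} - {..n}"
        then have "j \<ge> Suc n" by auto
        then have "d * Suc n \<le> d * j" by (intro mult_left_mono) auto
        moreover have "n + d - 1 < d * Suc n"
          using mult_le_mono1[OF d1, of n] d1 unfolding mult_Suc_right mult_1_left by linarith
        ultimately have "n + d - 1 < d * j" by (rule less_le_trans[rotated])
        then have "n + d - 1 < subdegree (f ^ j)" by (simp add: d_def mult.commute)
        from nth_less_subdegree_zero[OF this] show "Z $ j * (f ^ j) $ (n + d - 1) = 0"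
          by (simp only: mult_zero_right)
      qed
    qed (use d1 in auto)
    moreover have "(fps_const k * fps_deriv f * Z) $ (n + d - 1)
        = k * (\<Sum>j\<le>n. Z $ j * (real (n - j + d) * f $ (n - j + d)))"
    proof -
      have "(Z * fps_deriv f) $ (n + d - 1) = (\<Sum>j=0..n + d - 1. Z $ j * fps_deriv f $ (n + d - 1 - j))"
        by (rule fps_mult_nth)
      also have "\<dots> = (\<Sum>j\<le>n. Z $ j * fps_deriv f $ (n + d - 1 - j))"
      proof (rule sum.mono_neutral_right)
        show "\<forall>j\<in>{0..n + d - 1} - {..n}. Z $ j * fps_deriv f $ (n + d - 1 - j) = 0"
        proof
          fix j assume "j \<in> {0..n + d - 1} - {..n}"
          then have "Suc (n + d - 1 - j) < subdegree f" unfolding d_def[symmetric] by auto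
          from nth_less_subdegree_zero[OF this] show "Z $ j * fps_deriv f $ (n + d - 1 - j) = 0"
            by (simp only: fps_deriv_nth Suc_eq_plus1 mult_zero_right)
        qed
      qed (use d1 in auto)
      also have "\<dots> = (\<Sum>j\<le>n. Z $ j * (real (n - j + d) * f $ (n - j + d)))"
      proof (rule sum.cong)
        fix j assume "j \<in> {..n}"
        then have "Suc (n + d - 1 - j) = n - j + d" using d1 by auto
        then show "Z $ j * fps_deriv f $ (n + d - 1 - j) = Z $ j * (real (n - j + d) * f $ (n - j + d))"
          by (metis Suc_eq_plus1 fps_deriv_nth)
      qed simp
      finally show ?thesis by (simp add: mult.assoc mult.commute[of Z])
    qed
    ultimately show ?thesis using Z by (simp add: f_def)
  qed
  have small: "(\<lambda>n. (1/\<rho>) ^ n * (1 / (r ^ (d - 1) * (1 - q)))) \<longlonglongrightarrow> 0"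
    by (rule tendsto_mult_left_zero) (rule LIMSEQ_power_zero, use \<rho> in auto)
  then have "\<forall>\<^sub>F n in sequentially. (1/\<rho>) ^ n * (1 / (r ^ (d - 1) * (1 - q))) < M / 4"
    by (rule order_tendstoD) (use M in simp)
  then obtain n1 where n1: "\<And>n. n \<ge> n1 \<Longrightarrow> (1/\<rho>) ^ n * (1 / (r ^ (d - 1) * (1 - q))) < M / 4"
    by (auto simp: eventually_sequentially)
  \<comment> \<open>The coefficients before \<open>n1\<close> obey the bound by construction; from
    \<open>n1\<close> on the contribution of the composition is below \<open>M / 4\<close>.\<close>
  define C where "C = (\<Sum>j<n1. \<bar>Z $ j\<bar> * x ^ j)"
  have C0: "C \<ge> 0" unfolding C_def by (intro sum_nonneg) (use x(1) in auto)
  have bound: "\<bar>Z $ n\<bar> * x ^ n \<le> C" for n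
  proof (induction n rule: less_induct)
    case (less n)
    show ?case
    proof (cases "n < n1")
      case True
      then show ?thesis unfolding C_def by (intro member_le_sum) (use x(1) in auto)
    next
      case False
      define A where "A j = (f ^ j) $ (n + d - 1)" for j
      define E where "E j = real (n - j + d) * f $ (n - j + d)" for j
      have Ann: "A j \<ge> 0" for j unfolding A_def by (rule fps_power_nonneg[OF fnn])
      have Enn: "E j \<ge> 0" for j unfolding E_def using fnn by simp
      have split: "Z $ n * (k * real d * a - A n) = (\<Sum>j<n. Z $ j * (A j - k * E j))"
      proof -
        have "k * ((\<Sum>j<n. Z $ j * E j) + Z $ n * E n) = (\<Sum>j<n. Z $ j * A j) + Z $ n * A n"
          using main_eq[of n] unfolding A_def E_def lessThan_Suc_atMost[symmetric] sum.lessThan_Suc .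
        moreover have "E n = real d * a" by (simp add: E_def a_def)
        moreover have "(\<Sum>j<n. Z $ j * (A j - k * E j)) = (\<Sum>j<n. Z $ j * A j) - k * (\<Sum>j<n. Z $ j * E j)"
          by (simp only: right_diff_distrib sum_subtractf sum_distrib_left mult.left_commute)
        ultimately show ?thesis by (simp only: algebra_simps)
      qed
      define K where "K = (1/\<rho>) ^ n / r ^ (d - 1)"
      have rx0: "F ^ j / r ^ (n + d - 1) * x ^ n = (x ^ j * q ^ j) * ((1/\<rho>) ^ n / r ^ (d - 1))" for j
      proof -
        have nd: "n + d - 1 = n + (d - 1)" using d1 by simp
        have "r ^ (n + d - 1) = \<rho> ^ n * x ^ n * r ^ (d - 1)"
          unfolding nd power_add by (simp only: r_def power_mult_distrib)
        moreover have "F ^ j = x ^ j * q ^ j" using x(1) by (simp add: q_def power_divide)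
        ultimately have "F ^ j / r ^ (n + d - 1) * x ^ n
            = x ^ j * q ^ j / (\<rho> ^ n * x ^ n * r ^ (d - 1)) * x ^ n" by simp
        also have "\<dots> = (x ^ j * q ^ j) * ((1/\<rho>) ^ n / r ^ (d - 1))"
          using x(1) by (simp add: power_divide)
        finally show ?thesis .
      qed
      have rx: "F ^ j / r ^ (n + d - 1) = x ^ j * q ^ j * K / x ^ n" for j
        by (rule eq_divide_imp) (use x(1) in simp, use rx0[of j] in \<open>simp only: K_def\<close>)
      have small_n: "1 / (1 - q) * K < M / 4" using n1[of n] False by (simp add: K_def mult.commute)
      have sn0: "K \<ge> 0"
        unfolding K_def using \<rho>(1) r(1) by (intro divide_nonneg_pos zero_le_power zero_less_power) auto
      have An: "A n \<le> M / 4"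
      proof -
        have "A n \<le> F ^ n / r ^ (n + d - 1)" unfolding A_def by (rule pc)
        also have "\<dots> = q ^ n * K"
          unfolding rx using x(1) by simp
        also have "\<dots> \<le> 1 / (1 - q) * K"
        proof (rule mult_right_mono[OF _ sn0])
          have "q ^ n \<le> 1" using q by (intro power_le_one) auto
          also have "1 \<le> 1 / (1 - q)" using q by simp
          finally show "q ^ n \<le> 1 / (1 - q)" .
        qed
        finally show ?thesis using small_n by (rule order.trans[OF _ less_imp_le])
      qed
      \<comment> \<open>The term \<open>A n\<close> costs the leading factor at most a quarter of
        \<open>M\<close>. The sums over \<open>A j\<close> and \<open>E j\<close> with
        \<open>j < n\<close> contribute at most another quarter each, so that \<open>M / 2\<close>
        stands against \<open>3/4 * M\<close>.\<close>
      have "\<bar>Z $ n\<bar> * (3/4 * M) \<le> \<bar>Z $ n\<bar> * \<bar>k * real d * a - A n\<bar>"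
      proof (rule mult_left_mono)
        have "\<bar>k * real d * a\<bar> = M" using a by (simp add: M_def abs_mult)
        then show "3/4 * M \<le> \<bar>k * real d * a - A n\<bar>" using An Ann[of n] by linarith
      qed simp
      also have "\<dots> = \<bar>\<Sum>j<n. Z $ j * (A j - k * E j)\<bar>" using split by (simp add: abs_mult[symmetric])
      also have "\<dots> \<le> (\<Sum>j<n. \<bar>Z $ j\<bar> * (A j + \<bar>k\<bar> * E j))"
      proof (rule order.trans[OF sum_abs], rule sum_mono)
        fix j
        have "\<bar>A j - k * E j\<bar> \<le> A j + \<bar>k\<bar> * E j"
          using abs_triangle_ineq4[of "A j" "k * E j"] Ann[of j] Enn[of j] by (simp add: abs_mult)
        then show "\<bar>Z $ j * (A j - k * E j)\<bar> \<le> \<bar>Z $ j\<bar> * (A j + \<bar>k\<bar> * E j)"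
          by (simp add: abs_mult mult_left_mono)
      qed
      finally have "\<bar>Z $ n\<bar> * (3/4 * M) * x ^ n \<le> (\<Sum>j<n. \<bar>Z $ j\<bar> * (A j + \<bar>k\<bar> * E j)) * x ^ n"
        by (rule mult_right_mono) (use x(1) in simp)
      also have "\<dots> = (\<Sum>j<n. \<bar>Z $ j\<bar> * x ^ j * (A j * x ^ (n - j) + \<bar>k\<bar> * E j * x ^ (n - j)))"
        unfolding sum_distrib_right
      proof (rule sum.cong)
        fix j assume "j \<in> {..<n}"
        then have "x ^ n = x ^ j * x ^ (n - j)" by (simp flip: power_add)
        then show "\<bar>Z $ j\<bar> * (A j + \<bar>k\<bar> * E j) * x ^ n
            = \<bar>Z $ j\<bar> * x ^ j * (A j * x ^ (n - j) + \<bar>k\<bar> * E j * x ^ (n - j))"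
          by (simp only: distrib_left distrib_right mult_ac)
      qed simp
      also have "\<dots> \<le> (\<Sum>j<n. C * (A j * x ^ (n - j) + \<bar>k\<bar> * E j * x ^ (n - j)))"
      proof (rule sum_mono)
        fix j assume j: "j \<in> {..<n}"
        have "0 \<le> A j * x ^ (n - j) + \<bar>k\<bar> * E j * x ^ (n - j)"
          by (intro add_nonneg_nonneg mult_nonneg_nonneg Ann Enn abs_ge_zero zero_le_power less_imp_le[OF x(1)])
        then show "\<bar>Z $ j\<bar> * x ^ j * (A j * x ^ (n - j) + \<bar>k\<bar> * E j * x ^ (n - j))
            \<le> C * (A j * x ^ (n - j) + \<bar>k\<bar> * E j * x ^ (n - j))"
          using less.IH[of j] j by (intro mult_right_mono) auto
      qed
      also have "\<dots> = C * ((\<Sum>j<n. A j * x ^ (n - j)) + \<bar>k\<bar> * (\<Sum>j<n. E j * x ^ (n - j)))"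
        by (simp only: sum_distrib_left sum.distrib distrib_left mult.assoc)
      also have "\<dots> \<le> C * (M / 4 + M / 4)"
      proof (intro mult_left_mono add_mono C0)
        have "(\<Sum>j<n. A j * x ^ (n - j)) \<le> (\<Sum>j<n. q ^ j * K)"
        proof (rule sum_mono)
          fix j assume "j \<in> {..<n}"
          then have xn: "x ^ (n - j) = x ^ n / x ^ j" using x(1) by (simp add: power_diff)
          have "A j * x ^ (n - j) \<le> F ^ j / r ^ (n + d - 1) * x ^ (n - j)"
            unfolding A_def by (intro mult_right_mono pc) (use x(1) in auto)
          also have "\<dots> = q ^ j * K"
            unfolding xn rx using x(1) by simp
          finally show "A j * x ^ (n - j) \<le> q ^ j * K" .
        qed
        also have "\<dots> = (\<Sum>j<n. q ^ j) * K" by (simp add: sum_distrib_right)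
        also have "\<dots> \<le> 1 / (1 - q) * K"
        proof (rule mult_right_mono[OF _ sn0])
          show "(\<Sum>j<n. q ^ j) \<le> 1 / (1 - q)"
            using sum_le_suminf[of "\<lambda>j. q ^ j" "{..<n}"] suminf_geometric[of q] q
            by (simp add: summable_geometric)
        qed
        finally show "(\<Sum>j<n. A j * x ^ (n - j)) \<le> M / 4" using small_n by (rule order.trans[OF _ less_imp_le])
        have "(\<Sum>j<n. E j * x ^ (n - j)) = (\<Sum>i<n. real (i + 1 + d) * f $ (i + 1 + d) * x ^ (i + 1))"
        proof -
          define g where "g i = real (i + 1 + d) * f $ (i + 1 + d) * x ^ (i + 1)" for i
          have "E j * x ^ (n - j) = g (n - Suc j)" if "j < n" for j
          proof -
            have "n - Suc j + 1 = n - j" using that by simp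
            then show ?thesis by (simp only: g_def E_def)
          qed
          then have "(\<Sum>j<n. E j * x ^ (n - j)) = (\<Sum>j<n. g (n - Suc j))" by simp
          also have "\<dots> = (\<Sum>i<n. g i)" by (rule sum.nat_diff_reindex)
          finally show ?thesis by (simp only: g_def)
        qed
        also have "\<dots> \<le> (\<Sum>i<n. x * (real (i + 1 + d) * (1/2) ^ i))"
        proof (rule sum_mono)
          fix i
          have "f $ (i + 1 + d) * x ^ i \<le> 1 * (1/2) ^ i"
            by (rule mult_mono[OF fle power_mono[OF x(2) less_imp_le[OF x(1)]] zero_le_one
                zero_le_power[OF less_imp_le[OF x(1)]]])
          then have "(real (i + 1 + d) * x) * (f $ (i + 1 + d) * x ^ i) \<le> (real (i + 1 + d) * x) * (1 * (1/2) ^ i)"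
            using x(1) by (intro mult_left_mono) auto
          then show "real (i + 1 + d) * f $ (i + 1 + d) * x ^ (i + 1) \<le> x * (real (i + 1 + d) * (1/2) ^ i)"
            by (simp only: power_add power_one_right mult_ac mult_1_left)
        qed
        also have "\<dots> = x * (\<Sum>i<n. real (i + 1 + d) * (1/2) ^ i)" by (simp add: sum_distrib_left)
        also have "\<dots> \<le> x * B"
          unfolding B_def by (intro mult_left_mono sum_le_suminf Bs) (use x(1) in auto)
        finally have "\<bar>k\<bar> * (\<Sum>j<n. E j * x ^ (n - j)) \<le> \<bar>k\<bar> * (x * B)"
          by (intro mult_left_mono) auto
        also have "\<dots> = x * (4 * \<bar>k\<bar> * B) / 4" by simp
        also have "\<dots> \<le> M / 4"
        proof (rule divide_right_mono)
          have "4 * \<bar>k\<bar> * B > 0" using k B by simp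
          then show "x * (4 * \<bar>k\<bar> * B) \<le> M" using x(5) pos_le_divide_eq by blast
        qed simp
        finally show "\<bar>k\<bar> * (\<Sum>j<n. E j * x ^ (n - j)) \<le> M / 4" .
      qed
      finally have "(3/4 * M) * (\<bar>Z $ n\<bar> * x ^ n) \<le> (3/4 * M) * C"
        using M C0 by (simp add: algebra_simps)
      then show ?thesis using M by (simp add: mult.commute)
    qed
  qed
  have "abs_conv_at Z (x / 2)"
    unfolding abs_conv_at_def
  proof (rule summable_comparison_test)
    show "summable (\<lambda>n. C * (1/2::real) ^ n)"
      by (intro summable_mult summable_geometric) simp
    show "\<exists>N. \<forall>n\<ge>N. norm (norm (Z $ n * (x / 2) ^ n)) \<le> C * (1/2) ^ n"
    proof (intro exI allI impI)
      fix n
      have "norm (norm (Z $ n * (x / 2) ^ n)) = \<bar>Z $ n\<bar> * x ^ n * (1/2) ^ n"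
        using x(1) by (simp add: abs_mult power_divide)
      also have "\<dots> \<le> C * (1/2) ^ n" by (rule mult_right_mono[OF bound]) simp
      finally show "norm (norm (Z $ n * (x / 2) ^ n)) \<le> C * (1/2) ^ n" .
    qed
  qed
  then show ?thesis using x(1) by (intro exI[of _ "x / 2"]) auto
qed

section \<open>Conjugation to affine maps\<close>

text \<open>
  The fixed point of the affine map belonging to \<open>h\<close> lies outside the range of \<open>s\<close>, hence is an end of
  it, which is also preserved by the affine map belonging to \<open>g\<close>.
\<close>

lemma affine_common_fixed_point:
  fixes s g h :: "real \<Rightarrow> real"
  assumes s: "\<And>x y. 0 < x \<Longrightarrow> x < y \<Longrightarrow> y < 1 \<Longrightarrow> s x < s y"
    and g: "\<And>t. 0 < t \<Longrightarrow> t < 1 \<Longrightarrow> 0 < g t \<and> g t < t" "\<And>t. 0 < t \<Longrightarrow> t < 1 \<Longrightarrow> \<exists>u. 0 < u \<and> u < 1 \<and> g u = t"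
    and h: "\<And>t. 0 < t \<Longrightarrow> t < 1 \<Longrightarrow> 0 < h t \<and> h t < t" "\<And>t. 0 < t \<Longrightarrow> t < 1 \<Longrightarrow> \<exists>u. 0 < u \<and> u < 1 \<and> h u = t"
    and sg: "\<And>t. 0 < t \<Longrightarrow> t < 1 \<Longrightarrow> s (g t) = a * s t + c"
    and sh: "\<And>t. 0 < t \<Longrightarrow> t < 1 \<Longrightarrow> s (h t) = b * s t + d"
    and b: "b > 0" "b \<noteq> 1"
  shows "a * (d / (1 - b)) + c = d / (1 - b)"
proof -
  define p where "p = d / (1 - b)"
  have d: "d = p * (1 - b)" using b by (simp add: p_def)
  have sh': "s (h t) - p = b * (s t - p)" if "0 < t" "t < 1" for t
    using sh[OF that] d by (simp add: algebra_simps)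
  \<comment> \<open>It suffices to approach \<open>p\<close> along values of \<open>s\<close> whose
    images under the affine map of \<open>g\<close> also tend to \<open>p\<close>.\<close>
  have lim: "a * p + c = p"
    if P: "\<exists>v w. v \<longlonglongrightarrow> p \<and> w \<longlonglongrightarrow> p \<and> (\<forall>n. w n = a * v n + c)"
  proof -
    obtain v w where vw: "v \<longlonglongrightarrow> p" "w \<longlonglongrightarrow> p" "\<And>n. w n = a * v n + c" using P by blast
    have "(\<lambda>n. a * v n + c) \<longlonglongrightarrow> a * p + c" by (intro tendsto_intros vw)
    then have "w \<longlonglongrightarrow> a * p + c" using vw(3) by presburger
    then show ?thesis using vw(2) by (rule LIMSEQ_unique)
  qed
  consider "b < 1" | "b > 1" using b by linarith
  then have "a * p + c = p"
  proof cases
    case 1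
    define x where "x t n = (h ^^ n) t" for t n
    have x01: "0 < x t n \<and> x t n < 1" if "0 < t" "t < 1" for t n
      by (induction n) (use that h(1) in \<open>fastforce simp: x_def\<close>)+
    have xdec: "x t (Suc n) < x t n" if "0 < t" "t < 1" for t n
      using h(1) x01[OF that, of n] by (simp add: x_def)
    have sx: "s (x t n) = p + b ^ n * (s t - p)" if "0 < t" "t < 1" for t n
    proof (induction n)
      case (Suc n)
      have "s (x t (Suc n)) - p = b * (s (x t n) - p)"
        using sh'[of "x t n"] x01[OF that, of n] by (simp add: x_def)
      then show ?case using Suc by simp
    qed (simp add: x_def)
    have slim: "(\<lambda>n. s (x t n)) \<longlonglongrightarrow> p" if "0 < t" "t < 1" for t
    proof -
      have "(\<lambda>n. p + b ^ n * (s t - p)) \<longlonglongrightarrow> p + 0 * (s t - p)"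
        by (intro tendsto_intros LIMSEQ_realpow_zero) (use b 1 in auto)
      then show ?thesis using sx[OF that] by simp
    qed
    have above: "p < s t" if "0 < t" "t < 1" for t
    proof -
      have dec: "decseq (\<lambda>n. s (x t n))"
        by (intro decseq_SucI less_imp_le s xdec that) (use x01[OF that] in auto)
      have "p \<le> s (x t 1)" by (rule decseq_ge[OF dec slim[OF that]])
      also have "\<dots> < s t" using s[of "x t 1" t] xdec[OF that, of 0] x01[OF that, of 1] that by (simp add: x_def)
      finally show ?thesis .
    qed
    define t0 :: real where "t0 = 1/2"
    have t0: "0 < t0" "t0 < 1" by (auto simp: t0_def)
    \<comment> \<open>Iterating \<open>h\<close> moves \<open>s\<close> down to \<open>p\<close>, so
      \<open>p\<close> lies below the range of \<open>s\<close>; as \<open>g\<close> also decreases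
      points, its values are squeezed.\<close>
    have "(\<lambda>n. s (g (x t0 n))) \<longlonglongrightarrow> p"
    proof (rule tendsto_sandwich[OF _ _ tendsto_const slim[OF t0]])
      show "\<forall>\<^sub>F n in sequentially. p \<le> s (g (x t0 n))"
        using above g(1) x01[OF t0] by (intro always_eventually allI less_imp_le) (meson less_trans)
      show "\<forall>\<^sub>F n in sequentially. s (g (x t0 n)) \<le> s (x t0 n)"
        using s g(1) x01[OF t0] by (intro always_eventually allI less_imp_le) blast
    qed
    moreover have "s (g (x t0 n)) = a * s (x t0 n) + c" for n using sg x01[OF t0] by blast
    ultimately show ?thesis using slim[OF t0] by (intro lim) blast
  next
    case 2
    \<comment> \<open>For \<open>b > 1\<close> the map \<open>h\<close> moves \<open>s\<close> away
      from \<open>p\<close>. The backward orbit climbs to \<open>p\<close>, now above the range of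
      \<open>s\<close>, and preimages under \<open>g\<close> are squeezed from below.\<close>
    define k where "k t = (SOME u. 0 < u \<and> u < 1 \<and> h u = t)" for t
    have k: "0 < k t \<and> k t < 1 \<and> h (k t) = t" if "0 < t" "t < 1" for t
      unfolding k_def by (rule someI_ex) (use h(2) that in blast)
    have kt: "t < k t" if "0 < t" "t < 1" for t using k[OF that] h(1)[of "k t"] by auto
    have sk: "s (k t) - p = (1 / b) * (s t - p)" if "0 < t" "t < 1" for t
      using sh'[of "k t"] k[OF that] b by simp
    define x where "x t n = (k ^^ n) t" for t n
    have x01: "0 < x t n \<and> x t n < 1" if "0 < t" "t < 1" for t n
      by (induction n) (use that k in \<open>auto simp: x_def\<close>)
    have xinc: "x t n < x t (Suc n)" if "0 < t" "t < 1" for t n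
      using kt x01[OF that, of n] by (simp add: x_def)
    have sx: "s (x t n) = p + (1 / b) ^ n * (s t - p)" if "0 < t" "t < 1" for t n
    proof (induction n)
      case (Suc n)
      have "s (x t (Suc n)) - p = (1 / b) * (s (x t n) - p)"
        using sk[of "x t n"] x01[OF that, of n] by (simp add: x_def)
      then show ?case using Suc by simp
    qed (simp add: x_def)
    have slim: "(\<lambda>n. s (x t n)) \<longlonglongrightarrow> p" if "0 < t" "t < 1" for t
    proof -
      have "(\<lambda>n. p + (1 / b) ^ n * (s t - p)) \<longlonglongrightarrow> p + 0 * (s t - p)"
        by (intro tendsto_intros LIMSEQ_realpow_zero) (use b 2 in auto)
      then show ?thesis using sx[OF that] by simp
    qed
    have below: "s t < p" if "0 < t" "t < 1" for t
    proof -
      have inc: "incseq (\<lambda>n. s (x t n))"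
        by (intro incseq_SucI less_imp_le s xinc that) (use x01[OF that] in auto)
      have "s t < s (x t 1)" using s[of t "x t 1"] xinc[OF that, of 0] x01[OF that, of 1] that by (simp add: x_def)
      also have "\<dots> \<le> p" by (rule incseq_le[OF inc slim[OF that]])
      finally show ?thesis .
    qed
    define t0 :: real where "t0 = 1/2"
    have t0: "0 < t0" "t0 < 1" by (auto simp: t0_def)
    define z where "z n = (SOME u. 0 < u \<and> u < 1 \<and> g u = x t0 n)" for n
    have z: "0 < z n \<and> z n < 1 \<and> g (z n) = x t0 n" for n
      unfolding z_def by (rule someI_ex) (use g(2) x01[OF t0] in blast)
    have zx: "x t0 n < z n" for n using z[of n] g(1)[of "z n"] by auto
    have "(\<lambda>n. s (z n)) \<longlonglongrightarrow> p"
    proof (rule tendsto_sandwich[OF _ _ slim[OF t0] tendsto_const])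
      show "\<forall>\<^sub>F n in sequentially. s (z n) \<le> p"
        using below z by (intro always_eventually allI less_imp_le) blast
      show "\<forall>\<^sub>F n in sequentially. s (x t0 n) \<le> s (z n)"
        using s zx z x01[OF t0] by (intro always_eventually allI less_imp_le) blast
    qed
    moreover have "s (x t0 n) = a * s (z n) + c" for n using sg[of "z n"] z[of n] by simp
    ultimately show ?thesis using slim[OF t0] by (intro lim) blast
  qed
  then show ?thesis by (simp add: p_def)
qed

text \<open>The affine maps commute exactly if \<open>a * d + c = b * c + d\<close>. This is clear
  for two translations; otherwise one of the maps has slope different from 1, and its fixed point is
  also fixed by the other. Injectivity of \<open>s\<close> carries the identity back to
  \<open>g\<close> and \<open>h\<close>.\<close>

lemma affine_conjugates_commute:
  fixes s g h :: "real \<Rightarrow> real"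
  assumes s: "\<And>x y. 0 < x \<Longrightarrow> x < y \<Longrightarrow> y < 1 \<Longrightarrow> s x < s y"
    and g: "\<And>t. 0 < t \<Longrightarrow> t < 1 \<Longrightarrow> 0 < g t \<and> g t < t" "\<And>t. 0 < t \<Longrightarrow> t < 1 \<Longrightarrow> \<exists>u. 0 < u \<and> u < 1 \<and> g u = t"
    and h: "\<And>t. 0 < t \<Longrightarrow> t < 1 \<Longrightarrow> 0 < h t \<and> h t < t" "\<And>t. 0 < t \<Longrightarrow> t < 1 \<Longrightarrow> \<exists>u. 0 < u \<and> u < 1 \<and> h u = t"
    and sg: "\<And>t. 0 < t \<Longrightarrow> t < 1 \<Longrightarrow> s (g t) = a * s t + c"
    and sh: "\<And>t. 0 < t \<Longrightarrow> t < 1 \<Longrightarrow> s (h t) = b * s t + d"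
    and ab: "a > 0" "b > 0" and t: "0 < t" "t < 1"
  shows "g (h t) = h (g t)"
proof -
  have cd: "a * d + c = b * c + d"
  proof (cases "b = 1")
    case False
    then have "a * (d / (1 - b)) + c = d / (1 - b)"
      using affine_common_fixed_point[of s g h a c b d] s g h sg sh ab(2) by blast
    moreover define p where "p = d / (1 - b)"
    ultimately have c: "c = p - a * p" by simp
    have d: "d = p - p * b" using False by (simp add: p_def divide_simps) (simp add: algebra_simps)
    show ?thesis unfolding c d by (simp add: algebra_simps)
  next
    case b1: True
    show ?thesis
    proof (cases "a = 1")
      case False
      then have "b * (c / (1 - a)) + d = c / (1 - a)"
        using affine_common_fixed_point[of s h g b d a c] s g h sg sh ab(1) by blast
      then show ?thesis using b1 by simp
    qed (use b1 in simp)
  qed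
  have i: "0 < g t" "g t < 1" "0 < h t" "h t < 1" using g(1)[OF t] h(1)[OF t] t by auto
  have j: "0 < g (h t)" "g (h t) < 1" "0 < h (g t)" "h (g t) < 1"
    using g(1)[OF i(3,4)] h(1)[OF i(1,2)] i by auto
  have "s (g (h t)) = a * (b * s t + d) + c" using sg[OF i(3,4)] sh[OF t] by simp
  also have "\<dots> = b * (a * s t + c) + d" using cd by (simp add: algebra_simps)
  also have "\<dots> = s (h (g t))" using sh[OF i(1,2)] sg[OF t] by simp
  finally have eq: "s (g (h t)) = s (h (g t))" .
  show ?thesis
  proof (rule linorder_cases[of "g (h t)" "h (g t)"])
    assume "g (h t) < h (g t)" from s[OF j(1) this j(4)] show ?thesis using eq by simp
  next
    assume "h (g t) < g (h t)" from s[OF j(3) this j(2)] show ?thesis using eq by simp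
  qed
qed

section \<open>Analytic properties of pgfs on the unit interval\<close>

lemma pgf_0: "pmf N 0 = 0 \<Longrightarrow> pgf N 0 = 0"
  by (simp add: pgf_def powser_zero)

lemma pgf_1: "pgf N 1 = 1"
proof -
  have "ennreal (pgf N 1) = (\<integral>\<^sup>+n. ennreal (1 ^ n) \<partial>measure_pmf N)"
    by (rule nn_integral_pgf[symmetric]) simp
  also have "\<dots> = 1" by simp
  finally show ?thesis by (simp add: pgf_nonneg)
qed

lemma continuous_on_pgf: "continuous_on {0..1} (pgf N)"
proof -
  have "uniform_limit {0..1} (\<lambda>n t. \<Sum>i<n. pmf N i * t ^ i) (\<lambda>t. \<Sum>i. pmf N i * t ^ i) sequentially"
  proof (rule Weierstrass_m_test)
    show "norm (pmf N n * t ^ n) \<le> pmf N n" if "t \<in> {0..1}" for n t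
      using that by (auto simp: abs_mult mult_left_le power_le_one)
    show "summable (pmf N)" using summable_pgf[of 1 N] by simp
  qed
  then show ?thesis
    unfolding pgf_def[abs_def]
    by (rule uniform_limit_theorem[rotated]) (auto intro!: always_eventually continuous_intros)
qed

lemma pgf_pos:
  assumes "0 < t" "t \<le> 1"
  shows "0 < pgf N t"
proof -
  obtain n where n: "pmf N n > 0" using set_pmf_not_empty[of N] by (auto simp: set_pmf_iff order_less_le)
  have "0 < pmf N n * t ^ n" using n assms by simp
  also have "\<dots> \<le> pgf N t"
    unfolding pgf_def using sum_le_suminf[of "\<lambda>n. pmf N n * t ^ n" "{n}"] summable_pgf[of t N] assms by auto
  finally show ?thesis .
qed

lemma pgf_surj:
  assumes "pmf N 0 = 0" "0 < t" "t < 1"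
  shows "\<exists>u. 0 < u \<and> u < 1 \<and> pgf N u = t"
proof -
  obtain u where "0 \<le> u" "u \<le> 1" "pgf N u = t"
    using IVT'[of "pgf N" 0 t 1] assms pgf_0 pgf_1 continuous_on_pgf by auto
  then show ?thesis using assms pgf_0[of N] pgf_1[of N] by (intro exI[of _ u]) (auto simp: order_less_le)
qed

lemma pmf_1_eq_1:
  assumes "pmf N 0 = 0" "\<not> pmf N 1 < 1"
  shows "pgf N t = t"
proof -
  have p1: "pmf N 1 = 1" using assms(2) pmf_le_1[of N 1] by linarith
  have "pmf N n = (if n = 1 then 1 else 0)" for n
  proof (cases "n = 1")
    case False
    have "pmf N 1 + pmf N n = measure_pmf.prob N {1, n}"
      using False by (simp add: measure_measure_pmf_finite)
    also have "\<dots> \<le> 1" by (rule measure_pmf.prob_le_1)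
    finally show ?thesis using p1 False pmf_nonneg[of N n] by simp
  qed (use p1 in simp)
  then have "pmf N n * t ^ n = (if n = 1 then t else 0)" for n by simp
  then show ?thesis unfolding pgf_def using sums_single[of 1 "\<lambda>_. t"] by (simp add: sums_iff)
qed

definition pgf' :: "nat pmf \<Rightarrow> real \<Rightarrow> real" where
  "pgf' N = eval_fps (fps_deriv (gf N))"

lemma pgf_has_derivative:
  assumes "\<bar>t\<bar> < 1"
  shows "(pgf N has_real_derivative pgf' N t) (at t)" "abs_conv_at (fps_deriv (gf N)) t"
proof -
  have c: "abs_conv_at (gf N) 1" by (simp add: abs_conv_gf)
  show "abs_conv_at (fps_deriv (gf N)) t" by (rule abs_conv_deriv(1)[OF c assms])
  have "eval_fps (gf N) = pgf N" by (rule ext) (rule eval_gf)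
  then show "(pgf N has_real_derivative pgf' N t) (at t)"
    using abs_conv_deriv(2)[OF c assms] by (simp add: pgf'_def)
qed

lemma isCont_pgf': "\<bar>t\<bar> < 1 \<Longrightarrow> isCont (pgf' N) t"
proof -
  assume t: "\<bar>t\<bar> < 1"
  then obtain s where s: "\<bar>t\<bar> < s" "s < 1" using dense by blast
  then have "abs_conv_at (fps_deriv (gf N)) s" by (intro pgf_has_derivative) auto
  from abs_conv_deriv(2)[OF this s(1)] show ?thesis unfolding pgf'_def by (rule DERIV_isCont)
qed

lemma pgf'_pos:
  assumes "pmf N 0 = 0" "0 < t" "t < 1"
  shows "0 < pgf' N t"
proof -
  obtain n where n: "pmf N n > 0" using set_pmf_not_empty[of N] by (auto simp: set_pmf_iff order_less_le)
  then obtain m where m: "n = Suc m" using assms(1) by (cases n) auto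
  have s: "(\<lambda>n. fps_deriv (gf N) $ n * t ^ n) sums pgf' N t"
    unfolding pgf'_def by (intro abs_conv_sums pgf_has_derivative) (use assms in auto)
  have "0 < fps_deriv (gf N) $ m * t ^ m" using n assms by (simp add: m)
  also have "\<dots> \<le> (\<Sum>n. fps_deriv (gf N) $ n * t ^ n)"
    using sum_le_suminf[of "\<lambda>n. fps_deriv (gf N) $ n * t ^ n" "{m}"] s assms by (auto simp: sums_iff)
  finally show ?thesis using s by (simp add: sums_iff)
qed

section \<open>Commutation\<close>

text \<open>On \<open>(0, t]\<close> the quotient \<open>pgf f x / x\<close> is at most
  \<open>c < 1\<close>, so iterates of \<open>f\<close> contract geometrically. They carry any point
  of the open unit interval into the region where \<open>Z\<close> converges.\<close>

lemma pgf_iterate_small: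
  assumes pos: "\<And>N. N \<in> \<N> \<Longrightarrow> pmf N 0 = 0" and closed: "closed_under_pgf_comp \<N>"
    and f: "f \<in> \<N>" "pmf f 1 < 1" and t: "0 < t" "t < 1" and r: "r > 0"
  shows "\<exists>F\<in>\<N>. pgf F t < r"
proof -
  define c where "c = pmf f 1 + (1 - pmf f 1) * t"
  have c: "0 \<le> c" "c < 1"
  proof -
    show "0 \<le> c" using f t by (simp add: c_def)
    have "(1 - pmf f 1) * t < (1 - pmf f 1) * 1" using f t by (intro mult_strict_left_mono) auto
    then show "c < 1" by (simp add: c_def)
  qed
  have step: "pgf f x \<le> c * x" if "0 \<le> x" "x \<le> t" for x
  proof -
    have "pgf f x \<le> pmf f 1 * x + (1 - pmf f 1) * x\<^sup>2"
      using pgf_upper_bound[OF pos[OF f(1)], of x] that t by simp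
    also have "\<dots> = (pmf f 1 + (1 - pmf f 1) * x) * x" by (simp add: power2_eq_square algebra_simps)
    also have "\<dots> \<le> c * x"
      unfolding c_def using that f by (intro mult_right_mono add_left_mono mult_left_mono) auto
    finally show ?thesis .
  qed
  have it: "\<exists>F\<in>\<N>. pgf F t \<le> c ^ n * t" for n
  proof (induction n)
    \<comment> \<open>The identity need not be a member, so the induction starts with
      \<open>f\<close> itself.\<close>
    case 0
    have "pgf f t \<le> c * t" using step t by simp
    also have "\<dots> \<le> 1 * t" using c t by (intro mult_right_mono) auto
    finally show ?case using f by auto
  next
    case (Suc n)
    then obtain F where F: "F \<in> \<N>" "pgf F t \<le> c ^ n * t" by blast
    have 0: "0 \<le> pgf F t" using pgf_nonneg[of t F] t by simp
    have "c ^ n * t \<le> 1 * t" using c t by (intro mult_right_mono power_le_one) auto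
    then have "pgf f (pgf F t) \<le> c * pgf F t" using step[OF 0] F by simp
    also have "\<dots> \<le> c * (c ^ n * t)" using F c by (intro mult_left_mono) auto
    finally have "pgf (f \<circ>\<^sub>g F) t \<le> c ^ Suc n * t" using pgf_pgf_comp[of t f F] t by simp
    moreover have "f \<circ>\<^sub>g F \<in> \<N>" using closed f F by (auto simp: closed_under_pgf_comp_def)
    ultimately show ?case by blast
  qed
  have "(\<lambda>n. c ^ n * t) \<longlonglongrightarrow> 0" by (intro tendsto_mult_left_zero LIMSEQ_realpow_zero c)
  then have "\<forall>\<^sub>F n in sequentially. c ^ n * t < r" by (rule order_tendstoD) (rule r)
  then obtain n where "c ^ n * t < r" by (auto simp: eventually_sequentially)
  then show ?thesis using it[of n] by force
qed

lemma pgf_comp_in: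
  "closed_under_pgf_comp \<N> \<Longrightarrow> M \<in> \<N> \<Longrightarrow> N \<in> \<N> \<Longrightarrow> M \<circ>\<^sub>g N \<in> \<N>"
  by (simp add: closed_under_pgf_comp_def)

text \<open>
  \<open>V\<close> is the vector field on the open unit interval that extends the sum of the series \<open>Z\<close>, which converges near 0;
  a primitive of \<open>1 / V\<close> conjugates all pgfs to affine maps.
\<close>

lemma eigenvector_imp_commute:
  assumes pos: "\<And>N. N \<in> \<N> \<Longrightarrow> pmf N 0 = 0" and closed: "closed_under_pgf_comp \<N>"
    and Znz: "Z \<noteq> 0"
    and eig: "\<And>N. N \<in> \<N> \<Longrightarrow> \<exists>k. k \<noteq> 0 \<and> Z oo gf N = fps_const k * fps_deriv (gf N) * Z"
    and M: "M1 \<in> \<N>" "M2 \<in> \<N>"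
  shows "pgf_commute M1 M2"
proof (cases "pmf M1 1 < 1 \<and> pmf M2 1 < 1")
  case False
  then show ?thesis
    using pmf_1_eq_1[OF pos[OF M(1)]] pmf_1_eq_1[OF pos[OF M(2)]] by (auto simp: pgf_commute_def)
next
  case True
  define k where "k N = (SOME k. k \<noteq> 0 \<and> Z oo gf N = fps_const k * fps_deriv (gf N) * Z)" for N
  have k: "k N \<noteq> 0" "Z oo gf N = fps_const (k N) * fps_deriv (gf N) * Z" if "N \<in> \<N>" for N
    using someI_ex[OF eig[OF that]] unfolding k_def by auto
  obtain r0 where r0: "r0 > 0" "abs_conv_at Z r0"
    using eigenvector_converges[OF pos[OF M(1)] _ k[OF M(1)]] True by blast
  obtain r1 where r1: "0 < r1" "\<And>t. 0 < t \<Longrightarrow> t \<le> r1 \<Longrightarrow> eval_fps Z t \<noteq> 0"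
    using eval_fps_nonzero_near_0[OF r0(2,1) Znz] by blast
  define r where "r = min r0 r1"
  have r: "0 < r" "abs_conv_at Z r" "\<And>t. 0 < t \<Longrightarrow> t \<le> r \<Longrightarrow> eval_fps Z t \<noteq> 0"
    using r0 r1 abs_conv_at_mono[OF r0(2), of r] by (auto simp: r_def)
  have in01: "0 < pgf N t" "pgf N t < 1" if "N \<in> \<N>" "0 < t" "t < 1" for N t
  proof -
    show "0 < pgf N t" using pgf_pos that by simp
    show "pgf N t < 1"
    proof (cases "pmf N 1 < 1")
      case True
      then show ?thesis using pgf_less[OF pos[OF that(1)]] that by fastforce
    next
      case False
      then show ?thesis using pmf_1_eq_1[OF pos[OF that(1)]] that by simp
    qed
  qed
  have pgf_le: "pgf N t \<le> t" if "N \<in> \<N>" "0 < t" "t < 1" for N t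
  proof (cases "pmf N 1 < 1")
    case True
    then show ?thesis using pgf_less[OF pos[OF that(1)]] that by fastforce
  qed (use pmf_1_eq_1[OF pos[OF that(1)]] that in simp)
  \<comment> \<open>The functional equation solved for \<open>Z(t)\<close>; the right-hand side
    makes sense as soon as \<open>pgf N t\<close> lies in the region of convergence.\<close>
  define V0 where "V0 N t = eval_fps Z (pgf N t) / (k N * pgf' N t)" for N t
  have V0_unique: "V0 F t = V0 G t"
    if F: "F \<in> \<N>" "pgf F t < r" and G: "G \<in> \<N>" "pgf G t < r" and t: "0 < t" "t < 1" for F G t
  proof -
    have conv: "abs_conv_at (Z oo gf N) t" "eval_fps (Z oo gf N) t = eval_fps Z (pgf N t)"
      if "N \<in> \<N>" "pgf N t < r" for N
    proof -
      have "abs_conv_at Z (eval_fps (gf N) t)"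
        using abs_conv_at_mono[OF r(2), of "pgf N t"] that in01[OF that(1) t] by (simp add: eval_gf)
      then show "abs_conv_at (Z oo gf N) t" "eval_fps (Z oo gf N) t = eval_fps Z (pgf N t)"
        using abs_conv_compose[of "gf N" t Z] pos[OF that(1)] t by (simp_all add: abs_conv_gf eval_gf)
    qed
    have d: "abs_conv_at (fps_deriv (gf N)) t" for N using pgf_has_derivative(2) t by simp
    \<comment> \<open>Both compositions are multiples of \<open>Z\<close>. Cross-multiplication
      eliminates \<open>Z\<close> itself, whose series may diverge at \<open>t\<close>, and leaves
      only factors that can be evaluated there.\<close>
    have "(Z oo gf F) * (fps_const (k G) * fps_deriv (gf G)) = (Z oo gf G) * (fps_const (k F) * fps_deriv (gf F))"
      by (simp add: k(2)[OF F(1)] k(2)[OF G(1)] mult_ac)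
    then have "eval_fps ((Z oo gf F) * (fps_const (k G) * fps_deriv (gf G))) t
        = eval_fps ((Z oo gf G) * (fps_const (k F) * fps_deriv (gf F))) t" by simp
    then have "eval_fps Z (pgf F t) * (k G * pgf' G t) = eval_fps Z (pgf G t) * (k F * pgf' F t)"
      using conv[OF F] conv[OF G] abs_conv_const_mult[OF d] by (simp add: abs_conv_mult pgf'_def)
    then show ?thesis
      using k(1)[OF F(1)] k(1)[OF G(1)] pgf'_pos[OF pos[OF F(1)] t] pgf'_pos[OF pos[OF G(1)] t]
      by (simp add: V0_def field_simps)
  qed
  define Fs where "Fs t = (SOME F. F \<in> \<N> \<and> pgf F t < r)" for t
  have Fs: "Fs t \<in> \<N>" "pgf (Fs t) t < r" if "0 < t" "t < 1" for t
    using someI_ex[of "\<lambda>F. F \<in> \<N> \<and> pgf F t < r"]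
      pgf_iterate_small[OF pos closed M(1) _ that r(1)] True unfolding Fs_def by blast+
  define V where "V t = V0 (Fs t) t" for t
  have V_eq: "V t = V0 F t" if "F \<in> \<N>" "pgf F t < r" "0 < t" "t < 1" for F t
    unfolding V_def by (rule V0_unique) (use that Fs in auto)
  have V_nz: "V t \<noteq> 0" if t: "0 < t" "t < 1" for t
  proof -
    have "eval_fps Z (pgf (Fs t) t) \<noteq> 0"
      using r(3) in01[OF Fs(1)[OF t] t] Fs(2)[OF t] by simp
    then show ?thesis
      using k(1)[OF Fs(1)[OF t]] pgf'_pos[OF pos[OF Fs(1)[OF t]] t] by (simp add: V_def V0_def)
  qed
  have V_cont: "isCont V t" if t: "0 < t" "t < 1" for t
  proof -
    define F where "F = Fs t"
    have F: "F \<in> \<N>" "pgf F t < r" using Fs[OF t] by (simp_all add: F_def)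
    have cF: "isCont (pgf F) t" using pgf_has_derivative(1)[of t F] t by (auto intro: DERIV_isCont)
    have rad: "ereal \<bar>pgf F t\<bar> < fps_conv_radius Z"
      by (rule less_le_trans[OF _ abs_conv_radius[OF r(2)]]) (use F in01[OF F(1) t] in simp)
    have "isCont (eval_fps Z) (pgf F t)"
      using abs_conv_deriv(2)[OF r(2), of "pgf F t"] F in01[OF F(1) t] by (auto intro: DERIV_isCont)
    then have "isCont (V0 F) t"
      unfolding V0_def[abs_def]
      by (intro continuous_intros isCont_o2[OF cF] isCont_pgf')
         (use rad t k(1)[OF F(1)] pgf'_pos[OF pos[OF F(1)] t] in auto)
    \<comment> \<open>The choice \<open>Fs\<close> varies with the point, but a fixed
      \<open>F\<close> serves a whole neighbourhood of \<open>t\<close>.\<close>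
    moreover have "\<forall>\<^sub>F x in nhds t. V x = V0 F x"
    proof -
      have "\<forall>\<^sub>F x in nhds t. pgf F x < r"
        using cF F(2) order_tendstoD(2)[of "pgf F" "pgf F t" "nhds t" r] by (simp add: continuous_within tendsto_at_iff_tendsto_nhds)
      moreover have "\<forall>\<^sub>F x in nhds t. x \<in> {0<..<1}"
        by (rule eventually_nhds_in_open) (use t in auto)
      ultimately show ?thesis by eventually_elim (use V_eq F in auto)
    qed
    ultimately show ?thesis by (simp add: isCont_cong)
  qed
  \<comment> \<open>The eigenvalue is unique because \<open>Z\<close> and the derivative of a member
    are nonzero; comparing both bracketings of the substitution gives multiplicativity.\<close>
  have k_comp: "k (v \<circ>\<^sub>g w) = k v * k w" if v: "v \<in> \<N>" and w: "w \<in> \<N>" for v w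
  proof -
    have vw: "v \<circ>\<^sub>g w \<in> \<N>" by (rule pgf_comp_in[OF closed v w])
    have g: "gf (v \<circ>\<^sub>g w) = gf v oo gf w" by (rule gf_pgf_comp[OF pos[OF w]])
    have w0: "gf w $ 0 = 0" and v0: "gf v $ 0 = 0" using pos v w by simp_all
    have "fps_const (k (v \<circ>\<^sub>g w)) * (fps_deriv (gf (v \<circ>\<^sub>g w)) * Z) = Z oo (gf v oo gf w)"
      using k(2)[OF vw] g by (simp add: mult.assoc)
    also have "\<dots> = (Z oo gf v) oo gf w" by (rule fps_compose_assoc[OF w0 v0])
    also have "\<dots> = fps_const (k v) * (fps_deriv (gf v) oo gf w) * (Z oo gf w)"
      by (simp add: k(2)[OF v] fps_compose_mult_distrib[OF w0])
    also have "\<dots> = fps_const (k v * k w) * (fps_deriv (gf (v \<circ>\<^sub>g w)) * Z)"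
      by (simp add: k(2)[OF w] g fps_compose_deriv[OF w0] mult_ac flip: fps_const_mult)
    finally have "fps_const (k (v \<circ>\<^sub>g w)) = fps_const (k v * k w)"
      using fps_deriv_gf_nonzero[OF pos[OF vw]] Znz by simp
    then show ?thesis by (metis fps_nth_fps_const)
  qed
  \<comment> \<open>\<open>V\<close> is computed at \<open>pgf w t\<close> through \<open>G\<close>
    and at \<open>t\<close> through the composite of \<open>G\<close> and \<open>w\<close>, which
    passes through the same point of the region of convergence.\<close>
  have V_comp: "V (pgf w t) = k w * pgf' w t * V t" if w: "w \<in> \<N>" and t: "0 < t" "t < 1" for w t
  proof -
    define F where "F = Fs t"
    have F: "F \<in> \<N>" "pgf F t < r" using Fs[OF t] by (simp_all add: F_def)
    have wt: "0 < pgf w t" "pgf w t < 1" using in01[OF w t] by auto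
    obtain G where G: "G \<in> \<N>" "pgf G (pgf w t) < r" using Fs[OF wt] by blast
    have Gw: "G \<circ>\<^sub>g w \<in> \<N>" by (rule pgf_comp_in[OF closed G(1) w])
    have ev: "pgf (G \<circ>\<^sub>g w) t = pgf G (pgf w t)" using pgf_pgf_comp t by simp
    have "pgf' (G \<circ>\<^sub>g w) t = pgf' G (pgf w t) * pgf' w t"
    proof (rule DERIV_unique)
      show "(pgf (G \<circ>\<^sub>g w) has_real_derivative pgf' (G \<circ>\<^sub>g w) t) (at t)"
        by (rule pgf_has_derivative) (use t in simp)
      have "((\<lambda>x. pgf G (pgf w x)) has_real_derivative pgf' G (pgf w t) * pgf' w t) (at t)"
        by (rule DERIV_chain2) (intro pgf_has_derivative, use t wt in simp)+
      then show "(pgf (G \<circ>\<^sub>g w) has_real_derivative pgf' G (pgf w t) * pgf' w t) (at t)"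
        by (rule has_field_derivative_transform_within_open[of _ _ _ "{0<..<1}"])
           (use t pgf_pgf_comp in auto)
    qed
    then have "V t = eval_fps Z (pgf G (pgf w t)) / (k G * k w * (pgf' G (pgf w t) * pgf' w t))"
      using V_eq[OF Gw _ t] G(2) ev by (simp add: V0_def k_comp[OF G(1) w])
    moreover have "V (pgf w t) = eval_fps Z (pgf G (pgf w t)) / (k G * pgf' G (pgf w t))"
      using V_eq[OF G wt] by (simp add: V0_def)
    ultimately show ?thesis
      using k(1)[OF w] pgf'_pos[OF pos[OF w] t] by simp
  qed
  \<comment> \<open>By \<open>V_comp\<close>, the derivative of \<open>s\<close> along
    \<open>pgf w\<close> is that of \<open>s\<close> divided by \<open>\<bar>k w\<bar>\<close>,
    which makes \<open>pgf w\<close> affine in the coordinate \<open>s\<close>.\<close>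
  have "\<exists>s. \<forall>x::real. ereal 0 < x \<longrightarrow> x < ereal 1 \<longrightarrow> (s has_vector_derivative (1 / \<bar>V x\<bar>)) (at x)"
    by (rule einterval_antiderivative) (auto intro!: continuous_intros V_cont simp: V_nz)
  then obtain s where s: "\<And>x. 0 < x \<Longrightarrow> x < 1 \<Longrightarrow> (s has_real_derivative 1 / \<bar>V x\<bar>) (at x)"
    by (auto simp: has_real_derivative_iff_has_vector_derivative)
  have s_mono: "s x < s y" if "0 < x" "x < y" "y < 1" for x y
  proof (rule DERIV_pos_imp_increasing[OF that(2)])
    show "\<exists>z. (s has_real_derivative z) (at u) \<and> 0 < z" if "x \<le> u" "u \<le> y" for u
      using s[of u] V_nz[of u] that \<open>0 < x\<close> \<open>y < 1\<close> by (intro exI[of _ "1 / \<bar>V u\<bar>"]) auto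
  qed
  have affine: "\<exists>c. \<forall>t. 0 < t \<longrightarrow> t < 1 \<longrightarrow> s (pgf w t) = (1 / \<bar>k w\<bar>) * s t + c" if w: "w \<in> \<N>" for w
  proof -
    define D where "D t = s (pgf w t) - (1 / \<bar>k w\<bar>) * s t" for t
    have D: "(D has_real_derivative 0) (at t)" if t: "0 < t" "t < 1" for t
    proof -
      have wt: "0 < pgf w t" "pgf w t < 1" using in01[OF w t] by auto
      have "((\<lambda>t. s (pgf w t)) has_real_derivative 1 / \<bar>V (pgf w t)\<bar> * pgf' w t) (at t)"
        by (rule DERIV_chain2[OF s[OF wt] pgf_has_derivative(1)]) (use t in simp)
      moreover have "((\<lambda>t. (1 / \<bar>k w\<bar>) * s t) has_real_derivative (1 / \<bar>k w\<bar>) * (1 / \<bar>V t\<bar>)) (at t)"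
        by (rule DERIV_cmult[OF s[OF t]])
      ultimately have "(D has_real_derivative 1 / \<bar>V (pgf w t)\<bar> * pgf' w t - (1 / \<bar>k w\<bar>) * (1 / \<bar>V t\<bar>)) (at t)"
        unfolding D_def[abs_def] by (rule DERIV_diff)
      moreover have "1 / \<bar>V (pgf w t)\<bar> * pgf' w t - (1 / \<bar>k w\<bar>) * (1 / \<bar>V t\<bar>) = 0"
        using pgf'_pos[OF pos[OF w] t] by (simp add: V_comp[OF w t] abs_mult)
      ultimately show ?thesis by simp
    qed
    have "\<exists>c. \<forall>x\<in>{0<..<1}. D x = c"
    proof (rule has_field_derivative_zero_constant)
      show "(D has_field_derivative 0) (at x within {0<..<1})" if "x \<in> {0<..<1}" for x
        using D[of x] that by (auto intro: has_field_derivative_at_within)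
    qed simp
    then obtain c where "\<And>x. 0 < x \<Longrightarrow> x < 1 \<Longrightarrow> D x = c" by auto
    then show ?thesis by (intro exI[of _ c]) (auto simp: D_def algebra_simps)
  qed
  obtain c1 where c1: "\<And>t. 0 < t \<Longrightarrow> t < 1 \<Longrightarrow> s (pgf M1 t) = (1 / \<bar>k M1\<bar>) * s t + c1"
    using affine[OF M(1)] by blast
  obtain c2 where c2: "\<And>t. 0 < t \<Longrightarrow> t < 1 \<Longrightarrow> s (pgf M2 t) = (1 / \<bar>k M2\<bar>) * s t + c2"
    using affine[OF M(2)] by blast
  have lt: "0 < pgf N t \<and> pgf N t < t" if "N \<in> {M1, M2}" "0 < t" "t < 1" for N t
    using that pgf_less[OF pos] pgf_pos[of t N] True M by auto
  have surj: "\<exists>u. 0 < u \<and> u < 1 \<and> pgf N u = t" if "N \<in> {M1, M2}" "0 < t" "t < 1" for N t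
    using that pgf_surj[OF pos] M by blast
  have inner: "pgf M1 (pgf M2 t) = pgf M2 (pgf M1 t)" if t: "0 < t" "t < 1" for t
  proof (rule affine_conjugates_commute[OF s_mono lt[OF insertI1] surj[OF insertI1]
        lt[OF insertI2[OF singletonI]] surj[OF insertI2[OF singletonI]] c1 c2 _ _ t])
    show "1 / \<bar>k M1\<bar> > 0" "1 / \<bar>k M2\<bar> > 0" using k(1)[OF M(1)] k(1)[OF M(2)] by simp_all
  qed
  show ?thesis
    unfolding pgf_commute_def
  proof
    fix t :: real assume "t \<in> {0..1}"
    then consider "t = 0" | "t = 1" | "0 < t" "t < 1" by force
    then show "pgf M1 (pgf M2 t) = pgf M2 (pgf M1 t)"
      by cases (use pos M inner in \<open>simp_all add: pgf_0 pgf_1\<close>)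
  qed
qed

section \<open>Commuting series\<close>

text \<open>Lower bounds for the orders take the place of \<open>subdegree\<close>, so that the
  coefficient at the bound may vanish.\<close>

lemma fps_mult_lowest:
  fixes A B :: "'a::idom fps"
  assumes A: "\<And>k. k < p \<Longrightarrow> A $ k = 0" and B: "\<And>k. k < q \<Longrightarrow> B $ k = 0"
  shows "k < p + q \<Longrightarrow> (A * B) $ k = 0" and "(A * B) $ (p + q) = A $ p * B $ q"
proof -
  show "(A * B) $ k = 0" if "k < p + q"
    unfolding fps_mult_nth
  proof (rule sum.neutral, intro ballI)
    fix i assume "i \<in> {0..k}"
    then have "i < p \<or> k - i < q" using that by auto
    then show "A $ i * B $ (k - i) = 0" using A B by auto
  qed
  have "(A * B) $ (p + q) = (\<Sum>i\<in>{p}. A $ i * B $ (p + q - i))"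
    unfolding fps_mult_nth
  proof (rule sum.mono_neutral_right)
    show "\<forall>i\<in>{0..p + q} - {p}. A $ i * B $ (p + q - i) = 0"
    proof
      fix i assume "i \<in> {0..p + q} - {p}"
      then have "i < p \<or> p + q - i < q" by auto
      then show "A $ i * B $ (p + q - i) = 0" using A B by auto
    qed
  qed auto
  then show "(A * B) $ (p + q) = A $ p * B $ q" by simp
qed

lemma fps_power_lowest:
  fixes v :: "'a::idom fps"
  assumes v: "\<And>k. k < d \<Longrightarrow> v $ k = 0"
  shows "(\<forall>k<d * i. (v ^ i) $ k = 0) \<and> (v ^ i) $ (d * i) = (v $ d) ^ i"
proof (induction i)
  case (Suc i)
  then have "\<And>k. k < d * i \<Longrightarrow> (v ^ i) $ k = 0" "(v ^ i) $ (d * i) = (v $ d) ^ i" by blast+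
  with fps_mult_lowest[OF v this(1)] show ?case by simp
qed simp

lemma fps_compose_lowest:
  fixes v f :: "'a::idom fps"
  assumes v: "\<And>k. k < d \<Longrightarrow> v $ k = 0" and f: "\<And>k. k < e \<Longrightarrow> f $ k = 0" and e: "e \<ge> 1"
  shows "k < d * e \<Longrightarrow> (v oo f) $ k = 0" and "(v oo f) $ (d * e) = v $ d * (f $ e) ^ d"
proof -
  have z: "v $ i * (f ^ i) $ k = 0" if "k \<le> d * e" "i \<noteq> d \<or> k < d * e" for i k
  proof (cases "i < d")
    case False
    then have "d * e \<le> e * i" by (simp add: mult.commute)
    moreover have "d * e < e * i" if "i \<noteq> d" using False that e by (simp add: mult.commute)
    ultimately have "k < e * i" using that by (metis le_neq_implies_less less_le_trans order.strict_trans1)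
    then show ?thesis using fps_power_lowest[of e f i] f by simp
  qed (use v in simp)
  show "(v oo f) $ k = 0" if "k < d * e"
    unfolding fps_compose_nth by (rule sum.neutral) (use z that in simp)
  have "(v oo f) $ (d * e) = (\<Sum>i\<in>{d}. v $ i * (f ^ i) $ (d * e))"
    unfolding fps_compose_nth by (rule sum.mono_neutral_right) (use z e in auto)
  then show "(v oo f) $ (d * e) = v $ d * (f $ e) ^ d"
    using fps_power_lowest[of e f d] f by (simp add: mult.commute)
qed

text \<open>The difference of powers is \<open>v - w\<close> times the sum of all
  \<open>v ^ p * w ^ (j - p)\<close>. As the leading coefficients agree, each of the
  \<open>j + 1\<close> summands starts with \<open>(w $ d) ^ j\<close>.\<close>

lemma power_diff_lowest:
  fixes v w :: "'a::idom fps"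
  assumes v: "\<And>k. k < d \<Longrightarrow> v $ k = 0" and w: "\<And>k. k < d \<Longrightarrow> w $ k = 0" and vw: "v $ d = w $ d"
    and u: "\<And>k. k < n \<Longrightarrow> (v - w) $ k = 0"
  shows "k < n + d * j \<Longrightarrow> (v ^ Suc j - w ^ Suc j) $ k = 0"
    and "(v ^ Suc j - w ^ Suc j) $ (n + d * j) = (v - w) $ n * (of_nat (Suc j) * (w $ d) ^ j)"
proof -
  define G where "G = (\<Sum>p<Suc j. v ^ p * w ^ (j - p))"
  have G: "v ^ Suc j - w ^ Suc j = (v - w) * G"
    unfolding G_def by (rule diff_power_eq_sum)
  have pw: "(\<forall>k<d * j. (v ^ p * w ^ (j - p)) $ k = 0) \<and> (v ^ p * w ^ (j - p)) $ (d * j) = (w $ d) ^ j"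
    if "p < Suc j" for p
  proof -
    have j: "d * j = d * p + d * (j - p)" using that by (metis add_mult_distrib2 le_add_diff_inverse less_Suc_eq_le)
    have "\<And>k. k < d * p \<Longrightarrow> (v ^ p) $ k = 0" "\<And>k. k < d * (j - p) \<Longrightarrow> (w ^ (j - p)) $ k = 0"
      "(v ^ p) $ (d * p) = (w $ d) ^ p" "(w ^ (j - p)) $ (d * (j - p)) = (w $ d) ^ (j - p)"
      using fps_power_lowest[of d v p] fps_power_lowest[of d w "j - p"] v w vw by auto
    note L = this
    have "(v ^ p * w ^ (j - p)) $ (d * j) = (w $ d) ^ p * (w $ d) ^ (j - p)"
    proof -
      have "(v ^ p * w ^ (j - p)) $ (d * p + d * (j - p)) = (v ^ p) $ (d * p) * (w ^ (j - p)) $ (d * (j - p))"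
        by (rule fps_mult_lowest(2)) (use L in auto)
      then show ?thesis by (simp only: j L(3,4))
    qed
    then have "(v ^ p * w ^ (j - p)) $ (d * j) = (w $ d) ^ j"
      using that by (simp add: power_add[symmetric])
    then show ?thesis unfolding j using fps_mult_lowest(1)[OF L(1,2)] j by auto
  qed
  have G0: "G $ k = 0" if "k < d * j" for k unfolding G_def fps_sum_nth by (rule sum.neutral) (use pw that in auto)
  have "G $ (d * j) = (\<Sum>p<Suc j. (w $ d) ^ j)" unfolding G_def fps_sum_nth by (rule sum.cong) (use pw in auto)
  then have G1: "G $ (d * j) = of_nat (Suc j) * (w $ d) ^ j" by simp
  show "(v ^ Suc j - w ^ Suc j) $ k = 0" if "k < n + d * j"
    unfolding G by (rule fps_mult_lowest(1)[OF u G0 that])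
  show "(v ^ Suc j - w ^ Suc j) $ (n + d * j) = (v - w) $ n * (of_nat (Suc j) * (w $ d) ^ j)"
  proof -
    have "((v - w) * G) $ (n + d * j) = (v - w) $ n * G $ (d * j)"
      by (rule fps_mult_lowest(2)) (fact u, fact G0)
    then show ?thesis by (simp only: G G1)
  qed
qed

text \<open>Comparing leading coefficients gives
  \<open>(v $ d) ^ (e - 1) = (f $ e) ^ (d - 1)\<close>, and positivity selects the root. So
  \<open>v\<close> and \<open>w\<close> agree up to degree \<open>d\<close>, and a first later
  discrepancy is carried to different degrees by the two sides of the commutation relation.\<close>

lemma commuting_series_unique:
  fixes f v w :: "real fps"
  assumes f: "\<And>k. k < e \<Longrightarrow> f $ k = 0" "f $ e > 0" "e \<ge> 2"
    and v: "\<And>k. k < d \<Longrightarrow> v $ k = 0" "v $ d > 0" and w: "\<And>k. k < d \<Longrightarrow> w $ k = 0" "w $ d > 0"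
    and d: "d \<ge> 1"
    and vf: "v oo f = f oo v" and wf: "w oo f = f oo w"
  shows "v = w"
proof (rule ccontr)
  assume ne: "v \<noteq> w"
  have lead: "(f $ e) ^ (d - 1) = (x $ d) ^ (e - 1)"
    if x: "\<And>k. k < d \<Longrightarrow> x $ k = 0" "x $ d > 0" "x oo f = f oo x" for x
  proof -
    have "x $ d * (f $ e) ^ d = (x oo f) $ (d * e)"
      by (rule fps_compose_lowest(2)[OF x(1) f(1), symmetric]) (use f(3) in auto)
    also have "\<dots> = (f oo x) $ (e * d)" by (simp only: x(3) mult.commute[of d e])
    also have "\<dots> = f $ e * (x $ d) ^ e" by (rule fps_compose_lowest(2)[OF f(1) x(1) d])
    finally have "x $ d * (f $ e) ^ d = f $ e * (x $ d) ^ e" .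
    moreover have "(f $ e) ^ d = f $ e * (f $ e) ^ (d - 1)" "(x $ d) ^ e = x $ d * (x $ d) ^ (e - 1)"
      using d f(3) by (simp_all add: power_eq_if)
    ultimately have "(x $ d * f $ e) * (f $ e) ^ (d - 1) = (x $ d * f $ e) * (x $ d) ^ (e - 1)"
      by (simp only: mult_ac)
    then show ?thesis using x(2) f(2) by simp
  qed
  have "(v $ d) ^ (e - 1) = (w $ d) ^ (e - 1)"
    using lead[OF v vf] lead[OF w wf] by simp
  then have vw: "v $ d = w $ d"
    using v(2) w(2) f(3) power_eq_iff_eq_base[of "e - 1" "v $ d" "w $ d"] by simp
  define n where "n = subdegree (v - w)"
  have un: "(v - w) $ n \<noteq> 0" using ne by (simp add: n_def del: fps_sub_nth)
  have u0: "(v - w) $ k = 0" if "k < n" for k using that unfolding n_def by (rule nth_less_subdegree_zero)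
  have "d < n"
  proof (rule ccontr)
    assume "\<not> d < n"
    then consider "n < d" | "n = d" by linarith
    then show False using un v(1) w(1) vw by cases auto
  qed
  \<comment> \<open>If \<open>v - w\<close> starts in degree \<open>n > d\<close>, then
    \<open>f oo v - f oo w\<close> starts exactly in degree \<open>m\<close>, through the term
    \<open>f $ e\<close> alone. But \<open>(v - w) oo f\<close> starts only in degree
    \<open>n * e > m\<close>.\<close>
  define m where "m = n + d * (e - 1)"
  have "((v - w) oo f) $ m = 0"
  proof (rule fps_compose_lowest(1)[OF u0 f(1)])
    have "d * (e - 1) < n * (e - 1)" using \<open>d < n\<close> f(3) by simp
    then have "m < n + n * (e - 1)" by (simp add: m_def)
    also have "\<dots> = n * e" using f(3) by (cases e) auto
    finally show "m < n * e" .
  qed (use f(3) in auto)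
  then have e1: "(f oo v) $ m - (f oo w) $ m = 0" using vf wf by (simp add: fps_compose_sub_distrib)
  have e2: "(f oo v) $ m - (f oo w) $ m = (\<Sum>i=0..m. f $ i * (v ^ i - w ^ i) $ m)"
    by (simp add: fps_compose_nth sum_subtractf right_diff_distrib)
  have e3: "(\<Sum>i=0..m. f $ i * (v ^ i - w ^ i) $ m) = (\<Sum>i\<in>{e}. f $ i * (v ^ i - w ^ i) $ m)"
  proof (rule sum.mono_neutral_right)
    show "\<forall>i\<in>{0..m} - {e}. f $ i * (v ^ i - w ^ i) $ m = 0"
    proof
      fix i assume "i \<in> {0..m} - {e}"
      then consider "i < e" | j where "i = Suc j" "e \<le> j" by (cases i) force+
      then show "f $ i * (v ^ i - w ^ i) $ m = 0"
      proof cases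
        case 2
        then have "d * (e - 1) < d * j" using d f(3) by simp
        then have "m < n + d * j" by (simp add: m_def)
        from power_diff_lowest(1)[OF v(1) w(1) vw u0 this] show ?thesis using 2 by simp
      qed (use f(1) in simp)
    qed
    have "e - 1 \<le> d * (e - 1)" using d by simp
    then have "e \<le> m" unfolding m_def using \<open>d < n\<close> by linarith
    then show "{e} \<subseteq> {0..m}" by simp
  qed simp
  have e4: "(v ^ e - w ^ e) $ m = (v - w) $ n * (of_nat (Suc (e - 1)) * (w $ d) ^ (e - 1))"
  proof -
    have "(v ^ Suc (e - 1) - w ^ Suc (e - 1)) $ m = (v - w) $ n * (of_nat (Suc (e - 1)) * (w $ d) ^ (e - 1))"
      unfolding m_def by (rule power_diff_lowest(2)) (fact v(1), fact w(1), fact vw, fact u0)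
    then show ?thesis using f(3) by simp
  qed
  have "f $ e * ((v - w) $ n * (of_nat (Suc (e - 1)) * (w $ d) ^ (e - 1))) = 0"
    using e1 unfolding e2 e3 by (simp add: e4 del: fps_sub_nth of_nat_Suc)
  then show False using un f(2) w(2) by (simp del: fps_sub_nth)
qed

lemma gf_commute:
  assumes "pmf M 0 = 0" "pmf N 0 = 0" "pgf_commute M N"
  shows "gf M oo gf N = gf N oo gf M"
proof -
  have "M \<circ>\<^sub>g N = N \<circ>\<^sub>g M"
    using assms(3) by (intro pgf_inject) (simp add: pgf_pgf_comp pgf_commute_def)
  then show ?thesis using gf_pgf_comp[OF assms(1), of N] gf_pgf_comp[OF assms(2), of M] by simp
qed

lemma pmf_1_pgf_comp:
  assumes "pmf N 0 = 0" "pmf M 0 = 0"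
  shows "pmf (M \<circ>\<^sub>g N) 1 = pmf M 1 * pmf N 1"
proof -
  have "pmf (M \<circ>\<^sub>g N) 1 = gf (M \<circ>\<^sub>g N) $ (1 * 1)" by simp
  also have "\<dots> = gf M $ 1 * (gf N $ 1) ^ 1"
    unfolding gf_pgf_comp[OF assms(1)]
    by (rule fps_compose_lowest(2)) (use assms in auto)
  finally show ?thesis by simp
qed

lemma gf_order:
  assumes "pmf N 0 = 0"
  shows "subdegree (gf N) \<ge> 1" "\<And>k. k < subdegree (gf N) \<Longrightarrow> gf N $ k = 0" "gf N $ subdegree (gf N) > 0"
proof -
  have nz: "gf N \<noteq> 0" by (rule fps_deriv_gf_nonzero[OF assms])
  then show "subdegree (gf N) \<ge> 1"
    using assms by (simp add: subdegree_eq_0_iff Suc_le_eq zero_less_iff_neq_zero)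
  show "gf N $ k = 0" if "k < subdegree (gf N)" for k using that by (rule nth_less_subdegree_zero)
  have "gf N $ subdegree (gf N) \<noteq> 0" using nz by (simp del: gf_nth)
  then show "gf N $ subdegree (gf N) > 0" by (simp add: order_less_le)
qed

text \<open>For a series of order \<open>d\<close> commuting with \<open>N0\<close>, the leading
  coefficients give \<open>pmf N0 1 ^ d = pmf N0 1\<close>, which forces
  \<open>d = 1\<close>.\<close>

lemma commutant_pmf_1_pos:
  assumes N0: "pmf N0 0 = 0" "0 < pmf N0 1" "pmf N0 1 < 1" and N: "N \<in> commutant N0"
  shows "0 < pmf N 1"
proof -
  have N': "pmf N 0 = 0" "pgf_commute N N0" using N by (simp_all add: commutant_def)
  define d where "d = subdegree (gf N)"
  note o = gf_order[OF N'(1), folded d_def]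
  have f: "\<And>k. k < 1 \<Longrightarrow> gf N0 $ k = 0" using N0 by simp
  have "gf N $ d * (gf N0 $ 1) ^ d = (gf N oo gf N0) $ (d * 1)"
    by (rule fps_compose_lowest(2)[OF o(2) f order_refl, symmetric])
  also have "\<dots> = (gf N0 oo gf N) $ (1 * d)"
    by (simp only: gf_commute[OF N'(1) N0(1) N'(2)] mult.commute[of d 1])
  also have "\<dots> = gf N0 $ 1 * (gf N $ d) ^ 1" by (rule fps_compose_lowest(2)[OF f o(2) o(1)])
  finally have "gf N $ d * (gf N0 $ 1) ^ d = gf N0 $ 1 * (gf N $ d) ^ 1" .
  then have "pmf N0 1 ^ d = pmf N0 1" using o(3) by simp
  then have "d = 1" using N0 power_inject_exp'[of "pmf N0 1" d 1] o(1)
    by (metis One_nat_def le_neq_implies_less less_irrefl power_one_right power_strict_decreasing)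
  then show ?thesis using o(3) by simp
qed

text \<open>
  The coefficient of degree \<open>n\<close> of the commutation relation is linear in \<open>p\<^sub>n(N)\<close>, with leading factor
  \<open>p\<^sub>1(N0)\<^sup>n - p\<^sub>1(N0)\<close>; the remaining terms involve earlier coefficients only.
\<close>

lemma commutant_coefficients:
  assumes N0: "pmf N0 0 = 0" "0 < pmf N0 1" "pmf N0 1 < 1"
  shows "\<exists>g :: real \<Rightarrow> real. continuous_on UNIV g \<and> (\<forall>N\<in>commutant N0. pmf N n = g (pmf N 1))"
proof (induction n rule: less_induct)
  case (less n)
  consider "n = 0" | "n = 1" | "n \<ge> 2" by linarith
  then show ?case
  proof cases
    case 1
    then show ?thesis by (intro exI[of _ "\<lambda>_. 0"]) (auto simp: commutant_def)
  next
    case 2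
    then show ?thesis by (intro exI[of _ "\<lambda>x. x"]) auto
  next
    case 3
    define a where "a = pmf N0 1"
    have an: "a ^ n - a \<noteq> 0"
      using N0 3 power_strict_decreasing[of 1 n a] by (simp add: a_def)
    obtain g where g: "\<And>i. i < n \<Longrightarrow> continuous_on UNIV (g i) \<and> (\<forall>N\<in>commutant N0. pmf N i = g i (pmf N 1))"
      using less.IH by metis
    define T where "T x = Abs_fps (\<lambda>i. if i < n then g i x else 0)" for x
    have Tc: "continuous_on UNIV (\<lambda>x. T x $ i)" for i
      using g[of i] by (cases "i < n") (auto simp: T_def)
    define G where "G x = ((\<Sum>j\<in>{2..n}. pmf N0 j * (T x ^ j) $ n)
        - (\<Sum>j<n. T x $ j * (gf N0 ^ j) $ n)) / (a ^ n - a)" for x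
    have "continuous_on UNIV G"
      unfolding G_def[abs_def]
      by (intro continuous_on_divide continuous_on_diff continuous_on_sum continuous_on_mult
          continuous_on_const continuous_on_fps_power Tc) (use an in auto)
    moreover have "pmf N n = G (pmf N 1)" if N: "N \<in> commutant N0" for N
    proof -
      have N': "pmf N 0 = 0" "pgf_commute N N0" using N by (simp_all add: commutant_def)
      have T: "T (pmf N 1) $ i = pmf N i" if "i < n" for i using g that N by (simp add: T_def)
      \<comment> \<open>In a product of at least two series vanishing at 0, the coefficient of
        degree \<open>n\<close> involves only coefficients below \<open>n\<close>, so
        \<open>T\<close> may replace \<open>gf N\<close>.\<close>
      have Tj: "(gf N ^ j) $ n = (T (pmf N 1) ^ j) $ n" if "j \<ge> 2" for j
      proof -
        have *: "\<And>k. k < 1 \<Longrightarrow> gf N $ k = 0" "\<And>k. k < 1 \<Longrightarrow> T (pmf N 1) $ k = 0" "gf N $ 1 = T (pmf N 1) $ 1"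
          "\<And>k. k < n \<Longrightarrow> (gf N - T (pmf N 1)) $ k = 0"
          using T N' 3 by auto
        have "n < n + 1 * (j - 1)" using that by simp
        from power_diff_lowest(1)[OF * this] that show ?thesis by simp
      qed
      have l: "(gf N oo gf N0) $ n = (\<Sum>j<n. T (pmf N 1) $ j * (gf N0 ^ j) $ n) + pmf N n * a ^ n"
      proof -
        have "(gf N0 ^ n) $ n = a ^ n" using fps_power_lowest[of 1 "gf N0" n] N0 by (simp add: a_def)
        then have "(gf N oo gf N0) $ n = (\<Sum>j<n. pmf N j * (gf N0 ^ j) $ n) + pmf N n * a ^ n"
          by (simp add: fps_compose_nth atLeast0AtMost lessThan_Suc_atMost[symmetric])
        then show ?thesis using T by simp
      qed
      have r: "(gf N0 oo gf N) $ n = a * pmf N n + (\<Sum>j\<in>{2..n}. pmf N0 j * (T (pmf N 1) ^ j) $ n)"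
      proof -
        have "{0..n} = {0, 1} \<union> {2..n}" using 3 by auto
        then have "(gf N0 oo gf N) $ n = a * pmf N n + (\<Sum>j\<in>{2..n}. pmf N0 j * (gf N ^ j) $ n)"
          using N0(1) by (simp add: fps_compose_nth a_def)
        then show ?thesis using Tj by simp
      qed
      have "(\<Sum>j<n. T (pmf N 1) $ j * (gf N0 ^ j) $ n) + pmf N n * a ^ n
          = a * pmf N n + (\<Sum>j\<in>{2..n}. pmf N0 j * (T (pmf N 1) ^ j) $ n)"
        using l r gf_commute[OF N'(1) N0(1) N'(2)] by simp
      then have "pmf N n * (a ^ n - a) = (\<Sum>j\<in>{2..n}. pmf N0 j * (T (pmf N 1) ^ j) $ n)
          - (\<Sum>j<n. T (pmf N 1) $ j * (gf N0 ^ j) $ n)"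
        by (simp add: algebra_simps)
      then show ?thesis unfolding G_def using an eq_divide_imp by blast
    qed
    ultimately show ?thesis by blast
  qed
qed

lemma commuting_family_contains_contraction:
  assumes pos: "\<And>N. N \<in> \<N> \<Longrightarrow> pmf N 0 = 0"
    and comm: "\<And>M N. M \<in> \<N> \<Longrightarrow> N \<in> \<N> \<Longrightarrow> pgf_commute M N"
    and unc: "uncountable \<N>"
  shows "\<exists>N0\<in>\<N>. 0 < pmf N0 1 \<and> pmf N0 1 < 1"
proof (rule ccontr)
  assume neg: "\<not> ?thesis"
  define A where "A = {N \<in> \<N>. pmf N 1 = 0}"
  have p1: "pmf N 1 = 1" if "N \<in> \<N> - A" for N
    using that neg pmf_nonneg[of N 1] pmf_le_1[of N 1] by (force simp: A_def order_less_le)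
  have "M = N" if "M \<in> \<N> - A" "N \<in> \<N> - A" for M N
    using pmf_1_eq_1[of M] pmf_1_eq_1[of N] p1 that pos by (intro pgf_inject) auto
  then have cB: "countable (\<N> - A)"
    by (metis countable_empty countable_insert insert_Diff is_singletonI' is_singleton_def)
  have "countable A"
  proof (cases "A = {}")
    case False
    then obtain F where F: "F \<in> A" by blast
    have F0: "pmf F 0 = 0" "pmf F 1 = 0" using F pos by (auto simp: A_def)
    have e: "subdegree (gf F) \<ge> 2"
    proof (rule ccontr)
      assume "\<not> ?thesis"
      then have "subdegree (gf F) = 1" using gf_order(1)[OF F0(1)] by simp
      then show False using gf_order(3)[OF F0(1)] F0 by simp
    qed
    have "inj_on (\<lambda>N. subdegree (gf N)) A"
    proof (rule inj_onI)
      fix M N assume MN: "M \<in> A" "N \<in> A" "subdegree (gf M) = subdegree (gf N)"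
      have M0: "pmf M 0 = 0" and N0: "pmf N 0 = 0" using MN pos by (auto simp: A_def)
      have cM: "gf M oo gf F = gf F oo gf M" and cN: "gf N oo gf F = gf F oo gf N"
        using MN F by (auto intro!: gf_commute M0 N0 F0 comm simp: A_def)
      have "gf M = gf N"
        by (rule commuting_series_unique[OF gf_order(2,3)[OF F0(1)] e
              gf_order(2,3)[OF M0] gf_order(2,3)[OF N0, folded MN(3)] gf_order(1)[OF M0] cM cN])
      then show "M = N" by (simp add: gf_inject)
    qed
    then show ?thesis by (rule countable_image_inj_on[rotated]) simp
  qed simp
  then have "countable (A \<union> (\<N> - A))" using cB by (rule countable_Un)
  moreover have "\<N> \<subseteq> A \<union> (\<N> - A)" by blast
  ultimately show False using unc countable_subset by blast
qed

section \<open>Parametrizations and the interior\<close>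

lemma C1_on_imp_differentiable_on: "C1_on S f \<Longrightarrow> f differentiable_on S"
  unfolding C1_on_def differentiable_on_def differentiable_def by blast

text \<open>For the coefficient of index 0, which the smoothness hypothesis leaves out and which
  vanishes on all members.\<close>

lemma differentiable_on_zero:
  assumes "\<And>x. x \<in> V \<Longrightarrow> f x = (0 :: 'b::real_normed_vector)"
  shows "f differentiable_on V"
  unfolding differentiable_on_def differentiable_def
proof
  fix x assume "x \<in> V"
  then show "\<exists>D. (f has_derivative D) (at x within V)"
    by (intro exI[of _ "\<lambda>_. 0"], rule has_derivative_transform[where f = "\<lambda>_. 0"])
       (use assms in auto)
qed

lemma pmf_image_inj: "pmf N \<in> pmf ` A \<Longrightarrow> N \<in> A"
proof (elim imageE)
  fix M assume "pmf N = pmf M" "M \<in> A"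
  then show "N \<in> A" using pmf_eqI[of N M] by simp
qed

text \<open>
  Local parametrizations in the form common to both kinds of structure; for a global parametrization,
  \<open>U\<close> is everything.
\<close>

lemma local_parametrization:
  fixes \<S> :: "'m::finite model_structure"
  assumes positive: "\<And>N. N \<in> \<N> \<Longrightarrow> pmf N 0 = 0"
    and finite_dim: "finite_dimensional \<S> \<N>"
    and C1: "\<And>i. i \<ge> 1 \<Longrightarrow> C1_in_parameters \<S> (\<lambda>N. pmf N i)"
    and N: "N \<in> \<N>"
  shows "\<exists>V (\<phi> :: real ^ 'm \<Rightarrow> nat pmf) U. open U \<and> pmf N \<in> U \<and> {Q \<in> \<N>. pmf Q \<in> U} \<subseteq> \<phi> ` V \<and>
    (\<forall>n. (\<lambda>x. pmf (\<phi> x) n) differentiable_on V)"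
proof -
  have diff: "(\<lambda>x. pmf (\<phi> x) n) differentiable_on V"
    if "\<phi> ` V \<subseteq> \<N>" "\<And>i. i \<ge> 1 \<Longrightarrow> C1_on V (\<lambda>x. pmf (\<phi> x) i)" for \<phi> :: "real ^ 'm \<Rightarrow> nat pmf" and V n
  proof (cases "n = 0")
    case True
    then show ?thesis by (intro differentiable_on_zero) (use that positive in auto)
  next
    case False
    then show ?thesis using C1_on_imp_differentiable_on[OF that(2), of n] by simp
  qed
  show ?thesis
  proof (cases \<S>)
    case (Global D \<gamma>)
    then have g: "\<gamma> ` D = \<N>" using finite_dim by (simp add: global_parametrization_def)
    show ?thesis
    proof (intro exI[of _ D] exI[of _ \<gamma>] exI[of _ UNIV] conjI allI diff)
      show "C1_on D (\<lambda>x. pmf (\<gamma> x) i)" if "i \<ge> 1" for i using C1[OF that] Global by simp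
    qed (use g in auto)
  next
    case (Atlas A)
    then have em: "embedded_manifold A \<N>" using finite_dim by simp
    then have "N \<in> (\<Union>(V, \<phi>)\<in>A. \<phi> ` V)" using N unfolding embedded_manifold_def by blast
    then obtain V \<phi> where V: "(V, \<phi>) \<in> A" "N \<in> \<phi> ` V" by blast
    have sub: "\<phi> ` V \<subseteq> \<N>" using em V unfolding embedded_manifold_def by blast
    have "openin (top_of_set (pmf ` \<N>)) (pmf ` \<phi> ` V)"
      using em V(1) unfolding embedded_manifold_def by blast
    then obtain U where U: "open U" "pmf ` \<phi> ` V = pmf ` \<N> \<inter> U" by (auto simp: openin_open)
    show ?thesis
    proof (intro exI[of _ V] exI[of _ \<phi>] exI[of _ U] conjI allI diff)
      show "C1_on V (\<lambda>x. pmf (\<phi> x) i)" if "i \<ge> 1" for i using C1[OF that] Atlas V(1) by auto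
      show "pmf N \<in> U" using U(2) V(2) by blast
      show "{Q \<in> \<N>. pmf Q \<in> U} \<subseteq> \<phi> ` V"
        using U(2) by (auto intro!: pmf_image_inj)
    qed (use U sub in auto)
  qed
qed

text \<open>The counterpart of \<open>local_parametrization\<close>: there a neighbourhood in the
  model has to be covered, here an open set of parameters has to map injectively into the model, for
  drawing curves and for invariance of domain.\<close>

lemma interior_parametrization:
  fixes \<S> :: "'m::finite model_structure"
  assumes positive: "\<And>N. N \<in> \<N> \<Longrightarrow> pmf N 0 = 0"
    and finite_dim: "finite_dimensional \<S> \<N>"
    and C1: "\<And>i. i \<ge> 1 \<Longrightarrow> C1_in_parameters \<S> (\<lambda>N. pmf N i)"
    and N: "N \<in> model_interior \<S>"
  shows "\<exists>W (\<phi> :: real ^ 'm \<Rightarrow> nat pmf). open W \<and> N \<in> \<phi> ` W \<and> \<phi> ` W \<subseteq> \<N> \<and> inj_on \<phi> W \<and>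
    (\<forall>n. (\<lambda>x. pmf (\<phi> x) n) differentiable_on W)"
proof -
  have diff: "(\<lambda>x. pmf (\<phi> x) n) differentiable_on interior V"
    if "\<phi> ` V \<subseteq> \<N>" "\<And>i. i \<ge> 1 \<Longrightarrow> C1_on V (\<lambda>x. pmf (\<phi> x) i)" for \<phi> :: "real ^ 'm \<Rightarrow> nat pmf" and V n
  proof (cases "n = 0")
    case True
    have "\<phi> x \<in> \<N>" if "x \<in> interior V" for x using that \<open>\<phi> ` V \<subseteq> \<N>\<close> interior_subset by blast
    then show ?thesis using True positive by (intro differentiable_on_zero) simp
  next
    case False
    then show ?thesis
      using differentiable_on_subset[OF C1_on_imp_differentiable_on[OF that(2)] interior_subset, of n] by simp
  qed
  show ?thesis
  proof (cases \<S>)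
    case (Global D \<gamma>)
    then have g: "\<gamma> ` D = \<N>" "inj_on \<gamma> D" using finite_dim by (simp_all add: global_parametrization_def)
    show ?thesis
    proof (intro exI[of _ "interior D"] exI[of _ \<gamma>] conjI allI diff)
      show "C1_on D (\<lambda>x. pmf (\<gamma> x) i)" if "i \<ge> 1" for i using C1[OF that] Global by simp
      show "inj_on \<gamma> (interior D)" by (rule inj_on_subset[OF g(2) interior_subset])
      show "\<gamma> ` interior D \<subseteq> \<N>" using g interior_subset by blast
    qed (use g N Global in auto)
  next
    case (Atlas A)
    then have em: "embedded_manifold A \<N>" using finite_dim by simp
    obtain V \<phi> where V: "(V, \<phi>) \<in> A" "N \<in> \<phi> ` interior V" using N Atlas by auto
    have sub: "\<phi> ` V \<subseteq> \<N>" using em V unfolding embedded_manifold_def by blast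
    have "\<exists>\<psi>. homeomorphism V (pmf ` \<phi> ` V) (\<lambda>x. pmf (\<phi> x)) \<psi>"
      using em V(1) unfolding embedded_manifold_def by blast
    then have "inj_on \<phi> V" unfolding homeomorphism_def inj_on_def by metis
    then have inj: "inj_on \<phi> (interior V)" by (rule inj_on_subset[OF _ interior_subset])
    show ?thesis
    proof (intro exI[of _ "interior V"] exI[of _ \<phi>] conjI allI diff)
      show "C1_on V (\<lambda>x. pmf (\<phi> x) i)" if "i \<ge> 1" for i using C1[OF that] Atlas V(1) by auto
      show "\<phi> ` interior V \<subseteq> \<N>" using sub interior_subset by blast
    qed (use inj sub V in auto)
  qed
qed

text \<open>An injective parametrization may have zero derivative at a given point, but not on a
  whole ball, where it would be constant. The curve is a line segment through a suitable point of
  the ball.\<close>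

lemma curve_with_nonzero_velocity:
  fixes \<phi> :: "real ^ 'm::finite \<Rightarrow> nat pmf"
  assumes W: "open W" "W \<noteq> {}" and sub: "\<phi> ` W \<subseteq> \<N>" and inj: "inj_on \<phi> W"
    and diff: "\<And>n. (\<lambda>x. pmf (\<phi> x) n) differentiable_on W"
  shows "\<exists>e>0. \<exists>H D. D \<noteq> 0 \<and> (\<forall>t::real. \<bar>t\<bar> < e \<longrightarrow> H t \<in> gf ` \<N>) \<and>
    (\<forall>n. continuous_on {-e<..<e} (\<lambda>t. H t $ n)) \<and>
    (\<forall>n. ((\<lambda>t. H t $ n) has_real_derivative D $ n) (at 0))"
proof -
  define L where "L n x = frechet_derivative (\<lambda>x. pmf (\<phi> x) n) (at x)" for n x
  have L: "((\<lambda>x. pmf (\<phi> x) n) has_derivative L n x) (at x)" if "x \<in> W" for n x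
  proof -
    have "(\<lambda>x. pmf (\<phi> x) n) differentiable (at x)"
      using differentiable_on_eq_differentiable_at[OF W(1)] diff that by blast
    then show ?thesis unfolding L_def by (rule frechet_derivative_works[THEN iffD1])
  qed
  obtain x0 d where xd: "d > 0" "ball x0 d \<subseteq> W" using W open_contains_ball by blast
  have "\<exists>x\<in>ball x0 d. \<exists>n v. L n x v \<noteq> 0"
  proof (rule ccontr)
    assume neg: "\<not> ?thesis"
    have const: "pmf (\<phi> x) n = pmf (\<phi> y) n" if "x \<in> ball x0 d" "y \<in> ball x0 d" for x y n
    proof (rule has_derivative_zero_unique[OF _ _ that])
      show "((\<lambda>x. pmf (\<phi> x) n) has_derivative (\<lambda>h. 0)) (at z within ball x0 d)" if "z \<in> ball x0 d" for z
      proof -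
        have "L n z = (\<lambda>h. 0)" using neg that by blast
        then show ?thesis using L[of z n] that xd(2) has_derivative_at_withinI by fastforce
      qed
    qed simp
    define y where "y = x0 + (d / 2) *\<^sub>R axis undefined 1"
    have "norm ((d / 2) *\<^sub>R axis undefined 1 :: real ^ 'm) = d / 2" using xd(1) by (simp add: norm_axis_1)
    then have y: "y \<in> ball x0 d" "y \<noteq> x0" using xd(1) by (auto simp: y_def dist_norm)
    have "\<phi> y = \<phi> x0" using const[OF y(1), of x0] xd(1) by (intro pmf_eqI) simp
    then show False using inj y xd by (auto simp: inj_on_def subset_iff)
  qed
  then obtain x n0 v where x: "x \<in> ball x0 d" "L n0 x v \<noteq> 0" by blast
  have xW: "x \<in> W" using x xd by blast
  obtain r where r: "r > 0" "ball x r \<subseteq> W" using W(1) xW open_contains_ball by blast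
  define e where "e = r / (norm v + 1)"
  have e: "e > 0" using r by (simp add: e_def add_nonneg_pos)
  have line: "x + t *\<^sub>R v \<in> W" if "\<bar>t\<bar> < e" for t
  proof -
    have "\<bar>t\<bar> * norm v \<le> \<bar>t\<bar> * (norm v + 1)" by (simp add: mult_left_mono)
    also have "\<dots> < r" using that by (simp add: e_def pos_less_divide_eq add_nonneg_pos)
    finally show ?thesis using r(2) by (auto simp: subset_iff dist_norm)
  qed
  define H where "H t = gf (\<phi> (x + t *\<^sub>R v))" for t :: real
  define D where "D = Abs_fps (\<lambda>n. L n x v)"
  have der: "((\<lambda>t. H t $ n) has_derivative (\<lambda>h. L n (x + t *\<^sub>R v) (h *\<^sub>R v))) (at t)" if "\<bar>t\<bar> < e" for n t
  proof -
    have "((\<lambda>t. x + t *\<^sub>R v) has_derivative (\<lambda>h. h *\<^sub>R v)) (at t)"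
      by (auto intro!: derivative_eq_intros)
    from has_derivative_compose[OF this L[OF line[OF that]]] show ?thesis by (simp add: H_def)
  qed
  show ?thesis
  proof (intro exI[of _ e] exI[of _ H] exI[of _ D] conjI allI impI e)
    show "D \<noteq> 0" using x(2) by (metis D_def fps_nth_Abs_fps fps_zero_nth)
    show "H t \<in> gf ` \<N>" if "\<bar>t\<bar> < e" for t using line[OF that] sub by (auto simp: H_def)
    show "continuous_on {-e<..<e} (\<lambda>t. H t $ n)" for n
      by (rule has_derivative_continuous_on[of _ _ "\<lambda>t h. L n (x + t *\<^sub>R v) (h *\<^sub>R v)"])
         (auto intro!: has_derivative_at_withinI[OF der])
    show "((\<lambda>t. H t $ n) has_real_derivative D $ n) (at 0)" for n
    proof -
      have lin: "linear (L n x)" using L[OF xW] has_derivative_linear by blast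
      have "(\<lambda>h. L n x (h *\<^sub>R v)) = (*) (D $ n)"
        by (rule ext) (simp add: D_def linear_scale[OF lin] mult.commute)
      then show ?thesis using der[of 0 n] e by (simp add: has_field_derivative_def)
    qed
  qed
qed

section \<open>Commutativity of the whole model\<close>

lemma stopping_model_commutes:
  fixes \<S> :: "'m::finite model_structure"
  assumes positive: "\<And>N. N \<in> \<N> \<Longrightarrow> pmf N 0 = 0"
    and finite_dim: "finite_dimensional \<S> \<N>"
    and closed: "closed_under_pgf_comp \<N>"
    and C1: "\<And>i. i \<ge> 1 \<Longrightarrow> C1_in_parameters \<S> (\<lambda>N. pmf N i)"
    and interior: "model_interior \<S> \<noteq> {}"
    and M: "M \<in> \<N>" "N \<in> \<N>"
  shows "pgf_commute M N"
proof -
  define S where "S = gf ` \<N>"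
  have S0: "w $ 0 = 0" and Snz: "w \<noteq> 0" if "w \<in> S" for w
    using that positive fps_deriv_gf_nonzero(1) by (auto simp: S_def)
  have Scomp: "v oo w \<in> S" if vw: "v \<in> S" "w \<in> S" for v w
  proof -
    obtain A B where AB: "A \<in> \<N>" "B \<in> \<N>" "v = gf A" "w = gf B" using vw by (auto simp: S_def)
    then have "v oo w = gf (A \<circ>\<^sub>g B)" using gf_pgf_comp[OF positive[OF AB(2)]] by simp
    then show ?thesis using pgf_comp_in[OF closed AB(1,2)] by (auto simp: S_def)
  qed
  have chart: "\<exists>V (\<phi> :: real ^ 'm \<Rightarrow> real fps) U. open U \<and> fps_nth P \<in> U \<and>
      {Q \<in> S. fps_nth Q \<in> U} \<subseteq> \<phi> ` V \<and> (\<forall>n. (\<lambda>x. \<phi> x $ n) differentiable_on V)" if P: "P \<in> S" for P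
  proof -
    obtain K where K: "K \<in> \<N>" "P = gf K" using P by (auto simp: S_def)
    have "\<exists>V (\<phi> :: real ^ 'm \<Rightarrow> nat pmf) U. open U \<and> pmf K \<in> U \<and> {Q \<in> \<N>. pmf Q \<in> U} \<subseteq> \<phi> ` V \<and>
        (\<forall>n. (\<lambda>x. pmf (\<phi> x) n) differentiable_on V)"
      by (rule local_parametrization[OF _ finite_dim _ K(1)]) (fact positive, fact C1)
    then obtain V and \<phi> :: "real ^ 'm \<Rightarrow> nat pmf" and U where U: "open U" "pmf K \<in> U"
        "{Q \<in> \<N>. pmf Q \<in> U} \<subseteq> \<phi> ` V" "\<forall>n. (\<lambda>x. pmf (\<phi> x) n) differentiable_on V"
      by (elim exE conjE)
    have nth: "fps_nth (gf Q) = pmf Q" for Q by (rule ext) simp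
    show ?thesis
    proof (intro exI[of _ V] exI[of _ "\<lambda>x. gf (\<phi> x)"] exI[of _ U] conjI)
      show "fps_nth P \<in> U" unfolding K(2) nth by (rule U(2))
      show "{Q \<in> S. fps_nth Q \<in> U} \<subseteq> (\<lambda>x. gf (\<phi> x)) ` V"
      proof
        fix R assume "R \<in> {Q \<in> S. fps_nth Q \<in> U}"
        then obtain Q where "Q \<in> \<N>" "R = gf Q" "pmf Q \<in> U" unfolding S_def using nth by auto
        then show "R \<in> (\<lambda>x. gf (\<phi> x)) ` V" using U(3) by blast
      qed
      show "\<forall>n. (\<lambda>x. gf (\<phi> x) $ n) differentiable_on V" unfolding gf_nth by (rule U(4))
    qed (rule U(1))
  qed
  obtain N1 where N1: "N1 \<in> model_interior \<S>" using interior by blast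
  have "\<exists>W (\<phi> :: real ^ 'm \<Rightarrow> nat pmf). open W \<and> N1 \<in> \<phi> ` W \<and> \<phi> ` W \<subseteq> \<N> \<and> inj_on \<phi> W \<and>
      (\<forall>n. (\<lambda>x. pmf (\<phi> x) n) differentiable_on W)"
    by (rule interior_parametrization[OF _ finite_dim _ N1]) (fact positive, fact C1)
  then obtain W and \<phi> :: "real ^ 'm \<Rightarrow> nat pmf" where W: "open W" "N1 \<in> \<phi> ` W" "\<phi> ` W \<subseteq> \<N>" "inj_on \<phi> W"
      "\<forall>n. (\<lambda>x. pmf (\<phi> x) n) differentiable_on W"
    by (elim exE conjE)
  have "W \<noteq> {}" using W(2) by blast
  have "\<exists>e>0. \<exists>H D. D \<noteq> 0 \<and> (\<forall>t::real. \<bar>t\<bar> < e \<longrightarrow> H t \<in> S) \<and>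
      (\<forall>n. continuous_on {-e<..<e} (\<lambda>t. H t $ n)) \<and>
      (\<forall>n. ((\<lambda>t. H t $ n) has_real_derivative D $ n) (at 0))"
    unfolding S_def by (rule curve_with_nonzero_velocity[OF W(1) \<open>W \<noteq> {}\<close> W(3,4)]) (use W(5) in blast)
  then obtain e H D where D: "e > 0" "D \<noteq> 0" "\<And>t::real. \<bar>t\<bar> < e \<Longrightarrow> H t \<in> S"
      "\<And>n. continuous_on {-e<..<e} (\<lambda>t. H t $ n)" "\<And>n. ((\<lambda>t. H t $ n) has_real_derivative D $ n) (at 0)"
    by blast
  have H0: "H 0 \<in> S" using D(3)[of 0] D(1) by simp
  have D0: "D $ 0 = 0"
  proof -
    have "((\<lambda>t. H t $ 0) has_real_derivative 0) (at 0)"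
      by (rule has_field_derivative_transform_within[of "\<lambda>_. 0" 0 0 UNIV e])
         (use D S0 in \<open>auto simp: dist_norm\<close>)
    then show ?thesis using D(5)[of 0] DERIV_unique by blast
  qed
  have "\<exists>u\<in>S. \<exists>(J :: ((real ^ 'm) \<times> real) set) X. finite J \<and>
      (\<forall>w\<in>S. \<exists>c. pull (w oo u) (fps_to_fls D / fps_to_fls (fps_deriv (H 0))) = (\<Sum>b\<in>J. fls_const (c b) * X b))"
    by (rule finite_dimensional_pull[where S = S and H = H and e = e])
       (fact S0, fact Snz, fact Scomp, fact chart, fact D(1), fact D(3), fact D(4), fact D(5))
  then obtain u and J :: "((real ^ 'm) \<times> real) set" and X where u: "u \<in> S" "finite J"
    and span: "\<forall>w\<in>S. \<exists>c. pull (w oo u) (fps_to_fls D / fps_to_fls (fps_deriv (H 0)))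
        = (\<Sum>b\<in>J. fls_const (c b) * X b)"
    by (elim bexE exE conjE)
  have "\<exists>Z. Z \<noteq> 0 \<and> Z $ 0 = 0 \<and> (\<forall>w\<in>S. \<exists>k. k \<noteq> 0 \<and> Z oo w = fps_const k * fps_deriv w * Z)"
    by (rule pull_eigenvector[where S = S and f = "H 0" and D = D and u = u and J = J and X = X])
       (fact S0, fact Snz, fact Scomp, fact H0, fact D(2), fact D0, fact u(1), fact u(2), rule bspec[OF span])
  then obtain Z where Z: "Z \<noteq> 0" "\<forall>w\<in>S. \<exists>k. k \<noteq> 0 \<and> Z oo w = fps_const k * fps_deriv w * Z"
    by blast
  show ?thesis
    by (rule eigenvector_imp_commute[OF _ closed Z(1) _ M]) (use Z(2) positive in \<open>auto simp: S_def\<close>)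
qed

section \<open>The interior in terms of the first coefficient\<close>

lemma interior_interval:
  fixes J :: "real set"
  assumes conn: "connected J" and pos: "\<And>x. x \<in> J \<Longrightarrow> 0 < x" and bdd: "bdd_above J"
    and small: "\<And>r. r > 0 \<Longrightarrow> \<exists>x\<in>J. x < r"
  shows "0 < Sup J" "{0<..<Sup J} \<subseteq> J" "interior J = {0<..<Sup J}"
proof -
  have ne: "J \<noteq> {}" using small[of 1] by auto
  show S: "0 < Sup J" using small[of 1] pos cSup_upper[OF _ bdd] less_le_trans by fastforce
  show sub: "{0<..<Sup J} \<subseteq> J"
  proof
    fix t assume t: "t \<in> {0<..<Sup J}"
    then obtain a where a: "a \<in> J" "a < t" using small by auto
    obtain b where b: "b \<in> J" "t < b" using t less_cSup_iff[OF ne bdd] by auto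
    show "t \<in> J" using connected_contains_Ioo[OF conn a(1) b(1)] a b by auto
  qed
  show "interior J = {0<..<Sup J}"
  proof
    show "{0<..<Sup J} \<subseteq> interior J" using sub by (rule interior_maximal) simp
    show "interior J \<subseteq> {0<..<Sup J}"
    proof
      fix t assume t: "t \<in> interior J"
      then obtain e where e: "e > 0" "cball t e \<subseteq> J" using mem_interior_cball by blast
      then have "t + e \<in> J" by (auto simp: dist_norm subset_iff)
      then have "t + e \<le> Sup J" by (rule cSup_upper[OF _ bdd])
      then show "t \<in> {0<..<Sup J}" using e pos interior_subset t by auto
    qed
  qed
qed

text \<open>The intervals in \<open>theta_K\<close> are closed on the right, so \<open>s\<close>
  itself may fail to qualify; every \<open>t < s\<close> does.\<close>

lemma theta_K_ge:
  assumes "{0<..<s} \<subseteq> theta_set N0"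
  shows "s \<le> theta_K N0"
proof (rule dense_le)
  fix t assume "t < s"
  then have "{0<..t} \<subseteq> theta_set N0" using assms by force
  moreover have "bdd_above {t. {0<..t} \<subseteq> theta_set N0}"
  proof (rule bdd_aboveI[of _ 1])
    fix t assume t: "t \<in> {t. {0<..t} \<subseteq> theta_set N0}"
    show "t \<le> 1"
    proof (cases "t > 0")
      case True
      then have "t \<in> theta_set N0" using t by auto
      then show ?thesis by (auto simp: theta_set_def pmf_le_1)
    qed simp
  qed
  ultimately show "t \<le> theta_K N0" unfolding theta_K_def by (intro cSup_upper) auto
qed

text \<open>The coefficient \<open>p\<^sub>1\<close> is a global coordinate on the model. Invariance
  of domain, applied to it on interior parameters and to its inverse on the interior of
  \<open>J\<close>, identifies the two interiors.\<close>

lemma model_interior_of_commuting_family: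
  fixes \<N> :: "nat pmf set" and \<S> :: "'m::finite model_structure" and N0 :: "nat pmf"
  assumes positive: "\<And>N. N \<in> \<N> \<Longrightarrow> pmf N 0 = 0"
    and finite_dim: "finite_dimensional \<S> \<N>"
    and conn: "model_connected \<S> \<N>"
    and interior_nonempty: "model_interior \<S> \<noteq> {}"
    and C1: "\<And>i. i \<ge> 1 \<Longrightarrow> C1_in_parameters \<S> (\<lambda>N. pmf N i)"
    and N0: "pmf N0 0 = 0" "0 < pmf N0 1" "pmf N0 1 < 1" and sub: "\<N> \<subseteq> commutant N0"
  defines "J \<equiv> (\<lambda>N. pmf N 1) ` \<N>"
  shows "connected J" and "model_interior \<S> = {N \<in> \<N>. pmf N 1 \<in> interior J}"
    and "inj_on (\<lambda>N. pmf N 1) (commutant N0)"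
proof -
  have "\<forall>n. \<exists>g. continuous_on UNIV g \<and> (\<forall>N\<in>commutant N0. pmf N n = g (pmf N 1))"
    by (intro allI commutant_coefficients N0)
  from choice[OF this] obtain g :: "nat \<Rightarrow> real \<Rightarrow> real"
    where g: "\<forall>n. continuous_on UNIV (g n) \<and> (\<forall>N\<in>commutant N0. pmf N n = g n (pmf N 1))" by (rule exE)
  then have gc: "\<And>n. continuous_on UNIV (g n)" and gN: "\<And>n N. N \<in> commutant N0 \<Longrightarrow> pmf N n = g n (pmf N 1)"
    by blast+
  show inj: "inj_on (\<lambda>N. pmf N 1) (commutant N0)"
    by (rule inj_onI, rule pmf_eqI) (metis gN)
  have injN: "inj_on (\<lambda>N. pmf N 1) \<N>" by (rule inj_on_subset[OF inj sub])
  \<comment> \<open>A continuous injection of a nonempty open set into the line forces the parameter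
    space to have dimension 1 and the image to be open.\<close>
  have param: "open ((\<lambda>x. pmf (\<phi> x) 1) ` W) \<and> (\<lambda>x. pmf (\<phi> x) 1) ` W \<subseteq> J \<and> (W \<noteq> {} \<longrightarrow> CARD('m) = 1)"
    if W: "open W" "\<phi> ` W \<subseteq> \<N>" "inj_on \<phi> W" "\<forall>n. (\<lambda>x. pmf (\<phi> x) n) differentiable_on W"
    for W and \<phi> :: "real ^ 'm \<Rightarrow> nat pmf"
  proof (intro conjI impI)
    have c: "continuous_on W (\<lambda>x. pmf (\<phi> x) 1)"
      using W(4) by (intro differentiable_imp_continuous_on) blast
    have i: "inj_on (\<lambda>x. pmf (\<phi> x) 1) W"
    proof (rule inj_onI)
      fix x y assume xy: "x \<in> W" "y \<in> W" "pmf (\<phi> x) 1 = pmf (\<phi> y) 1"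
      then have "\<phi> x = \<phi> y" using W(2) by (intro inj_onD[OF injN]) auto
      then show "x = y" using xy W(3) by (auto dest: inj_onD)
    qed
    show "open ((\<lambda>x. pmf (\<phi> x) 1) ` W)" by (rule invariance_of_domain_gen[OF W(1) c i]) simp
    show "(\<lambda>x. pmf (\<phi> x) 1) ` W \<subseteq> J" using W(2) by (auto simp: J_def)
    show "CARD('m) = 1" if "W \<noteq> {}"
    proof -
      have "dim (UNIV :: (real ^ 'm) set) \<le> dim (UNIV :: real set)"
        by (rule invariance_of_dimension_subspaces[OF _ _ _ c _ i that]) (use W(1) in auto)
      then have "CARD('m) \<le> 1" by simp
      then show ?thesis using zero_less_card_finite[where 'a = 'm] by linarith
    qed
  qed
  have ex: "\<exists>W (\<phi> :: real ^ 'm \<Rightarrow> nat pmf). open W \<and> N \<in> \<phi> ` W \<and> \<phi> ` W \<subseteq> \<N> \<and> inj_on \<phi> W \<and>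
      (\<forall>n. (\<lambda>x. pmf (\<phi> x) n) differentiable_on W)" if "N \<in> model_interior \<S>" for N
    by (rule interior_parametrization[OF _ finite_dim _ that]) (fact positive, fact C1)
  have dim1: "CARD('m) = 1"
  proof -
    obtain N where "N \<in> model_interior \<S>" using interior_nonempty by blast
    from ex[OF this] obtain W and \<phi> :: "real ^ 'm \<Rightarrow> nat pmf"
      where "open W" "N \<in> \<phi> ` W" "\<phi> ` W \<subseteq> \<N>" "inj_on \<phi> W" "\<forall>n. (\<lambda>x. pmf (\<phi> x) n) differentiable_on W"
      by (elim exE conjE)
    then show ?thesis using param[of W \<phi>] by blast
  qed
  have le: "model_interior \<S> \<subseteq> {N \<in> \<N>. pmf N 1 \<in> interior J}"
  proof
    fix N assume "N \<in> model_interior \<S>"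
    from ex[OF this] obtain W and \<phi> :: "real ^ 'm \<Rightarrow> nat pmf"
      where W: "open W" "N \<in> \<phi> ` W" "\<phi> ` W \<subseteq> \<N>" "inj_on \<phi> W" "\<forall>n. (\<lambda>x. pmf (\<phi> x) n) differentiable_on W"
      by (elim exE conjE)
    have "pmf N 1 \<in> (\<lambda>x. pmf (\<phi> x) 1) ` W" using W(2) by auto
    then have "pmf N 1 \<in> interior J" using param[OF W(1,3,4,5)] interiorI by blast
    then show "N \<in> {N \<in> \<N>. pmf N 1 \<in> interior J}" using W(2,3) by auto
  qed
  have dims: "DIM(real ^ 'm) \<le> DIM(real)" using dim1 by simp
  have "connected J \<and> {N \<in> \<N>. pmf N 1 \<in> interior J} \<subseteq> model_interior \<S>"
  proof (cases \<S>)
    case (Global D \<gamma>)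
    then have D: "\<gamma> ` D = \<N>" "inj_on \<gamma> D" "connected D"
      using finite_dim conn by (simp_all add: global_parametrization_def)
    have c: "continuous_on D (\<lambda>x. pmf (\<gamma> x) 1)"
      using C1[of 1] Global by (intro differentiable_imp_continuous_on C1_on_imp_differentiable_on) simp
    have J: "J = (\<lambda>x. pmf (\<gamma> x) 1) ` D" using D(1) by (auto simp: J_def)
    have i: "inj_on (\<lambda>x. pmf (\<gamma> x) 1) D"
      using comp_inj_on[OF D(2)] injN D(1) by (simp add: comp_def)
    \<comment> \<open>A global parametrization comes without continuity of its inverse; on a
      connected subset of a line, a continuous injection into the reals is a homeomorphism onto its
      image.\<close>
    have "path_connected D"
      using D(3) connected_convex_1_gen[of D] dim1 convex_imp_path_connected by simp
    then obtain h where h: "homeomorphism D J (\<lambda>x. pmf (\<gamma> x) 1) h"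
      unfolding J using injective_into_1d_eq_homeomorphism[OF c] i by blast
    have oh: "open (h ` interior J)"
    proof (rule invariance_of_domain_gen)
      have hc: "continuous_on J h" and hi: "inj_on h J"
        using h by (auto simp: homeomorphism_def inj_on_def)
      show "continuous_on (interior J) h" by (rule continuous_on_subset[OF hc interior_subset])
      show "inj_on h (interior J)" by (rule inj_on_subset[OF hi interior_subset])
    qed (use dim1 in simp_all)
    have "h ` interior J \<subseteq> D" using h interior_subset[of J] by (auto simp: homeomorphism_def)
    then have hD: "h ` interior J \<subseteq> interior D" using oh by (rule interior_maximal)
    have "N \<in> \<gamma> ` interior D" if N: "N \<in> \<N>" "pmf N 1 \<in> interior J" for N
    proof -
      obtain x where x: "x \<in> D" "N = \<gamma> x" using N D(1) by blast
      have "h (pmf N 1) = x" using h x by (simp add: homeomorphism_def)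
      then show ?thesis using hD N(2) x(2) by blast
    qed
    moreover have "connected J" unfolding J by (rule connected_continuous_image[OF c D(3)])
    ultimately show ?thesis using Global by auto
  next
    case (Atlas A)
    then have em: "embedded_manifold A \<N>" using finite_dim by simp
    have conn': "connected (pmf ` \<N>)" using conn Atlas by simp
    have "connected J"
    proof -
      have J: "J = (\<lambda>p. p 1) ` pmf ` \<N>" by (auto simp: J_def image_image)
      have "continuous_on (pmf ` \<N>) (\<lambda>p :: nat \<Rightarrow> real. p 1)"
        by (rule continuous_on_subset[OF continuous_on_product_coordinates]) simp
      then show ?thesis unfolding J using conn' by (rule connected_continuous_image)
    qed
    moreover have "N \<in> model_interior \<S>" if N: "N \<in> \<N>" "pmf N 1 \<in> interior J" for N
    proof -
      have "N \<in> (\<Union>(V, \<phi>)\<in>A. \<phi> ` V)" using N(1) em unfolding embedded_manifold_def by blast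
      then obtain V \<phi> where V: "(V, \<phi>) \<in> A" "N \<in> \<phi> ` V" by blast
      have "openin (top_of_set (pmf ` \<N>)) (pmf ` \<phi> ` V)"
        using em V(1) unfolding embedded_manifold_def by blast
      then obtain U where U: "open U" "pmf ` \<phi> ` V = pmf ` \<N> \<inter> U" by (auto simp: openin_open)
      have "\<exists>\<psi>. homeomorphism V (pmf ` \<phi> ` V) (\<lambda>x. pmf (\<phi> x)) \<psi>"
        using em V(1) unfolding embedded_manifold_def by blast
      then obtain \<psi> where \<psi>: "homeomorphism V (pmf ` \<phi> ` V) (\<lambda>x. pmf (\<phi> x)) \<psi>" ..
      \<comment> \<open>The coefficient sequence as a continuous function of
        \<open>p\<^sub>1\<close>. It is meaningful only on \<open>J\<close>, and \<open>T\<close>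
        restricts it to values whose members lie in the chart.\<close>
      define h where "h t = (\<lambda>n. g n t)" for t
      have hc: "continuous_on UNIV h"
        unfolding h_def[abs_def] by (rule continuous_on_coordinatewise_then_product) (rule gc)
      have hN: "h (pmf M 1) = pmf M" if "M \<in> \<N>" for M
        by (rule ext) (simp only: h_def gN[OF subsetD[OF sub that], symmetric])
      define T where "T = interior J \<inter> h -` U"
      have "open (h -` U)" using U(1) hc by (rule open_vimage)
      then have oT: "open T" unfolding T_def by (intro open_Int open_interior)
      have hT: "h t \<in> pmf ` \<phi> ` V" "h t 1 = t" if t: "t \<in> T" for t
      proof -
        have "t \<in> J" using t interior_subset by (auto simp: T_def)
        then obtain M where M: "M \<in> \<N>" "t = pmf M 1" by (auto simp: J_def)
        show "h t \<in> pmf ` \<phi> ` V" unfolding U(2) using M hN[OF M(1)] t by (auto simp: T_def)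
        show "h t 1 = t" using M hN[OF M(1)] by simp
      qed
      have "open ((\<lambda>t. \<psi> (h t)) ` T)"
      proof (rule invariance_of_domain_gen[OF oT])
        have "continuous_on (pmf ` \<phi> ` V) \<psi>" using \<psi> by (simp add: homeomorphism_def)
        then show "continuous_on T (\<lambda>t. \<psi> (h t))"
          by (rule continuous_on_compose2) (use hT(1) continuous_on_subset[OF hc] in auto)
        show "inj_on (\<lambda>t. \<psi> (h t)) T"
        proof (rule inj_onI)
          fix s t assume st: "s \<in> T" "t \<in> T" "\<psi> (h s) = \<psi> (h t)"
          have inv: "pmf (\<phi> (\<psi> p)) = p" if "p \<in> pmf ` \<phi> ` V" for p
            by (rule homeomorphism_apply2[OF \<psi> that])
          have "h s = pmf (\<phi> (\<psi> (h s)))" by (rule inv[OF hT(1)[OF st(1)], symmetric])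
          also have "\<dots> = pmf (\<phi> (\<psi> (h t)))" by (simp only: st(3))
          also have "\<dots> = h t" by (rule inv[OF hT(1)[OF st(2)]])
          finally have "h s 1 = h t 1" by (rule fun_cong)
          then show "s = t" by (simp only: hT(2)[OF st(1)] hT(2)[OF st(2)])
        qed
      qed (use dim1 in simp)
      moreover have "(\<lambda>t. \<psi> (h t)) ` T \<subseteq> V"
        using hT(1) homeomorphism_image2[OF \<psi>] by blast
      ultimately have int: "(\<lambda>t. \<psi> (h t)) ` T \<subseteq> interior V" by (rule interior_maximal[rotated])
      obtain x where x: "x \<in> V" "N = \<phi> x" using V(2) by blast
      have "pmf N \<in> U" using U(2) V(2) by blast
      then have "pmf N 1 \<in> T" using N hN[OF N(1)] by (simp add: T_def)
      moreover have "\<psi> (h (pmf N 1)) = x" using hN[OF N(1)] homeomorphism_apply1[OF \<psi> x(1)] x(2) by simp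
      ultimately have "x \<in> interior V" using int by blast
      then have "N \<in> \<phi> ` interior V" using x(2) by blast
      then show ?thesis using V(1) Atlas by auto
    qed
    ultimately show ?thesis by blast
  qed
  then show "connected J" "model_interior \<S> = {N \<in> \<N>. pmf N 1 \<in> interior J}" using le by blast+
qed

unbundle no fps_syntax
unbundle vec_syntax

theorem theorem4:
  fixes \<N> :: "nat pmf set" and \<S> :: "'m::finite model_structure"
  assumes positive: "\<And>N. N \<in> \<N> \<Longrightarrow> pmf N 0 = 0"
    and finite_dim: "finite_dimensional \<S> \<N>"
    and closed: "closed_under_pgf_comp \<N>"
    and conn: "model_connected \<S> \<N>"
    and interior_nonempty: "model_interior \<S> \<noteq> {}"
    and C1: "\<And>i. i \<ge> 1 \<Longrightarrow> C1_in_parameters \<S> (\<lambda>N. pmf N i)"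
  shows "(\<forall>N1\<in>\<N>. \<forall>N2\<in>\<N>. pgf_commute N1 N2) \<and>
    (\<exists>N0. pmf N0 0 = 0 \<and> 0 < pmf N0 1 \<and> pmf N0 1 < 1 \<and>
       \<N> \<subseteq> commutant N0 \<and>
       (\<exists>\<theta>\<^sub>N. 0 < \<theta>\<^sub>N \<and> \<theta>\<^sub>N \<le> theta_K N0 \<and>
          model_interior \<S> = {N \<in> commutant N0. pmf N 1 \<in> {0<..<\<theta>\<^sub>N}}))"
proof -
  have comm: "pgf_commute M N" if "M \<in> \<N>" "N \<in> \<N>" for M N
    by (rule stopping_model_commutes[OF _ finite_dim closed _ interior_nonempty that]) (fact positive, fact C1)
  obtain N1 where N1: "N1 \<in> model_interior \<S>" using interior_nonempty by blast
  have unc: "uncountable \<N>"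
  proof
    assume cN: "countable \<N>"
    have "\<exists>W (\<phi> :: real ^ 'm \<Rightarrow> nat pmf). open W \<and> N1 \<in> \<phi> ` W \<and> \<phi> ` W \<subseteq> \<N> \<and> inj_on \<phi> W \<and>
        (\<forall>n. (\<lambda>x. pmf (\<phi> x) n) differentiable_on W)"
      by (rule interior_parametrization[OF _ finite_dim _ N1]) (fact positive, fact C1)
    then obtain W and \<phi> :: "real ^ 'm \<Rightarrow> nat pmf"
      where W: "open W" "N1 \<in> \<phi> ` W" "\<phi> ` W \<subseteq> \<N>" "inj_on \<phi> W" by blast
    have cW: "countable W"
      using countable_image_inj_on[OF countable_subset[OF W(3) cN] W(4)] .
    obtain x r where "r > 0" "ball x r \<subseteq> W" using W(1,2) open_contains_ball by blast
    then show False using uncountable_ball[of r x] countable_subset[OF _ cW] by blast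
  qed
  obtain N0 where N0: "N0 \<in> \<N>" "0 < pmf N0 1" "pmf N0 1 < 1"
    using commuting_family_contains_contraction[of \<N>] positive comm unc by blast
  have N00: "pmf N0 0 = 0" by (rule positive[OF N0(1)])
  have sub: "\<N> \<subseteq> commutant N0" using positive comm N0(1) by (auto simp: commutant_def)
  define J where "J = (\<lambda>N. pmf N 1) ` \<N>"
  have int: "connected J" "model_interior \<S> = {N \<in> \<N>. pmf N 1 \<in> interior J}"
      "inj_on (\<lambda>N. pmf N 1) (commutant N0)"
    unfolding J_def
    by (rule model_interior_of_commuting_family[OF _ finite_dim conn interior_nonempty _ N00 N0(2,3) sub],
        fact positive, fact C1)+
  have bdd: "bdd_above J" by (rule bdd_aboveI[of _ 1]) (auto simp: J_def pmf_le_1)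
  have pos: "0 < x" if "x \<in> J" for x
    using that commutant_pmf_1_pos[OF N00 N0(2,3)] sub by (auto simp: J_def)
  \<comment> \<open>Iterates of \<open>N0\<close> make the values of \<open>p\<^sub>1\<close>
    accumulate at 0, so \<open>J\<close> is an interval starting there.\<close>
  have powers: "pmf N0 1 ^ Suc n \<in> J" for n
  proof (induction n)
    case 0
    then show ?case using N0(1) by (simp add: J_def)
  next
    case (Suc n)
    then obtain N where N: "N \<in> \<N>" "pmf N0 1 ^ Suc n = pmf N 1" by (auto simp: J_def)
    have "pmf (N0 \<circ>\<^sub>g N) 1 = pmf N0 1 * pmf N 1"
      by (rule pmf_1_pgf_comp[OF positive[OF N(1)] N00])
    then have "pmf N0 1 ^ Suc (Suc n) = pmf (N0 \<circ>\<^sub>g N) 1" using N(2) by simp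
    then show ?case using pgf_comp_in[OF closed N0(1) N(1)] unfolding J_def by blast
  qed
  have small: "\<exists>x\<in>J. x < r" if "r > 0" for r
  proof -
    have "(\<lambda>n. pmf N0 1 ^ n) \<longlonglongrightarrow> 0" by (rule LIMSEQ_realpow_zero) (use N0 in auto)
    then have "(\<lambda>n. pmf N0 1 ^ Suc n) \<longlonglongrightarrow> 0" by (rule LIMSEQ_Suc)
    then have "\<forall>\<^sub>F n in sequentially. pmf N0 1 ^ Suc n < r" by (rule order_tendstoD) (rule that)
    then obtain n where "pmf N0 1 ^ Suc n < r" by (auto simp: eventually_sequentially)
    then show ?thesis using powers by blast
  qed
  have J: "0 < Sup J" "{0<..<Sup J} \<subseteq> J" "interior J = {0<..<Sup J}"
    by (rule interior_interval[OF int(1) _ bdd], fact pos, fact small)+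
  have "J \<subseteq> theta_set N0" unfolding J_def theta_set_def by (rule image_mono[OF sub])
  with J(2) have "{0<..<Sup J} \<subseteq> theta_set N0" by (rule subset_trans)
  then have K: "Sup J \<le> theta_K N0" by (rule theta_K_ge)
  have "model_interior \<S> = {N \<in> commutant N0. pmf N 1 \<in> {0<..<Sup J}}"
  proof
    show "model_interior \<S> \<subseteq> {N \<in> commutant N0. pmf N 1 \<in> {0<..<Sup J}}"
      unfolding int(2) J(3) using sub by blast
    show "{N \<in> commutant N0. pmf N 1 \<in> {0<..<Sup J}} \<subseteq> model_interior \<S>"
    proof
      fix N assume N: "N \<in> {N \<in> commutant N0. pmf N 1 \<in> {0<..<Sup J}}"
      then have "pmf N 1 \<in> J" using J(2) by blast
      \<comment> \<open>The set on the right ranges over the whole commutant, but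
        \<open>p\<^sub>1\<close> separates its elements and each value in this interval is taken by
        a member of the model.\<close>
      then obtain M where M: "M \<in> \<N>" "pmf N 1 = pmf M 1" by (auto simp: J_def)
      have "N = M" using inj_onD[OF int(3) M(2)] N M(1) sub by blast
      then show "N \<in> model_interior \<S>" unfolding int(2) J(3) using M N by blast
    qed
  qed
  then show ?thesis
    using comm by (intro conjI ballI exI[of _ N0] exI[of _ "Sup J"] N00 N0(2,3) sub J(1) K)
qed

end
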